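(* The sixteen cells $e^j$, $j = 0,3,5,6,7,8,9,10,11,12,13,14,15,16,18,21$, defined in the context give a cellular decomposition of $Spin(7)$: $$Spin(7) = e^0 \cup e^3 \cup e^5 \cup e^6 \cup e^7 \cup e^8 \cup e^9 \cup e^{10} \cup e^{11} \cup e^{12} \cup e^{13} \cup e^{14} \cup e^{15} \cup e^{16} \cup e^{18} \cup e^{21}.$$
   Context: **Groups.** Let $\mathfrak C$ be the Cayley algebra (octonions) over $\mathbb R$ with basis $e_0,\dots,e_7$, where $e_0$ is the unit, $e_i^2=-e_0$ and $e_ie_j=-e_je_i$ for distinct $i,j\ge1$, and $e_ie_j=e_k$, $e_je_k=e_i$, $e_ke_i=e_j$ for $(i,j,k)\in\{(1,2,3),(1,4,5),(1,6,7),(2,5,7),(2,6,4),(3,4,7),(3,5,6)\}$. $SO(8)$ acts on $\mathfrak C\cong\mathbb R^8$ by matrices in the basis $e_0,\dots,e_7$ (column vectors), and $SO(7)$ is the subgroup of $SO(8)$ fixing $e_0$. Put $$Spin(7)=\{\tilde g\in SO(8)\mid \text{there is } g\in SO(7) \text{ with } g(x)\tilde g(y)=\tilde g(xy)\text{ for all }x,y\in\mathfrak C\}.$$ **Matrices.** $D^i$ is the closed unit disc in $\mathbb R^i$. For $\mathbf x=(x_1,x_2,x_3)\in D^3$, $\mathbf y=(y_1,y_2)\in D^2$, $\mathbf z=z_1\in D^1$, $\mathbf w=(w_1,w_2)\in D^2$ put $X=\sqrt{1-x_1^2-x_2^2-x_3^2}$, $Y=\sqrt{1-y_1^2-y_2^2}$,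 $Z=\sqrt{1-z_1^2}$, $W=\sqrt{1-w_1^2-w_2^2}$, and define the block-diagonal $8\times 8$ matrices $A(\mathbf x)=\mathrm{diag}(I_4,M_A)$, $B(\mathbf y)=\mathrm{diag}(I_2,M_B,I_2)$, $D(\mathbf w)=\mathrm{diag}(M_D,I_4)$, with $$M_A=\begin{pmatrix}1-2X^2&-2x_1X&-2x_2X&-2x_3X \\ 2x_1X&1-2X^2&2x_3X&-2x_2X \\ 2x_2X&-2x_3X&1-2X^2&2x_1X \\ 2x_3X&2x_2X&-2x_1X&1-2X^2\end{pmatrix},$$ $$M_B=\begin{pmatrix}y_1&-y_2&-Y&0 \\ y_2&y_1&0&-Y \\ Y&0&y_1&y_2 \\ 0&Y&-y_2&y_1\end{pmatrix},\quad M_D=\begin{pmatrix}w_1&-w_2&-W&0 \\ w_2&w_1&0&-W \\ W&0&w_1&w_2 \\ 0&W&-w_2&w_1\end{pmatrix}.$$ $C(\mathbf z)$ is the matrix fixing $e_0,e_2,e_4,e_6$ with $e_1\mapsto z_1e_1+Ze_3$, $e_3\mapsto -Ze_1+z_1e_3$, $e_5\mapsto z_1e_5+Ze_7$, $e_7\mapsto -Ze_5+z_1e_7$. All these matrices lie in $Spin(7)$. **Cells.** Define maps into $Spin(7)$ by $\varphi_3:D^3\to Spin(7)$, $\varphi_3(\mathbf x)=A(\mathbf x)$; $\varphi_5:D^3\times D^2\to Spin(7)$, $\varphi_5(\mathbf x,\mathbf y)=B(\mathbf y)A(\mathbf x)B(\mathbf y)^{-1}$; $\varphi_6:D^3\times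 D^2\times D^1\to Spin(7)$, $\varphi_6(\mathbf x,\mathbf y,\mathbf z)=C(\mathbf z)B(\mathbf y)A(\mathbf x)B(\mathbf y)^{-1}C(\mathbf z)^{-1}$; $\varphi_7:D^3\times D^2\times D^2\to Spin(7)$, $\varphi_7(\mathbf x,\mathbf y,\mathbf w)=D(\mathbf w)B(\mathbf y)A(\mathbf x)B(\mathbf y)^{-1}D(\mathbf w)^{-1}$. Put $e^0=\{1\}$, $e^i=\mathrm{Im}\,\varphi_i$ for $i=3,5,6,7$, and (products of subsets of the group $Spin(7)$) $e^8=e^5e^3$, $e^9=e^6e^3$, $e^{10}=e^7e^3$, $e^{11}=e^6e^5$, $e^{12}=e^7e^5$, $e^{13}=e^6e^7$, $e^{14}=e^6e^5e^3$, $e^{15}=e^7e^5e^3$, $e^{16}=e^6e^7e^3$, $e^{18}=e^6e^7e^5$, $e^{21}=e^6e^7e^5e^3$. The characteristic map of a product cell $e^{i_1}\cdots e^{i_k}$ is $(v_1,\dots,v_k)\mapsto\varphi_{i_1}(v_1)\cdots\varphi_{i_k}(v_k)$ on the product of the domains. **Cellular decomposition** means the usual finite CW structure with these characteristic maps: each characteristic map is injective on the interior of its domain, the open cells (images of interiors) are pairwise disjoint and their union is the whole space, and the boundary of each domain is mapped into the union of the cells of lower dimension. *)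

theory Defs
  imports "HOL-Analysis.Analysis"
begin

section \<open>Finite cellular decompositions\<close>

text \<open>
  \<open>K i\<close> is the domain and \<open>\<Phi> i\<close> the characteristic map of the \<open>i\<close>-th cell.  A compact convex set
  of affine dimension \<open>d\<close> is a closed disc of dimension \<open>d\<close>, and its relative interior and relative
  frontier are the open disc and its boundary.  They are used instead of \<^const>\<open>interior\<close> and
  \<^const>\<open>frontier\<close> so that all domains, including the one-point domain of a 0-cell, can live in
  one Euclidean space.  In the last clause the lower-dimensional cells are the closed ones; by
  induction on the dimension their union is also the union of the lower-dimensional open cells.
\<close>

definition cellular_decomposition ::
  "'b::t2_space set \<Rightarrow> 'i set \<Rightarrow> ('i \<Rightarrow> nat) \<Rightarrow> ('i \<Rightarrow> 'a::euclidean_space set) \<Rightarrow> ('i \<Rightarrow> 'a \<Rightarrow> 'b) \<Rightarrow> bool"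
  where
  "cellular_decomposition S I dm K \<Phi> \<longleftrightarrow>
     finite I \<and>
     (\<forall>i\<in>I. compact (K i) \<and> convex (K i) \<and> aff_dim (K i) = int (dm i)) \<and>
     (\<forall>i\<in>I. continuous_on (K i) (\<Phi> i) \<and> \<Phi> i ` K i \<subseteq> S) \<and>
     (\<forall>i\<in>I. inj_on (\<Phi> i) (rel_interior (K i))) \<and>
     (\<forall>i\<in>I. \<forall>j\<in>I. i \<noteq> j \<longrightarrow> \<Phi> i ` rel_interior (K i) \<inter> \<Phi> j ` rel_interior (K j) = {}) \<and>
     (\<Union>i\<in>I. \<Phi> i ` rel_interior (K i)) = S \<and>
     (\<forall>i\<in>I. \<Phi> i ` rel_frontier (K i) \<subseteq> (\<Union>j\<in>{j\<in>I. dm j < dm i}. \<Phi> j ` K j))"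


section \<open>The Cayley algebra and Spin(7)\<close>

text \<open>
  The basis vector \<open>e\<^sub>i\<close>, \<open>0 \<le> i \<le> 7\<close>, is \<open>axis i 1\<close>; the index type \<open>8\<close> consists of
  \<open>0, \<dots>, 7\<close>.
\<close>

definition cayley_triples :: "(8 \<times> 8 \<times> 8) set" where
  "cayley_triples = {(1,2,3), (1,4,5), (1,6,7), (2,5,7), (2,6,4), (3,4,7), (3,5,6)}"

definition cyclic_triple :: "8 \<Rightarrow> 8 \<Rightarrow> 8 \<Rightarrow> bool" where
  "cyclic_triple i j k \<longleftrightarrow>
     (i,j,k) \<in> cayley_triples \<or> (j,k,i) \<in> cayley_triples \<or> (k,i,j) \<in> cayley_triples"

text \<open>\<open>cayley_coeff i j k\<close> is the coefficient of \<open>e\<^sub>k\<close> in \<open>e\<^sub>i e\<^sub>j\<close>.\<close>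

definition cayley_coeff :: "8 \<Rightarrow> 8 \<Rightarrow> 8 \<Rightarrow> real" where
  "cayley_coeff i j k =
     (if i = 0 then (if k = j then 1 else 0)
      else if j = 0 then (if k = i then 1 else 0)
      else if i = j then (if k = 0 then -1 else 0)
      else if cyclic_triple i j k then 1
      else if cyclic_triple j i k then -1
      else 0)"

definition cayley_mult :: "real^8 \<Rightarrow> real^8 \<Rightarrow> real^8" (infixl "\<bullet>\<^sub>C" 70) where
  "x \<bullet>\<^sub>C y = (\<chi> k. \<Sum>i\<in>UNIV. \<Sum>j\<in>UNIV. cayley_coeff i j k * x $ i * y $ j)"

definition SO8 :: "(real^8^8) set" where
  "SO8 = {G. rotation_matrix G}"

definition SO7 :: "(real^8^8) set" where
  "SO7 = {G \<in> SO8. G *v axis 0 1 = axis 0 1}"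

definition Spin7 :: "(real^8^8) set" where
  "Spin7 = {G \<in> SO8. \<exists>g\<in>SO7. \<forall>x y. (g *v x) \<bullet>\<^sub>C (G *v y) = G *v (x \<bullet>\<^sub>C y)}"


section \<open>The matrices\<close>

text \<open>
  \<^const>\<open>vector\<close> numbers entries from 1, whereas the rows and columns here are numbered from 0
  to 7.
\<close>

definition vec8 :: "'a \<Rightarrow> 'a \<Rightarrow> 'a \<Rightarrow> 'a \<Rightarrow> 'a \<Rightarrow> 'a \<Rightarrow> 'a \<Rightarrow> 'a \<Rightarrow> 'a^8" where
  "vec8 a0 a1 a2 a3 a4 a5 a6 a7 =
     (\<chi> i. if i = 0 then a0 else if i = 1 then a1 else if i = 2 then a2 else if i = 3 then a3
           else if i = 4 then a4 else if i = 5 then a5 else if i = 6 then a6 else a7)"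

definition matA :: "real^3 \<Rightarrow> real^8^8" where
  "matA x = (let x1 = x$1; x2 = x$2; x3 = x$3; X = sqrt (1 - x1\<^sup>2 - x2\<^sup>2 - x3\<^sup>2) in
     vec8 (vec8 1 0 0 0 0 0 0 0)
          (vec8 0 1 0 0 0 0 0 0)
          (vec8 0 0 1 0 0 0 0 0)
          (vec8 0 0 0 1 0 0 0 0)
          (vec8 0 0 0 0 (1 - 2*X\<^sup>2) (-2*x1*X)   (-2*x2*X)   (-2*x3*X))
          (vec8 0 0 0 0 (2*x1*X)    (1 - 2*X\<^sup>2) (2*x3*X)    (-2*x2*X))
          (vec8 0 0 0 0 (2*x2*X)    (-2*x3*X)   (1 - 2*X\<^sup>2) (2*x1*X))
          (vec8 0 0 0 0 (2*x3*X)    (2*x2*X)    (-2*x1*X)   (1 - 2*X\<^sup>2)))"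

definition matB :: "real^2 \<Rightarrow> real^8^8" where
  "matB y = (let y1 = y$1; y2 = y$2; Y = sqrt (1 - y1\<^sup>2 - y2\<^sup>2) in
     vec8 (vec8 1 0 0 0 0 0 0 0)
          (vec8 0 1 0 0 0 0 0 0)
          (vec8 0 0 y1 (-y2) (-Y) 0     0 0)
          (vec8 0 0 y2 y1    0    (-Y)  0 0)
          (vec8 0 0 Y  0     y1   y2    0 0)
          (vec8 0 0 0  Y     (-y2) y1   0 0)
          (vec8 0 0 0 0 0 0 1 0)
          (vec8 0 0 0 0 0 0 0 1))"

text \<open>The \<open>j\<close>-th column is the image of \<open>e\<^sub>j\<close>, so \<open>e\<^sub>1 \<mapsto> z\<^sub>1 e\<^sub>1 + Z e\<^sub>3\<close> gives column 1.\<close>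

definition matC :: "real^1 \<Rightarrow> real^8^8" where
  "matC z = (let z1 = z$1; Z = sqrt (1 - z1\<^sup>2) in
     vec8 (vec8 1 0  0 0    0 0  0 0)
          (vec8 0 z1 0 (-Z) 0 0  0 0)
          (vec8 0 0  1 0    0 0  0 0)
          (vec8 0 Z  0 z1   0 0  0 0)
          (vec8 0 0  0 0    1 0  0 0)
          (vec8 0 0  0 0    0 z1 0 (-Z))
          (vec8 0 0  0 0    0 0  1 0)
          (vec8 0 0  0 0    0 Z  0 z1))"

definition matD :: "real^2 \<Rightarrow> real^8^8" where
  "matD w = (let w1 = w$1; w2 = w$2; W = sqrt (1 - w1\<^sup>2 - w2\<^sup>2) in
     vec8 (vec8 w1 (-w2) (-W) 0     0 0 0 0)
          (vec8 w2 w1    0    (-W)  0 0 0 0)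
          (vec8 W  0     w1   w2    0 0 0 0)
          (vec8 0  W     (-w2) w1   0 0 0 0)
          (vec8 0 0 0 0 1 0 0 0)
          (vec8 0 0 0 0 0 1 0 0)
          (vec8 0 0 0 0 0 0 1 0)
          (vec8 0 0 0 0 0 0 0 1))"


section \<open>The cells\<close>

abbreviation D1 :: "(real^1) set" where "D1 \<equiv> cball 0 1"
abbreviation D2 :: "(real^2) set" where "D2 \<equiv> cball 0 1"
abbreviation D3 :: "(real^3) set" where "D3 \<equiv> cball 0 1"

definition phi3 :: "real^3 \<Rightarrow> real^8^8" where
  "phi3 x = matA x"

definition phi5 :: "(real^3) \<times> (real^2) \<Rightarrow> real^8^8" where
  "phi5 = (\<lambda>(x, y). matB y ** matA x ** matrix_inv (matB y))"

definition phi6 :: "(real^3) \<times> (real^2) \<times> (real^1) \<Rightarrow> real^8^8" where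
  "phi6 = (\<lambda>(x, y, z).
     matC z ** matB y ** matA x ** matrix_inv (matB y) ** matrix_inv (matC z))"

definition phi7 :: "(real^3) \<times> (real^2) \<times> (real^2) \<Rightarrow> real^8^8" where
  "phi7 = (\<lambda>(x, y, w).
     matD w ** matB y ** matA x ** matrix_inv (matB y) ** matrix_inv (matD w))"

definition e3 :: "(real^8^8) set" where "e3 = phi3 ` D3"
definition e5 :: "(real^8^8) set" where "e5 = phi5 ` (D3 \<times> D2)"
definition e6 :: "(real^8^8) set" where "e6 = phi6 ` (D3 \<times> D2 \<times> D1)"
definition e7 :: "(real^8^8) set" where "e7 = phi7 ` (D3 \<times> D2 \<times> D2)"

definition set_mult :: "(real^8^8) set \<Rightarrow> (real^8^8) set \<Rightarrow> (real^8^8) set" (infixl "\<odot>" 70) where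
  "P \<odot> Q = {p ** q | p q. p \<in> P \<and> q \<in> Q}"

definition cell_dims :: "nat set" where
  "cell_dims = {0, 3, 5, 6, 7, 8, 9, 10, 11, 12, 13, 14, 15, 16, 18, 21}"

text \<open>The values outside \<^const>\<open>cell_dims\<close> here and below are irrelevant.\<close>

definition cell :: "nat \<Rightarrow> (real^8^8) set" where
  "cell n =
    (if n = 0 then {mat 1}
     else if n = 3 then e3
     else if n = 5 then e5
     else if n = 6 then e6
     else if n = 7 then e7
     else if n = 8 then e5 \<odot> e3
     else if n = 9 then e6 \<odot> e3
     else if n = 10 then e7 \<odot> e3
     else if n = 11 then e6 \<odot> e5
     else if n = 12 then e7 \<odot> e5
     else if n = 13 then e6 \<odot> e7
     else if n = 14 then e6 \<odot> e5 \<odot> e3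
     else if n = 15 then e7 \<odot> e5 \<odot> e3
     else if n = 16 then e6 \<odot> e7 \<odot> e3
     else if n = 18 then e6 \<odot> e7 \<odot> e5
     else if n = 21 then e6 \<odot> e7 \<odot> e5 \<odot> e3
     else {})"

text \<open>
  In every product cell the factors occur in the order \<open>e\<^sup>6, e\<^sup>7, e\<^sup>5, e\<^sup>3\<close>.  Hence all domains
  embed in one space with a slot for each possible factor; the slots of the factors that do not
  occur are filled with the one-point set \<open>{0}\<close>.
\<close>

type_synonym cell_params =
  "((real^3) \<times> (real^2) \<times> (real^1)) \<times> ((real^3) \<times> (real^2) \<times> (real^2)) \<times> ((real^3) \<times> (real^2)) \<times> (real^3)"

definition cell_domain :: "nat \<Rightarrow> cell_params set" where
  "cell_domain n =
    (let K6 = D3 \<times> D2 \<times> D1; K7 = D3 \<times> D2 \<times> D2; K5 = D3 \<times> D2; K3 = D3 in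
     if n = 0 then {0} \<times> {0} \<times> {0} \<times> {0}
     else if n = 3 then {0} \<times> {0} \<times> {0} \<times> K3
     else if n = 5 then {0} \<times> {0} \<times> K5 \<times> {0}
     else if n = 6 then K6 \<times> {0} \<times> {0} \<times> {0}
     else if n = 7 then {0} \<times> K7 \<times> {0} \<times> {0}
     else if n = 8 then {0} \<times> {0} \<times> K5 \<times> K3
     else if n = 9 then K6 \<times> {0} \<times> {0} \<times> K3
     else if n = 10 then {0} \<times> K7 \<times> {0} \<times> K3
     else if n = 11 then K6 \<times> {0} \<times> K5 \<times> {0}
     else if n = 12 then {0} \<times> K7 \<times> K5 \<times> {0}
     else if n = 13 then K6 \<times> K7 \<times> {0} \<times> {0}
     else if n = 14 then K6 \<times> {0} \<times> K5 \<times> K3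
     else if n = 15 then {0} \<times> K7 \<times> K5 \<times> K3
     else if n = 16 then K6 \<times> K7 \<times> {0} \<times> K3
     else if n = 18 then K6 \<times> K7 \<times> K5 \<times> {0}
     else if n = 21 then K6 \<times> K7 \<times> K5 \<times> K3
     else {})"

definition char_map :: "nat \<Rightarrow> cell_params \<Rightarrow> real^8^8" where
  "char_map n = (\<lambda>(v6, v7, v5, v3).
     if n = 0 then mat 1
     else if n = 3 then phi3 v3
     else if n = 5 then phi5 v5
     else if n = 6 then phi6 v6
     else if n = 7 then phi7 v7
     else if n = 8 then phi5 v5 ** phi3 v3
     else if n = 9 then phi6 v6 ** phi3 v3
     else if n = 10 then phi7 v7 ** phi3 v3
     else if n = 11 then phi6 v6 ** phi5 v5
     else if n = 12 then phi7 v7 ** phi5 v5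
     else if n = 13 then phi6 v6 ** phi7 v7
     else if n = 14 then phi6 v6 ** phi5 v5 ** phi3 v3
     else if n = 15 then phi7 v7 ** phi5 v5 ** phi3 v3
     else if n = 16 then phi6 v6 ** phi7 v7 ** phi3 v3
     else if n = 18 then phi6 v6 ** phi7 v7 ** phi5 v5
     else if n = 21 then phi6 v6 ** phi7 v7 ** phi5 v5 ** phi3 v3
     else mat 1)"

end

theory Submission
  imports Defs
begin

text \<open>
  Consider the chain \<open>Spin(7) \<supseteq> SU(4) \<supseteq> SU(3) \<supseteq> SU(2) \<supseteq> 1\<close> of successive stabilizers of \<open>e\<^sub>1\<close> (under the
  action through \<open>SO(7)\<close>), \<open>e\<^sub>0\<close>, \<open>e\<^sub>2\<close> and \<open>e\<^sub>4\<close>.  The orbits are \<open>S\<^sup>6\<close>, \<open>S\<^sup>7\<close>, \<open>S\<^sup>5\<close>, \<open>S\<^sup>3\<close>, and the orbit map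
  composed with \<open>\<phi>\<^sub>6\<close>, \<open>\<phi>\<^sub>7\<close>, \<open>\<phi>\<^sub>5\<close>, \<open>\<phi>\<^sub>3\<close> is a bijection from the open disc onto the sphere without
  its base point, while the boundary goes to the base point.  So every element of \<open>Spin(7)\<close> is uniquely
  a product of interior values of some of \<open>\<phi>\<^sub>6, \<phi>\<^sub>7, \<phi>\<^sub>5, \<phi>\<^sub>3\<close> in this order, which gives \<open>2\<^sup>4\<close> open cells.
  For the boundaries one also needs that \<open>\<phi>\<^sub>6\<close> and \<open>\<phi>\<^sub>7\<close> map theirs into \<open>e\<^sup>5\<close>, and that \<open>e\<^sup>5 e\<^sup>7\<close>, which
  occurs in the boundary of \<open>e\<^sup>1\<^sup>3\<close>, lies in \<open>e\<^sup>7 e\<^sup>5 \<union> SU(3)\<close>.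
\<close>

text \<open>The boundary condition is a matter of dimensions. A degenerate factor is absorbed into
  one of the stabilizers, which turn out to be closed cells themselves, of dimension 3, 8 and 15.
  This is too coarse in two places. The boundaries of e^6 and e^7 would only land in SU(3), of
  dimension 8; to reach e^5 one produces, besides e_0 and e_1, a fixed vector that has a component
  in the span of e_2, ..., e_5 and none along e_6 and e_7. And in e^6 e^7 absorption only gives
  SU(4), whose dimension 15 exceeds 13; the inclusion for e^5 e^7 replaces it by dimensions 12 and
  8. As soon as a further factor is present, the product has dimension at least 16 and SU(4) is
  small enough. On the open cells the equations contain the square roots X, Y, Z, W. In the
  coordinates x / X and so on, these survive only as positive scalars, and what is left are complex
  linear equations that determine the unknowns one after another.\<close>

section \<open>Coordinates in dimension eight and the multiplication table\<close>

lemma UNIV_8: "(UNIV :: 8 set) = {0,1,2,3,4,5,6,7}"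
proof -
  have "card {0,1,2,3,4,5,6,7::8} = 8" by simp
  then show ?thesis by (intro card_subset_eq[symmetric]) auto
qed

lemma sum_8: "sum f (UNIV::8 set) = f 0 + f 1 + f 2 + f 3 + f 4 + f 5 + f 6 + f 7"
  unfolding UNIV_8 by (simp add: algebra_simps)

lemma forall_8: "(\<forall>i::8. P i) \<longleftrightarrow> P 0 \<and> P 1 \<and> P 2 \<and> P 3 \<and> P 4 \<and> P 5 \<and> P 6 \<and> P 7"
proof -
  have "(\<forall>i::8. P i) \<longleftrightarrow> (\<forall>i\<in>UNIV. P i)" by simp
  then show ?thesis unfolding UNIV_8 by simp
qed

lemma vec8_nth [simp]:
  "vec8 a0 a1 a2 a3 a4 a5 a6 a7 $ 0 = a0" "vec8 a0 a1 a2 a3 a4 a5 a6 a7 $ 1 = a1"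
  "vec8 a0 a1 a2 a3 a4 a5 a6 a7 $ 2 = a2" "vec8 a0 a1 a2 a3 a4 a5 a6 a7 $ 3 = a3"
  "vec8 a0 a1 a2 a3 a4 a5 a6 a7 $ 4 = a4" "vec8 a0 a1 a2 a3 a4 a5 a6 a7 $ 5 = a5"
  "vec8 a0 a1 a2 a3 a4 a5 a6 a7 $ 6 = a6" "vec8 a0 a1 a2 a3 a4 a5 a6 a7 $ 7 = a7"
  by (simp_all add: vec8_def)

lemma vec8_eq_iff:
  "x = (y :: 'a^8) \<longleftrightarrow> x$0 = y$0 \<and> x$1 = y$1 \<and> x$2 = y$2 \<and> x$3 = y$3 \<and>
     x$4 = y$4 \<and> x$5 = y$5 \<and> x$6 = y$6 \<and> x$7 = y$7"
  by (simp add: vec_eq_iff forall_8)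

lemma vec8_inject [simp]:
  "vec8 a0 a1 a2 a3 a4 a5 a6 a7 = vec8 b0 b1 b2 b3 b4 b5 b6 b7 \<longleftrightarrow>
     a0 = b0 \<and> a1 = b1 \<and> a2 = b2 \<and> a3 = b3 \<and> a4 = b4 \<and> a5 = b5 \<and> a6 = b6 \<and> a7 = b7"
  by (simp add: vec8_eq_iff)

lemma vec8_cases: obtains a0 a1 a2 a3 a4 a5 a6 a7 where "x = vec8 a0 a1 a2 a3 a4 a5 a6 a7"
  by (rule that[of "x$0" "x$1" "x$2" "x$3" "x$4" "x$5" "x$6" "x$7"]) (simp add: vec8_eq_iff)

lemma axis_vec8:
  "axis 0 c = vec8 c 0 0 0 0 0 0 0" "axis 1 c = vec8 0 c 0 0 0 0 0 0"
  "axis 2 c = vec8 0 0 c 0 0 0 0 0" "axis 3 c = vec8 0 0 0 c 0 0 0 0"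
  "axis 4 c = vec8 0 0 0 0 c 0 0 0" "axis 5 c = vec8 0 0 0 0 0 c 0 0"
  "axis 6 c = vec8 0 0 0 0 0 0 c 0" "axis 7 c = vec8 0 0 0 0 0 0 0 c"
  by (simp_all add: vec8_eq_iff axis_def)

lemma vec8_arith:
  "vec8 a0 a1 a2 a3 a4 a5 a6 a7 + vec8 b0 b1 b2 b3 b4 b5 b6 b7 =
     vec8 (a0+b0) (a1+b1) (a2+b2) (a3+b3) (a4+b4) (a5+b5) (a6+b6) (a7+b7 :: real)"
  "vec8 a0 a1 a2 a3 a4 a5 a6 a7 - vec8 b0 b1 b2 b3 b4 b5 b6 b7 =
     vec8 (a0-b0) (a1-b1) (a2-b2) (a3-b3) (a4-b4) (a5-b5) (a6-b6) (a7-b7 :: real)"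
  "c *\<^sub>R vec8 a0 a1 a2 a3 a4 a5 a6 a7 =
     vec8 (c*a0) (c*a1) (c*a2) (c*a3) (c*a4) (c*a5) (c*a6) (c*a7 :: real)"
  "(0 :: real^8) = vec8 0 0 0 0 0 0 0 0"
  by (simp_all add: vec8_eq_iff)

lemma inner_8: "x \<bullet> (y :: real^8) =
   x$0 * y$0 + x$1 * y$1 + x$2 * y$2 + x$3 * y$3 + x$4 * y$4 + x$5 * y$5 + x$6 * y$6 + x$7 * y$7"
  by (simp add: inner_vec_def sum_8)

lemma matrix_vector_mult_vec8:
  "vec8 r0 r1 r2 r3 r4 r5 r6 r7 *v x =
     vec8 (r0 \<bullet> x) (r1 \<bullet> x) (r2 \<bullet> x) (r3 \<bullet> x) (r4 \<bullet> x) (r5 \<bullet> x) (r6 \<bullet> x) (r7 \<bullet> (x :: real^8))"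
  by (simp add: vec8_eq_iff matrix_vector_mult_def inner_vec_def)

lemma cayley_mult_vec8:
  "vec8 x0 x1 x2 x3 x4 x5 x6 x7 \<bullet>\<^sub>C vec8 y0 y1 y2 y3 y4 y5 y6 y7 = vec8
    (x0*y0 - x1*y1 - x2*y2 - x3*y3 - x4*y4 - x5*y5 - x6*y6 - x7*y7)
    (x0*y1 + x1*y0 + x2*y3 - x3*y2 + x4*y5 - x5*y4 + x6*y7 - x7*y6)
    (x0*y2 + x2*y0 - x1*y3 + x3*y1 + x5*y7 - x7*y5 + x6*y4 - x4*y6)
    (x0*y3 + x3*y0 + x1*y2 - x2*y1 + x4*y7 - x7*y4 + x5*y6 - x6*y5)
    (x0*y4 + x4*y0 - x1*y5 + x5*y1 + x2*y6 - x6*y2 - x3*y7 + x7*y3)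
    (x0*y5 + x5*y0 + x1*y4 - x4*y1 - x2*y7 + x7*y2 - x3*y6 + x6*y3)
    (x0*y6 + x6*y0 - x1*y7 + x7*y1 - x2*y4 + x4*y2 + x3*y5 - x5*y3)
    (x0*y7 + x7*y0 + x1*y6 - x6*y1 + x2*y5 - x5*y2 + x3*y4 - x4*y3)"
  by (simp add: vec8_eq_iff cayley_mult_def sum_8 cayley_coeff_def cyclic_triple_def cayley_triples_def)

section \<open>Pairs representing elements of Spin(7)\<close>

declare transpose_matrix_vector [simp del]

lemma bilinear_cayley_mult: "bilinear (\<bullet>\<^sub>C)"
  by (auto simp: bilinear_def linear_iff cayley_mult_def vec_eq_iff algebra_simps
      sum.distrib sum_distrib_left)

text \<open>Both sides are bilinear, so 64 pairs of basis vectors decide. This turns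
  multiplicativity of an explicit matrix into finitely many polynomial identities.\<close>

lemma cayley_hom_basisI:
  assumes "\<And>i j. (g *v axis i 1) \<bullet>\<^sub>C (G *v axis j 1) = G *v (axis i 1 \<bullet>\<^sub>C axis j 1)"
  shows "(g *v x) \<bullet>\<^sub>C (G *v y) = G *v (x \<bullet>\<^sub>C y)"
proof -
  have "bilinear (\<lambda>x y. (g *v x) \<bullet>\<^sub>C (G *v y))" "bilinear (\<lambda>x y. G *v (x \<bullet>\<^sub>C y))"
    using bilinear_cayley_mult by (auto simp: bilinear_def linear_iff matrix_vector_right_distrib
      matrix_vector_mult_scaleR)
  then have "(\<lambda>x y. (g *v x) \<bullet>\<^sub>C (G *v y)) = (\<lambda>x y. G *v (x \<bullet>\<^sub>C y))"
    by (rule bilinear_eq_stdbasis) (auto simp: Basis_vec_def assms)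
  then show ?thesis by meson
qed

lemma cayley_mult_e0 [simp]: "x \<bullet>\<^sub>C axis 0 1 = x" "axis 0 1 \<bullet>\<^sub>C x = x"
  by (rule vec8_cases[of x]; simp add: axis_vec8 cayley_mult_vec8)+

lemma orthogonal_matrixI:
  assumes "\<And>x. (A *v x) \<bullet> (A *v x) = x \<bullet> (x::real^'n)"
  shows "orthogonal_matrix A"
proof -
  have "orthogonal_transformation ((*v) A)"
    unfolding orthogonal_transformation by (simp add: assms norm_eq_sqrt_inner)
  then show ?thesis by (simp add: orthogonal_transformation_matrix)
qed

text \<open>The definition of \<open>Spin7\<close> hides \<open>g\<close> behind an existential.
  Here the pair is the object, because the chain of stabilizers starts with the action of
  \<open>g\<close>; passing from \<open>G\<close> to \<open>g\<close> is the double cover of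
  SO(7).\<close>

definition spin_pair :: "real^8^8 \<Rightarrow> real^8^8 \<Rightarrow> bool" where
  "spin_pair g G \<longleftrightarrow> g \<in> SO7 \<and> G \<in> SO8 \<and> (\<forall>x y. (g *v x) \<bullet>\<^sub>C (G *v y) = G *v (x \<bullet>\<^sub>C y))"

lemma Spin7_iff: "G \<in> Spin7 \<longleftrightarrow> (\<exists>g. spin_pair g G)"
  by (auto simp: Spin7_def spin_pair_def)

lemma SO8_orthogonal: "G \<in> SO8 \<Longrightarrow> orthogonal_matrix G"
  by (simp add: SO8_def rotation_matrix_def)

lemma orthogonal_matrix_inverse:
  assumes "orthogonal_matrix (G::real^'n^'n)"
  shows "transpose G ** G = mat 1" "G ** transpose G = mat 1"
    "transpose G *v (G *v x) = x" "G *v (transpose G *v x) = x"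
  using assms by (simp_all add: orthogonal_matrix_def matrix_vector_mul_assoc)

lemma orthogonal_matrix_inner:
  assumes "orthogonal_matrix (G::real^'n^'n)"
  shows "(G *v x) \<bullet> (G *v y) = x \<bullet> y"
proof -
  have "(G *v x) \<bullet> (G *v y) = (transpose G *v (G *v x)) \<bullet> y"
    by (simp add: dot_lmul_matrix transpose_matrix_vector)
  then show ?thesis using assms by (simp add: orthogonal_matrix_inverse)
qed

lemma matrix_inv_orthogonal:
  assumes "orthogonal_matrix (G::real^'n^'n)"
  shows "matrix_inv G = transpose G"
proof -
  have "G ** matrix_inv G = mat 1 \<and> matrix_inv G ** G = mat 1"
    unfolding matrix_inv_def by (rule someI[of _ "transpose G"]) (simp add: orthogonal_matrix_inverse assms)
  then show ?thesis
    by (metis assms matrix_mul_assoc matrix_mul_lid matrix_mul_rid orthogonal_matrix_inverse(1))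
qed

lemma orthogonal_fix_transpose:
  assumes "orthogonal_matrix (G::real^'n^'n)" "G *v x = y"
  shows "transpose G *v y = x"
  using assms orthogonal_matrix_inverse(3) by blast

lemma SO8_group:
  "mat 1 \<in> SO8" "G \<in> SO8 \<Longrightarrow> H \<in> SO8 \<Longrightarrow> G ** H \<in> SO8" "G \<in> SO8 \<Longrightarrow> transpose G \<in> SO8"
  by (auto simp: SO8_def rotation_matrix_def orthogonal_matrix_mul orthogonal_matrix_id det_mul det_transpose)

lemma SO7_group:
  "mat 1 \<in> SO7" "G \<in> SO7 \<Longrightarrow> H \<in> SO7 \<Longrightarrow> G ** H \<in> SO7" "G \<in> SO7 \<Longrightarrow> transpose G \<in> SO7"
  by (auto simp: SO7_def SO8_group SO8_orthogonal orthogonal_fix_transpose simp flip: matrix_vector_mul_assoc)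

lemma spin_pair_id: "spin_pair (mat 1) (mat 1)"
  by (simp add: spin_pair_def SO8_group SO7_group)

lemma spin_pair_mult: "spin_pair g G \<Longrightarrow> spin_pair h H \<Longrightarrow> spin_pair (g ** h) (G ** H)"
  by (simp add: spin_pair_def SO8_group SO7_group flip: matrix_vector_mul_assoc)

lemma spin_pair_orthogonal:
  assumes "spin_pair g G" shows "orthogonal_matrix g" "orthogonal_matrix G"
  using assms by (auto simp: spin_pair_def SO7_def SO8_orthogonal)

lemma spin_pair_transpose:
  assumes "spin_pair g G" shows "spin_pair (transpose g) (transpose G)"
proof -
  have "(transpose g *v x) \<bullet>\<^sub>C (transpose G *v y) = transpose G *v (x \<bullet>\<^sub>C y)" for x y
  proof -
    have "G *v ((transpose g *v x) \<bullet>\<^sub>C (transpose G *v y))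
        = (g *v (transpose g *v x)) \<bullet>\<^sub>C (G *v (transpose G *v y))"
      using assms by (simp add: spin_pair_def)
    also have "\<dots> = x \<bullet>\<^sub>C y"
      using spin_pair_orthogonal[OF assms] by (simp add: orthogonal_matrix_inverse)
    finally show ?thesis
      using spin_pair_orthogonal(2)[OF assms] orthogonal_matrix_inverse(3) by metis
  qed
  then show ?thesis using assms by (simp add: spin_pair_def SO7_group SO8_group)
qed

lemma spin_pair_apply: "spin_pair g G \<Longrightarrow> (g *v x) \<bullet>\<^sub>C (G *v axis 0 1) = G *v x"
  by (simp add: spin_pair_def)

lemma spin_pair_unique:
  assumes "spin_pair g G" "spin_pair h G" shows "g = h"
proof -
  have "g *v x = h *v x" for x
  proof -
    \<comment> \<open>The difference is pulled back by \<open>g\<close> so that its product with the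
      image of e_0 under \<open>G\<close> becomes \<open>G *v d\<close>. Injectivity of
      \<open>G\<close> then takes the place of the absence of zero divisors.\<close>
    define d where "d = transpose g *v (g *v x - h *v x)"
    have "g *v d = g *v x - h *v x"
      unfolding d_def using spin_pair_orthogonal(1)[OF assms(1)] by (simp add: orthogonal_matrix_inverse)
    then have "G *v d = (g *v x - h *v x) \<bullet>\<^sub>C (G *v axis 0 1)"
      using spin_pair_apply[OF assms(1), of d] by simp
    also have "\<dots> = 0"
      using bilinear_cayley_mult spin_pair_apply[OF assms(1), of x] spin_pair_apply[OF assms(2), of x]
      by (simp add: bilinear_lsub)
    finally have "d = 0"
      using orthogonal_matrix_inverse(3)[OF spin_pair_orthogonal(2)[OF assms(1)], of d] by simp
    with \<open>g *v d = g *v x - h *v x\<close> show ?thesis by simp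
  qed
  then show ?thesis by (simp add: matrix_eq)
qed

text \<open>Passing to squares gives the sign of the determinant for free.\<close>

lemma spin_pair_square:
  assumes "orthogonal_matrix g" "orthogonal_matrix G" "g *v axis 0 1 = axis 0 1"
    and "\<And>x y. (g *v x) \<bullet>\<^sub>C (G *v y) = G *v (x \<bullet>\<^sub>C y)"
  shows "spin_pair (g ** g) (G ** G)"
proof -
  have "det H * det H = 1" if "orthogonal_matrix H" for H :: "real^8^8"
    using det_orthogonal_matrix[OF that] by auto
  then show ?thesis
    using assms by (simp add: spin_pair_def SO7_def SO8_def rotation_matrix_def orthogonal_matrix_mul
        det_mul flip: matrix_vector_mul_assoc)
qed

section \<open>Explicit rotations parametrized by unit quaternions\<close>

text \<open>The right-hand sides are the coordinates of the square of a + bi + cj + dk; the root is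
  found by halving the angle. The last two clauses keep the root free of j or k when the given
  quaternion is, as the families with fewer parameters require.\<close>

lemma unit_quaternion_square_root:
  assumes "p\<^sup>2 + q\<^sup>2 + r\<^sup>2 + s\<^sup>2 = (1::real)"
  obtains a b c d where "a\<^sup>2 + b\<^sup>2 + c\<^sup>2 + d\<^sup>2 = 1" "p = a\<^sup>2 - b\<^sup>2 - c\<^sup>2 - d\<^sup>2"
    "q = 2 * a * b" "r = 2 * a * c" "s = 2 * a * d" "r = 0 \<Longrightarrow> c = 0" "s = 0 \<Longrightarrow> d = 0"
proof (cases "p = -1")
  case True
  with assms have "q\<^sup>2 + r\<^sup>2 + s\<^sup>2 = 0" by simp
  then have "q = 0 \<and> r = 0 \<and> s = 0"
    by (smt (verit) zero_le_power2 power_eq_0_iff)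
  \<comment> \<open>Every imaginary unit quaternion is a square root of -1; the choice of i makes c
    and d vanish.\<close>
  with True show ?thesis by (intro that[of 0 1 0 0]) auto
next
  case False
  have "p\<^sup>2 \<le> 1" using assms by (smt (verit) zero_le_power2)
  then have "\<bar>p\<bar> \<le> 1" by (simp add: abs_square_le_1)
  with False have p: "1 + p > 0" by linarith
  define a where "a = sqrt ((1 + p) / 2)"
  have a: "a > 0" "a\<^sup>2 = (1 + p) / 2" using p by (auto simp: a_def)
  have *: "(q / (2*a))\<^sup>2 + (r / (2*a))\<^sup>2 + (s / (2*a))\<^sup>2 = (1 - p) / 2"
  proof -
    have "(q / (2*a))\<^sup>2 + (r / (2*a))\<^sup>2 + (s / (2*a))\<^sup>2 = (q\<^sup>2 + r\<^sup>2 + s\<^sup>2) / (4 * a\<^sup>2)"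
      by (simp add: power_divide power_mult_distrib add_divide_distrib)
    also have "\<dots> = (1 - p\<^sup>2) / (2 * (1 + p))"
    proof -
      have "q\<^sup>2 + r\<^sup>2 + s\<^sup>2 = 1 - p\<^sup>2" "4 * a\<^sup>2 = 2 * (1 + p)" using assms a by auto
      then show ?thesis by simp
    qed
    also have "\<dots> = (1 - p) / 2" using p by (simp add: field_simps power2_eq_square)
    finally show ?thesis .
  qed
  show ?thesis
  proof (rule that[of a "q / (2*a)" "r / (2*a)" "s / (2*a)"])
    show "a\<^sup>2 + (q / (2*a))\<^sup>2 + (r / (2*a))\<^sup>2 + (s / (2*a))\<^sup>2 = 1"
      "p = a\<^sup>2 - (q / (2*a))\<^sup>2 - (r / (2*a))\<^sup>2 - (s / (2*a))\<^sup>2"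
      using * a(2) by argo+
  qed (use a(1) in auto)
qed

text \<open>With e_4, ..., e_7 read as 1, i, j, k, the block is right multiplication by the
  quaternion p + qi + rj + sk; \<open>rotB\<close> and \<open>rotD\<close> have the same block with
  s = 0 in other places. Unlike the disc parameters, quaternion parameters make it visible that
  squares and transposes stay in the family.\<close>

definition rotA :: "real \<Rightarrow> real \<Rightarrow> real \<Rightarrow> real \<Rightarrow> real^8^8" where
  "rotA p q r s = vec8
     (vec8 1 0 0 0 0 0 0 0) (vec8 0 1 0 0 0 0 0 0) (vec8 0 0 1 0 0 0 0 0) (vec8 0 0 0 1 0 0 0 0)
     (vec8 0 0 0 0 p (-q) (-r) (-s)) (vec8 0 0 0 0 q p s (-r))
     (vec8 0 0 0 0 r (-s) p q) (vec8 0 0 0 0 s r (-q) p)"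

definition rotB :: "real \<Rightarrow> real \<Rightarrow> real \<Rightarrow> real^8^8" where
  "rotB p q r = vec8
     (vec8 1 0 0 0 0 0 0 0) (vec8 0 1 0 0 0 0 0 0)
     (vec8 0 0 p (-q) (-r) 0 0 0) (vec8 0 0 q p 0 (-r) 0 0)
     (vec8 0 0 r 0 p q 0 0) (vec8 0 0 0 r (-q) p 0 0)
     (vec8 0 0 0 0 0 0 1 0) (vec8 0 0 0 0 0 0 0 1)"

definition rotC :: "real \<Rightarrow> real \<Rightarrow> real^8^8" where
  "rotC p q = vec8
     (vec8 1 0 0 0 0 0 0 0) (vec8 0 p 0 (-q) 0 0 0 0)
     (vec8 0 0 1 0 0 0 0 0) (vec8 0 q 0 p 0 0 0 0)
     (vec8 0 0 0 0 1 0 0 0) (vec8 0 0 0 0 0 p 0 (-q))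
     (vec8 0 0 0 0 0 0 1 0) (vec8 0 0 0 0 0 q 0 p)"

definition rotD :: "real \<Rightarrow> real \<Rightarrow> real \<Rightarrow> real^8^8" where
  "rotD p q r = vec8
     (vec8 p (-q) (-r) 0 0 0 0 0) (vec8 q p 0 (-r) 0 0 0 0)
     (vec8 r 0 p q 0 0 0 0) (vec8 0 r (-q) p 0 0 0 0)
     (vec8 0 0 0 0 1 0 0 0) (vec8 0 0 0 0 0 1 0 0)
     (vec8 0 0 0 0 0 0 1 0) (vec8 0 0 0 0 0 0 0 1)"

text \<open>
  The element of \<open>SO(7)\<close> paired with \<open>rotD p q r\<close> must map \<open>x\<close> to the product of \<open>rotD p q r *v x\<close>
  with the conjugate of \<open>rotD p q r *v axis 0 1\<close>; this is its matrix.
\<close>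

definition rotD_lift :: "real \<Rightarrow> real \<Rightarrow> real \<Rightarrow> real^8^8" where
  "rotD_lift p q r = vec8
     (vec8 1 0 0 0 0 0 0 0) (vec8 0 1 0 0 0 0 0 0) (vec8 0 0 1 0 0 0 0 0) (vec8 0 0 0 1 0 0 0 0)
     (vec8 0 0 0 0 p (-q) r 0) (vec8 0 0 0 0 q p 0 (-r))
     (vec8 0 0 0 0 (-r) 0 p (-q)) (vec8 0 0 0 0 0 r q p)"

lemmas rot_defs = rotA_def rotB_def rotC_def rotD_def rotD_lift_def
lemmas vec8_simps = matrix_vector_mult_vec8 inner_8 axis_vec8 cayley_mult_vec8 vec8_arith

lemma rot_orthogonal:
  "p\<^sup>2 + q\<^sup>2 + r\<^sup>2 + s\<^sup>2 = 1 \<Longrightarrow> orthogonal_matrix (rotA p q r s)"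
  "p\<^sup>2 + q\<^sup>2 + r\<^sup>2 = 1 \<Longrightarrow> orthogonal_matrix (rotB p q r)"
  "p\<^sup>2 + q\<^sup>2 = 1 \<Longrightarrow> orthogonal_matrix (rotC p q)"
  "p\<^sup>2 + q\<^sup>2 + r\<^sup>2 = 1 \<Longrightarrow> orthogonal_matrix (rotD p q r)"
  "p\<^sup>2 + q\<^sup>2 + r\<^sup>2 = 1 \<Longrightarrow> orthogonal_matrix (rotD_lift p q r)"
  by (rule orthogonal_matrixI, simp add: rot_defs vec8_simps, algebra)+

lemma rot_square:
  "rotA p q r s ** rotA p q r s = rotA (p\<^sup>2 - q\<^sup>2 - r\<^sup>2 - s\<^sup>2) (2 * p * q) (2 * p * r) (2 * p * s)"
  "rotB p q r ** rotB p q r = rotB (p\<^sup>2 - q\<^sup>2 - r\<^sup>2) (2 * p * q) (2 * p * r)"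
  "rotC p q ** rotC p q = rotC (p\<^sup>2 - q\<^sup>2) (2 * p * q)"
  "rotD p q r ** rotD p q r = rotD (p\<^sup>2 - q\<^sup>2 - r\<^sup>2) (2 * p * q) (2 * p * r)"
  "rotD_lift p q r ** rotD_lift p q r = rotD_lift (p\<^sup>2 - q\<^sup>2 - r\<^sup>2) (2 * p * q) (2 * p * r)"
  by (simp_all add: matrix_eq rot_defs vec8_simps power2_eq_square algebra_simps flip: matrix_vector_mul_assoc)

text \<open>On basis vectors the identity is polynomial, modulo the equation of the sphere.
  \<open>rotA\<close>, \<open>rotB\<close> and \<open>rotC\<close> fix e_0 and are automorphisms of
  the Cayley algebra, hence their own partners; \<open>rotD\<close> moves e_0 and needs a different
  partner.\<close>

lemma rotA_hom:
  assumes "p\<^sup>2 + q\<^sup>2 + r\<^sup>2 + s\<^sup>2 = 1"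
  shows "(rotA p q r s *v x) \<bullet>\<^sub>C (rotA p q r s *v y) = rotA p q r s *v (x \<bullet>\<^sub>C y)"
proof (rule cayley_hom_basisI)
  have "\<forall>i j. (rotA p q r s *v axis i 1) \<bullet>\<^sub>C (rotA p q r s *v axis j 1) = rotA p q r s *v (axis i 1 \<bullet>\<^sub>C axis j 1)"
    unfolding forall_8 rotA_def using assms
    by (simp add: vec8_simps power2_eq_square; (intro conjI)?; algebra)
  then show "(rotA p q r s *v axis i 1) \<bullet>\<^sub>C (rotA p q r s *v axis j 1) = rotA p q r s *v (axis i 1 \<bullet>\<^sub>C axis j 1)" for i j
    by blast
qed

lemma rotB_hom:
  assumes "p\<^sup>2 + q\<^sup>2 + r\<^sup>2 = 1"
  shows "(rotB p q r *v x) \<bullet>\<^sub>C (rotB p q r *v y) = rotB p q r *v (x \<bullet>\<^sub>C y)"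
proof (rule cayley_hom_basisI)
  have "\<forall>i j. (rotB p q r *v axis i 1) \<bullet>\<^sub>C (rotB p q r *v axis j 1) = rotB p q r *v (axis i 1 \<bullet>\<^sub>C axis j 1)"
    unfolding forall_8 rotB_def using assms
    by (simp add: vec8_simps power2_eq_square; (intro conjI)?; algebra)
  then show "(rotB p q r *v axis i 1) \<bullet>\<^sub>C (rotB p q r *v axis j 1) = rotB p q r *v (axis i 1 \<bullet>\<^sub>C axis j 1)" for i j
    by blast
qed

lemma rotC_hom:
  assumes "p\<^sup>2 + q\<^sup>2 = 1"
  shows "(rotC p q *v x) \<bullet>\<^sub>C (rotC p q *v y) = rotC p q *v (x \<bullet>\<^sub>C y)"
proof (rule cayley_hom_basisI)
  have "\<forall>i j. (rotC p q *v axis i 1) \<bullet>\<^sub>C (rotC p q *v axis j 1) = rotC p q *v (axis i 1 \<bullet>\<^sub>C axis j 1)"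
    unfolding forall_8 rotC_def using assms
    by (simp add: vec8_simps power2_eq_square; (intro conjI)?; algebra)
  then show "(rotC p q *v axis i 1) \<bullet>\<^sub>C (rotC p q *v axis j 1) = rotC p q *v (axis i 1 \<bullet>\<^sub>C axis j 1)" for i j
    by blast
qed

lemma rotD_hom:
  assumes "p\<^sup>2 + q\<^sup>2 + r\<^sup>2 = 1"
  shows "(rotD_lift p q r *v x) \<bullet>\<^sub>C (rotD p q r *v y) = rotD p q r *v (x \<bullet>\<^sub>C y)"
proof (rule cayley_hom_basisI)
  have "\<forall>i j. (rotD_lift p q r *v axis i 1) \<bullet>\<^sub>C (rotD p q r *v axis j 1) = rotD p q r *v (axis i 1 \<bullet>\<^sub>C axis j 1)"
    unfolding forall_8 rotD_def rotD_lift_def using assms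
    by (simp add: vec8_simps power2_eq_square; (intro conjI)?; algebra)
  then show "(rotD_lift p q r *v axis i 1) \<bullet>\<^sub>C (rotD p q r *v axis j 1) = rotD p q r *v (axis i 1 \<bullet>\<^sub>C axis j 1)" for i j
    by blast
qed

section \<open>The chain of stabilizers\<close>

declare mem_cball [simp del] mem_cball_0 [simp del]

text \<open>Each member is the square of a member of its own family, because its parameter has a
  quaternion square root with the same vanishing coordinates j and k.\<close>

lemma spin_pair_rot:
  "p\<^sup>2 + q\<^sup>2 + r\<^sup>2 + s\<^sup>2 = 1 \<Longrightarrow> spin_pair (rotA p q r s) (rotA p q r s)"
  "p\<^sup>2 + q\<^sup>2 + r\<^sup>2 = 1 \<Longrightarrow> spin_pair (rotB p q r) (rotB p q r)"
  "p\<^sup>2 + q\<^sup>2 = 1 \<Longrightarrow> spin_pair (rotC p q) (rotC p q)"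
  "p\<^sup>2 + q\<^sup>2 + r\<^sup>2 = 1 \<Longrightarrow> spin_pair (rotD_lift p q r) (rotD p q r)"
proof -
  show "spin_pair (rotA p q r s) (rotA p q r s)" if *: "p\<^sup>2 + q\<^sup>2 + r\<^sup>2 + s\<^sup>2 = 1"
  proof -
    obtain a b c d where **: "a\<^sup>2 + b\<^sup>2 + c\<^sup>2 + d\<^sup>2 = 1" "p = a\<^sup>2 - b\<^sup>2 - c\<^sup>2 - d\<^sup>2"
      "q = 2 * a * b" "r = 2 * a * c" "s = 2 * a * d"
      using unit_quaternion_square_root[OF *] by metis
    have "spin_pair (rotA a b c d ** rotA a b c d) (rotA a b c d ** rotA a b c d)"
      by (rule spin_pair_square; (rule rot_orthogonal rotA_hom)?; (rule **)?; simp add: rotA_def vec8_simps)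
    then show ?thesis by (simp add: rot_square **)
  qed
  show "spin_pair (rotB p q r) (rotB p q r)" if *: "p\<^sup>2 + q\<^sup>2 + r\<^sup>2 = 1"
  proof -
    have "p\<^sup>2 + q\<^sup>2 + r\<^sup>2 + 0\<^sup>2 = 1" using * by simp
    from unit_quaternion_square_root[OF this]
    obtain a b c d where "a\<^sup>2 + b\<^sup>2 + c\<^sup>2 + d\<^sup>2 = 1" "p = a\<^sup>2 - b\<^sup>2 - c\<^sup>2 - d\<^sup>2"
      "q = 2 * a * b" "r = 2 * a * c" "d = 0" by metis
    then have **: "a\<^sup>2 + b\<^sup>2 + c\<^sup>2 = 1" "p = a\<^sup>2 - b\<^sup>2 - c\<^sup>2" "q = 2 * a * b" "r = 2 * a * c" by auto
    have "spin_pair (rotB a b c ** rotB a b c) (rotB a b c ** rotB a b c)"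
      by (rule spin_pair_square; (rule rot_orthogonal rotB_hom)?; (rule **)?; simp add: rotB_def vec8_simps)
    then show ?thesis by (simp add: rot_square **)
  qed
  show "spin_pair (rotC p q) (rotC p q)" if *: "p\<^sup>2 + q\<^sup>2 = 1"
  proof -
    have "p\<^sup>2 + q\<^sup>2 + 0\<^sup>2 + 0\<^sup>2 = 1" using * by simp
    from unit_quaternion_square_root[OF this]
    obtain a b c d where "a\<^sup>2 + b\<^sup>2 + c\<^sup>2 + d\<^sup>2 = 1" "p = a\<^sup>2 - b\<^sup>2 - c\<^sup>2 - d\<^sup>2"
      "q = 2 * a * b" "c = 0" "d = 0" by metis
    then have **: "a\<^sup>2 + b\<^sup>2 = 1" "p = a\<^sup>2 - b\<^sup>2" "q = 2 * a * b" by auto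
    have "spin_pair (rotC a b ** rotC a b) (rotC a b ** rotC a b)"
      by (rule spin_pair_square; (rule rot_orthogonal rotC_hom)?; (rule **)?; simp add: rotC_def vec8_simps)
    then show ?thesis by (simp add: rot_square **)
  qed
  show "spin_pair (rotD_lift p q r) (rotD p q r)" if *: "p\<^sup>2 + q\<^sup>2 + r\<^sup>2 = 1"
  proof -
    have "p\<^sup>2 + q\<^sup>2 + r\<^sup>2 + 0\<^sup>2 = 1" using * by simp
    from unit_quaternion_square_root[OF this]
    obtain a b c d where "a\<^sup>2 + b\<^sup>2 + c\<^sup>2 + d\<^sup>2 = 1" "p = a\<^sup>2 - b\<^sup>2 - c\<^sup>2 - d\<^sup>2"
      "q = 2 * a * b" "r = 2 * a * c" "d = 0" by metis
    then have **: "a\<^sup>2 + b\<^sup>2 + c\<^sup>2 = 1" "p = a\<^sup>2 - b\<^sup>2 - c\<^sup>2" "q = 2 * a * b" "r = 2 * a * c" by auto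
    have "spin_pair (rotD_lift a b c ** rotD_lift a b c) (rotD a b c ** rotD a b c)"
      by (rule spin_pair_square; (rule rot_orthogonal rotD_hom)?; (rule **)?; simp add: rotD_lift_def vec8_simps)
    then show ?thesis by (simp add: rot_square **)
  qed
qed

text \<open>The common form of the radicals X, Y, Z, W: the height of the upper hemisphere above a
  point of the disc.\<close>

definition cofactor :: "'a::real_inner \<Rightarrow> real" where
  "cofactor x = sqrt (1 - x \<bullet> x)"

lemma mem_cball_iff_inner: "x \<in> cball 0 1 \<longleftrightarrow> x \<bullet> x \<le> 1"
  and mem_ball_iff_inner: "x \<in> ball 0 1 \<longleftrightarrow> x \<bullet> x < 1" for x :: "'a::real_inner"
  by (simp_all add: mem_cball_0 norm_eq_sqrt_inner)

lemma cofactor_square: "x \<in> cball 0 1 \<Longrightarrow> (cofactor x)\<^sup>2 = 1 - x \<bullet> x"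
  by (simp add: cofactor_def mem_cball_iff_inner)

lemma inner_1: "x \<bullet> (y::real^1) = x$1 * y$1"
  by (simp add: inner_vec_def)

lemma inner_2: "x \<bullet> (y::real^2) = x$1 * y$1 + x$2 * y$2"
  by (simp add: inner_vec_def sum_2)

lemma inner_3: "x \<bullet> (y::real^3) = x$1 * y$1 + x$2 * y$2 + x$3 * y$3"
  by (simp add: inner_vec_def sum_3)

lemma cofactor_relation:
  "x \<in> D3 \<Longrightarrow> (cofactor x)\<^sup>2 + (x$1)\<^sup>2 + (x$2)\<^sup>2 + (x$3)\<^sup>2 = 1"
  "y \<in> D2 \<Longrightarrow> (y$1)\<^sup>2 + (y$2)\<^sup>2 + (cofactor y)\<^sup>2 = 1"
  "z \<in> D1 \<Longrightarrow> (z$1)\<^sup>2 + (cofactor z)\<^sup>2 = 1"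
  by (simp_all add: cofactor_square inner_1 inner_2 inner_3)
    (simp_all add: power2_eq_square)

text \<open>For \<open>x\<close> in the disc, the quaternion parameter of \<open>matA x\<close> is
  -(X - v)^2 with v = x1 i + x2 j + x3 k. On the boundary X = 0, and it becomes 1.\<close>

lemma mat_rot:
  "matA x = rotA (1 - 2 * (cofactor x)\<^sup>2) (2 * x$1 * cofactor x) (2 * x$2 * cofactor x) (2 * x$3 * cofactor x)"
  "matB y = rotB (y$1) (y$2) (cofactor y)"
  "matC z = rotC (z$1) (cofactor z)"
  "matD w = rotD (w$1) (w$2) (cofactor w)"
  by (simp_all add: matA_def matB_def matC_def matD_def rot_defs Let_def cofactor_def
      inner_1 inner_2 inner_3 power2_eq_square diff_diff_add)

lemma spin_pair_mat:
  "x \<in> D3 \<Longrightarrow> spin_pair (matA x) (matA x)"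
  "y \<in> D2 \<Longrightarrow> spin_pair (matB y) (matB y)"
  "z \<in> D1 \<Longrightarrow> spin_pair (matC z) (matC z)"
  "w \<in> D2 \<Longrightarrow> spin_pair (rotD_lift (w$1) (w$2) (cofactor w)) (matD w)"
proof -
  show "spin_pair (matA x) (matA x)" if "x \<in> D3"
    unfolding mat_rot using cofactor_relation(1)[OF that] by (intro spin_pair_rot) algebra
  show "spin_pair (matB y) (matB y)" if "y \<in> D2"
    unfolding mat_rot using cofactor_relation(2)[OF that] by (intro spin_pair_rot)
  show "spin_pair (matC z) (matC z)" if "z \<in> D1"
    unfolding mat_rot using cofactor_relation(3)[OF that] by (intro spin_pair_rot)
  show "spin_pair (rotD_lift (w$1) (w$2) (cofactor w)) (matD w)" if "w \<in> D2"
    unfolding mat_rot using cofactor_relation(2)[OF that] by (intro spin_pair_rot)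
qed

section \<open>The stabilizer subgroups and the place of the characteristic maps in them\<close>

text \<open>The condition concerns \<open>g\<close>, and \<open>G\<close> itself may move e_1. It
  amounts to \<open>G\<close> commuting with left multiplication by e_1, that is, to complex
  linearity on R^8 = C^4.\<close>

definition SU4 :: "(real^8^8) set" where
  "SU4 = {G. \<exists>g. spin_pair g G \<and> g *v axis 1 1 = axis 1 1}"

definition SU3 :: "(real^8^8) set" where
  "SU3 = {G \<in> SU4. G *v axis 0 1 = axis 0 1}"

definition SU2 :: "(real^8^8) set" where
  "SU2 = {G \<in> SU3. G *v axis 2 1 = axis 2 1}"

lemma subgroup_chain: "SU2 \<subseteq> SU3" "SU3 \<subseteq> SU4" "SU4 \<subseteq> Spin7"
  by (auto simp: SU2_def SU3_def SU4_def Spin7_iff)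

lemma Spin7_group:
  "mat 1 \<in> Spin7" "G \<in> Spin7 \<Longrightarrow> H \<in> Spin7 \<Longrightarrow> G ** H \<in> Spin7" "G \<in> Spin7 \<Longrightarrow> transpose G \<in> Spin7"
  unfolding Spin7_iff using spin_pair_id spin_pair_mult spin_pair_transpose by blast+

lemma Spin7_orthogonal: "G \<in> Spin7 \<Longrightarrow> orthogonal_matrix G"
  using spin_pair_orthogonal by (auto simp: Spin7_iff)

lemma SU4_group:
  "mat 1 \<in> SU4" "G \<in> SU4 \<Longrightarrow> H \<in> SU4 \<Longrightarrow> G ** H \<in> SU4" "G \<in> SU4 \<Longrightarrow> transpose G \<in> SU4"
proof -
  show "mat 1 \<in> SU4" using spin_pair_id by (force simp: SU4_def)
  show "G ** H \<in> SU4" if "G \<in> SU4" "H \<in> SU4"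
    using that spin_pair_mult by (fastforce simp: SU4_def simp flip: matrix_vector_mul_assoc)
  show "transpose G \<in> SU4" if "G \<in> SU4"
    using that spin_pair_transpose spin_pair_orthogonal(1) orthogonal_fix_transpose unfolding SU4_def by blast
qed

lemma SU4_orthogonal: "G \<in> SU4 \<Longrightarrow> orthogonal_matrix G"
  using subgroup_chain Spin7_orthogonal by blast

lemma SU3_group:
  "mat 1 \<in> SU3" "G \<in> SU3 \<Longrightarrow> H \<in> SU3 \<Longrightarrow> G ** H \<in> SU3" "G \<in> SU3 \<Longrightarrow> transpose G \<in> SU3"
  by (simp_all add: SU3_def SU4_group SU4_orthogonal orthogonal_fix_transpose flip: matrix_vector_mul_assoc)

lemma SU3_orthogonal: "G \<in> SU3 \<Longrightarrow> orthogonal_matrix G"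
  using subgroup_chain SU4_orthogonal by blast

lemma SU2_group:
  "mat 1 \<in> SU2" "G \<in> SU2 \<Longrightarrow> H \<in> SU2 \<Longrightarrow> G ** H \<in> SU2" "G \<in> SU2 \<Longrightarrow> transpose G \<in> SU2"
  by (simp_all add: SU2_def SU3_group SU3_orthogonal orthogonal_fix_transpose flip: matrix_vector_mul_assoc)

text \<open>Put y = e_0 in the defining identity. From this link of the chain on, the elements are
  automorphisms of the Cayley algebra, so products of fixed vectors are fixed.\<close>

lemma SU3_spin_pair:
  assumes "spin_pair g G" "G *v axis 0 1 = axis 0 1"
  shows "g = G"
  using spin_pair_apply[OF assms(1)] by (simp add: assms(2) matrix_eq)

lemma SU3D:
  assumes "G \<in> SU3"
  shows "spin_pair G G" "G *v axis 0 1 = axis 0 1" "G *v axis 1 1 = axis 1 1"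
    "(G *v x) \<bullet>\<^sub>C (G *v y) = G *v (x \<bullet>\<^sub>C y)"
proof -
  obtain g where g: "spin_pair g G" "g *v axis 1 1 = axis 1 1" "G *v axis 0 1 = axis 0 1"
    using assms by (auto simp: SU3_def SU4_def)
  moreover have "g = G" using SU3_spin_pair g by blast
  ultimately show "spin_pair G G" "G *v axis 0 1 = axis 0 1" "G *v axis 1 1 = axis 1 1"
    "(G *v x) \<bullet>\<^sub>C (G *v y) = G *v (x \<bullet>\<^sub>C y)"
    by (auto simp: spin_pair_def)
qed

lemma SU2D:
  assumes "G \<in> SU2"
  shows "G *v axis 0 1 = axis 0 1" "G *v axis 1 1 = axis 1 1" "G *v axis 2 1 = axis 2 1" "G *v axis 3 1 = axis 3 1"
proof -
  have G: "G \<in> SU3" using assms subgroup_chain by auto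
  show *: "G *v axis 0 1 = axis 0 1" "G *v axis 1 1 = axis 1 1" "G *v axis 2 1 = axis 2 1"
    using SU3D[OF G] assms by (auto simp: SU2_def)
  show "G *v axis 3 1 = axis 3 1"
    using SU3D(4)[OF G, of "axis 1 1" "axis 2 1"] unfolding * by (simp add: vec8_simps)
qed

lemma matrix_eq_mat1I:
  assumes "\<forall>i. G *v axis i 1 = axis i (1::real)" shows "(G::real^'n^'n) = mat 1"
proof -
  have "(*v) G = (\<lambda>x. x)"
    by (rule linear_eq_stdbasis) (use assms in \<open>auto simp: Basis_vec_def linear_id[unfolded id_def]\<close>)
  then show ?thesis by (simp add: matrix_eq fun_eq_iff)
qed

text \<open>The vectors e_1, e_2, e_4 generate the Cayley algebra: e_5 = e_1 e_4, e_6 = e_4 e_2, e_7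
  = e_1 e_6.\<close>

lemma SU2_trivial:
  assumes "G \<in> SU2" "G *v axis 4 1 = axis 4 1"
  shows "G = mat 1"
proof -
  have G: "G \<in> SU3" using assms subgroup_chain by auto
  note hom = SU3D(4)[OF G]
  note * = SU2D[OF assms(1)] assms(2)
  have 5: "G *v axis 5 1 = axis 5 1"
    using hom[of "axis 1 1" "axis 4 1"] unfolding * by (simp add: vec8_simps)
  have 6: "G *v axis 6 1 = axis 6 1"
    using hom[of "axis 4 1" "axis 2 1"] unfolding * by (simp add: vec8_simps)
  have 7: "G *v axis 7 1 = axis 7 1"
    using hom[of "axis 1 1" "axis 6 1"] unfolding * 6 by (simp add: vec8_simps)
  show ?thesis by (rule matrix_eq_mat1I) (simp add: forall_8 * 5 6 7)
qed

lemma SU_mat: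
  "x \<in> D3 \<Longrightarrow> matA x \<in> SU2" "y \<in> D2 \<Longrightarrow> matB y \<in> SU3" "w \<in> D2 \<Longrightarrow> matD w \<in> SU4"
proof -
  show "matA x \<in> SU2" if "x \<in> D3"
    using spin_pair_mat(1)[OF that] by (auto simp: SU2_def SU3_def SU4_def mat_rot rotA_def vec8_simps)
  show "matB y \<in> SU3" if "y \<in> D2"
    using spin_pair_mat(2)[OF that] by (auto simp: SU3_def SU4_def mat_rot rotB_def vec8_simps)
  show "matD w \<in> SU4" if "w \<in> D2"
    using spin_pair_mat(4)[OF that] by (force simp: SU4_def rotD_lift_def vec8_simps)
qed

lemma mat_orthogonal:
  "x \<in> D3 \<Longrightarrow> orthogonal_matrix (matA x)" "y \<in> D2 \<Longrightarrow> orthogonal_matrix (matB y)"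
  "z \<in> D1 \<Longrightarrow> orthogonal_matrix (matC z)" "w \<in> D2 \<Longrightarrow> orthogonal_matrix (matD w)"
  using spin_pair_mat spin_pair_orthogonal(2) by blast+

lemma phi_transpose:
  "y \<in> D2 \<Longrightarrow> phi5 (x, y) = matB y ** matA x ** transpose (matB y)"
  "y \<in> D2 \<Longrightarrow> z \<in> D1 \<Longrightarrow>
     phi6 (x, y, z) = matC z ** matB y ** matA x ** transpose (matB y) ** transpose (matC z)"
  "y \<in> D2 \<Longrightarrow> w \<in> D2 \<Longrightarrow>
     phi7 (x, y, w) = matD w ** matB y ** matA x ** transpose (matB y) ** transpose (matD w)"
  by (simp_all add: phi5_def phi6_def phi7_def matrix_inv_orthogonal mat_orthogonal)

lemma phi3_SU2: "x \<in> D3 \<Longrightarrow> phi3 x \<in> SU2"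
  by (simp only: phi3_def SU_mat)

lemma phi5_SU3:
  assumes "v \<in> D3 \<times> D2" shows "phi5 v \<in> SU3"
proof -
  obtain x y where v: "v = (x, y)" "x \<in> D3" "y \<in> D2" using assms by auto
  then have "matA x \<in> SU3" "matB y \<in> SU3" using SU_mat subgroup_chain by blast+
  then show ?thesis by (simp add: v phi_transpose SU3_group)
qed

lemma phi7_SU4:
  assumes "v \<in> D3 \<times> D2 \<times> D2" shows "phi7 v \<in> SU4"
proof -
  obtain x y w where v: "v = (x, y, w)" "x \<in> D3" "y \<in> D2" "w \<in> D2" using assms by auto
  then have "matA x \<in> SU4" "matB y \<in> SU4" "matD w \<in> SU4" using SU_mat subgroup_chain by blast+
  then show ?thesis by (simp add: v phi_transpose SU4_group)
qed

text \<open>All conjugated and conjugating matrices are automorphisms. Hence the action of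
  \<open>phi6 v\<close> on e_1 through SO(7) is its ordinary action, and the orbit can be computed
  by multiplying matrices.\<close>

lemma phi6_spin_pair:
  assumes "v \<in> D3 \<times> D2 \<times> D1" shows "spin_pair (phi6 v) (phi6 v)"
proof -
  obtain x y z where v: "v = (x, y, z)" "x \<in> D3" "y \<in> D2" "z \<in> D1" using assms by auto
  then show ?thesis by (simp add: phi_transpose spin_pair_mult spin_pair_transpose spin_pair_mat)
qed

lemma phi6_Spin7: "v \<in> D3 \<times> D2 \<times> D1 \<Longrightarrow> phi6 v \<in> Spin7"
  using phi6_spin_pair Spin7_iff by blast

text \<open>The orbit map of the first link has to be a function of \<open>G\<close> alone;
  uniqueness of the partner makes the description meaningful on \<open>Spin7\<close>.\<close>

definition spin_image :: "real^8^8 \<Rightarrow> real^8" where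
  "spin_image G = (THE g. spin_pair g G) *v axis 1 1"

lemma spin_image_eq: "spin_pair g G \<Longrightarrow> spin_image G = g *v axis 1 1"
  unfolding spin_image_def using spin_pair_unique by (subst the_equality[of _ g]) auto

section \<open>Charts and orbit maps\<close>

declare mem_ball [simp del] mem_ball_0 [simp del]

text \<open>
  \<open>chart\<close> is the inverse of \<open>x \<mapsto> x / X\<close>.  In the coordinates \<open>x / X, y / Y, z / Z, w / W\<close> the equations
  for a preimage under an orbit map can be solved successively.
\<close>

definition chart_scale :: "'a::real_inner \<Rightarrow> real" where
  "chart_scale t = 1 / sqrt (1 + t \<bullet> t)"

definition chart :: "'a::real_inner \<Rightarrow> 'a" where
  "chart t = chart_scale t *\<^sub>R t"

lemma one_plus_inner_pos: "0 < 1 + t \<bullet> (t::'a::real_inner)"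
  by (simp add: add_pos_nonneg)

lemma chart_scale_pos: "chart_scale t > 0"
  using one_plus_inner_pos[of t] by (simp add: chart_scale_def)

lemma chart_scale_square: "(chart_scale t)\<^sup>2 * (1 + t \<bullet> t) = 1"
  using one_plus_inner_pos[of t] by (simp add: chart_scale_def power_divide)

lemma chart_in_ball: "chart t \<in> ball 0 1"
proof -
  have "chart t \<bullet> chart t = 1 - (chart_scale t)\<^sup>2"
    using chart_scale_square[of t] by (simp add: chart_def power2_eq_square algebra_simps)
  then show ?thesis using chart_scale_pos[of t] by (simp add: mem_ball_iff_inner)
qed

lemma cofactor_chart: "cofactor (chart t) = chart_scale t"
proof -
  have "chart t \<bullet> chart t = 1 - (chart_scale t)\<^sup>2"
    using chart_scale_square[of t] by (simp add: chart_def power2_eq_square algebra_simps)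
  then show ?thesis using chart_scale_pos[of t] by (simp add: cofactor_def)
qed

lemma chart_surj:
  assumes "x \<in> ball 0 1" obtains t where "x = chart t"
proof -
  have c: "(cofactor x)\<^sup>2 = 1 - x \<bullet> x" "cofactor x > 0"
    using assms by (auto simp: cofactor_def mem_ball_iff_inner)
  have "1 + (x /\<^sub>R cofactor x) \<bullet> (x /\<^sub>R cofactor x) = 1 / (cofactor x)\<^sup>2"
    using c by (simp add: field_simps power2_eq_square)
  then have "chart_scale (x /\<^sub>R cofactor x) = cofactor x"
    using c(2) by (simp add: chart_scale_def real_sqrt_divide)
  then show ?thesis using c(2) by (intro that[of "x /\<^sub>R cofactor x"]) (simp add: chart_def)
qed

lemma chart_nth: "chart t $ i = chart_scale t * t $ i"
  by (simp add: chart_def)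

section \<open>The orbit maps in chart coordinates\<close>

lemma rot_transpose:
  "transpose (rotA p q r s) = rotA p (-q) (-r) (-s)"
  "transpose (rotB p q r) = rotB p (-q) (-r)"
  "transpose (rotC p q) = rotC p (-q)"
  "transpose (rotD p q r) = rotD p (-q) (-r)"
  by (simp_all add: vec8_eq_iff transpose_def rot_defs)

lemma rot_apply:
  "rotA p q r s *v vec8 x0 x1 x2 x3 x4 x5 x6 x7 = vec8 x0 x1 x2 x3
     (p * x4 - q * x5 - r * x6 - s * x7) (q * x4 + p * x5 + s * x6 - r * x7)
     (r * x4 - s * x5 + p * x6 + q * x7) (s * x4 + r * x5 - q * x6 + p * x7)"
  "rotB p q r *v vec8 x0 x1 x2 x3 x4 x5 x6 x7 = vec8 x0 x1
     (p * x2 - q * x3 - r * x4) (q * x2 + p * x3 - r * x5)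
     (r * x2 + p * x4 + q * x5) (r * x3 - q * x4 + p * x5) x6 x7"
  "rotC p q *v vec8 x0 x1 x2 x3 x4 x5 x6 x7 =
     vec8 x0 (p * x1 - q * x3) x2 (q * x1 + p * x3) x4 (p * x5 - q * x7) x6 (q * x5 + p * x7)"
  "rotD p q r *v vec8 x0 x1 x2 x3 x4 x5 x6 x7 = vec8
     (p * x0 - q * x1 - r * x2) (q * x0 + p * x1 - r * x3)
     (r * x0 + p * x2 + q * x3) (r * x1 - q * x2 + p * x3) x4 x5 x6 x7"
  by (simp_all add: rot_defs vec8_simps)

text \<open>Coordinates 4 and 5 are the real and imaginary parts of 2 X^2 Y^2 (1 - i t1)(u1 - i u2),
  and coordinate 2 reveals the real factor in front. This triangular shape is what the charts are
  chosen for.\<close>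

lemma rotB_orbit:
  assumes "X\<^sup>2 * (1 + t1\<^sup>2 + t2\<^sup>2 + t3\<^sup>2) = (1::real)" "Y\<^sup>2 * (1 + u1\<^sup>2 + u2\<^sup>2) = 1"
  shows "(rotB (Y * u1) (Y * u2) Y ** rotA (1 - 2 * X\<^sup>2) (2 * (X * t1) * X) (2 * (X * t2) * X) (2 * (X * t3) * X)
      ** rotB (Y * u1) (- (Y * u2)) (- Y)) *v axis 2 1
    = vec8 0 0 (1 - 2 * X\<^sup>2 * Y\<^sup>2) (2 * X\<^sup>2 * Y\<^sup>2 * t1)
        (2 * X\<^sup>2 * Y\<^sup>2 * (u1 - t1 * u2)) (- 2 * X\<^sup>2 * Y\<^sup>2 * (u2 + t1 * u1))
        (- 2 * X\<^sup>2 * Y * t2) (- 2 * X\<^sup>2 * Y * t3)"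
  unfolding matrix_vector_mul_assoc[symmetric] axis_vec8 rot_apply vec8_inject
  by (insert assms, intro conjI) (rule refl | algebra | (simp add: algebra_simps power2_eq_square; fail))+

lemma rotD_orbit:
  assumes "X\<^sup>2 * (1 + t1\<^sup>2 + t2\<^sup>2 + t3\<^sup>2) = (1::real)" "Y\<^sup>2 * (1 + u1\<^sup>2 + u2\<^sup>2) = 1"
    "W\<^sup>2 * (1 + v1\<^sup>2 + v2\<^sup>2) = 1"
  shows "(rotD (W * v1) (W * v2) W ** rotB (Y * u1) (Y * u2) Y **
      rotA (1 - 2 * X\<^sup>2) (2 * (X * t1) * X) (2 * (X * t2) * X) (2 * (X * t3) * X)
      ** rotB (Y * u1) (- (Y * u2)) (- Y) ** rotD (W * v1) (- (W * v2)) (- W)) *v axis 0 1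
    = vec8 (1 - 2 * X\<^sup>2 * Y\<^sup>2 * W\<^sup>2) (2 * X\<^sup>2 * Y\<^sup>2 * W\<^sup>2 * t1)
        (2 * X\<^sup>2 * Y\<^sup>2 * W\<^sup>2 * (v1 - t1 * v2)) (- 2 * X\<^sup>2 * Y\<^sup>2 * W\<^sup>2 * (v2 + t1 * v1))
        (- 2 * X\<^sup>2 * Y\<^sup>2 * W * (u1 - t1 * u2)) (2 * X\<^sup>2 * Y\<^sup>2 * W * (u2 + t1 * u1))
        (2 * X\<^sup>2 * Y * W * t2) (2 * X\<^sup>2 * Y * W * t3)"
  unfolding matrix_vector_mul_assoc[symmetric] axis_vec8 rot_apply vec8_inject
  by (insert assms, intro conjI) (rule refl | algebra | (simp add: algebra_simps power2_eq_square; fail))+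

lemma rotC_orbit:
  assumes "X\<^sup>2 * (1 + t1\<^sup>2 + t2\<^sup>2 + t3\<^sup>2) = (1::real)" "Y\<^sup>2 * (1 + u1\<^sup>2 + u2\<^sup>2) = 1"
    "Z\<^sup>2 * (1 + s\<^sup>2) = 1"
  shows "(rotC (Z * s) Z ** rotB (Y * u1) (Y * u2) Y **
      rotA (1 - 2 * X\<^sup>2) (2 * (X * t1) * X) (2 * (X * t2) * X) (2 * (X * t3) * X)
      ** rotB (Y * u1) (- (Y * u2)) (- Y) ** rotC (Z * s) (- Z)) *v axis 1 1
    = vec8 0 (1 - 2 * X\<^sup>2 * Y\<^sup>2 * Z\<^sup>2) (2 * X\<^sup>2 * Y\<^sup>2 * Z * t1) (2 * X\<^sup>2 * Y\<^sup>2 * Z\<^sup>2 * s)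
        (- 2 * X\<^sup>2 * Y\<^sup>2 * Z * (u2 + t1 * u1))
        (- 2 * X\<^sup>2 * Y * Z\<^sup>2 * (s * Y * (u1 - t1 * u2) + t2))
        (- 2 * X\<^sup>2 * Y * Z * t3)
        (- 2 * X\<^sup>2 * Y * Z\<^sup>2 * (Y * (u1 - t1 * u2) - s * t2))"
  unfolding matrix_vector_mul_assoc[symmetric] axis_vec8 rot_apply vec8_inject
  by (insert assms, intro conjI) (rule refl | algebra | (simp add: algebra_simps power2_eq_square; fail))+

lemma mult_pos_cancel: "a * c = b * c \<Longrightarrow> 0 < c \<Longrightarrow> a = (b::real)"
  by simp

text \<open>Both lemmas concern the complex equation \<open>(1 - i s) (u\<^sub>1 - i u\<^sub>2) = c\<close>.\<close>

lemma linear_system_unique: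
  fixes a b :: real
  assumes "a - s * b = a' - s * b'" "b + s * a = b' + s * a'"
  shows "a = a'" "b = b'"
proof -
  have "(1 + s * s) * (a - a') = 0" "(1 + s * s) * (b - b') = 0"
    using assms by algebra+
  moreover have "1 + s * s > 0" by (simp add: add_pos_nonneg)
  ultimately show "a = a'" "b = b'" by auto
qed

lemma linear_system_solve:
  fixes a b E s :: real
  assumes "E > 0"
  obtains u :: "real^2" where "E * (u$1 - s * u$2) = a" "- E * (u$2 + s * u$1) = b"
proof -
  define q where "q = E * (1 + s * s)"
  have q: "q > 0" using assms by (simp add: q_def add_pos_nonneg)
  define u where "u = (vector [(a - s * b) / q, - (b + s * a) / q] :: real^2)"
  have u: "u$1 = (a - s * b) / q" "u$2 = - (b + s * a) / q" by (simp_all add: u_def)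
  have "u$1 * q = a - s * b" "u$2 * q = - (b + s * a)" using q by (simp_all add: u)
  then have "E * (u$1 - s * u$2) * (1 + s * s) = a * (1 + s * s)"
    "- E * (u$2 + s * u$1) * (1 + s * s) = b * (1 + s * s)"
    unfolding q_def by algebra+
  moreover have "1 + s * s > 0" by (simp add: add_pos_nonneg)
  ultimately show ?thesis by (blast intro: that mult_pos_cancel)
qed

text \<open>Expanding the squared distance from the base point gives 2 - 2 c_i > 0. So E = 1 - c_i
  is a legitimate divisor when preimages are computed.\<close>

lemma unit_coordinate_less:
  fixes c :: "real^'n"
  assumes "c \<bullet> c = 1" "c \<noteq> axis i 1"
  shows "c $ i < 1"
proof -
  have "(c - axis i 1) \<bullet> (c - axis i 1) > 0" using assms(2) by simp
  then show ?thesis using assms(1) by (simp add: inner_diff inner_axis inner_axis')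
qed

lemma vec_eq_2: "x = (y :: 'a^2) \<longleftrightarrow> x$1 = y$1 \<and> x$2 = y$2"
  and vec_eq_3: "v = (w :: 'a^3) \<longleftrightarrow> v$1 = w$1 \<and> v$2 = w$2 \<and> v$3 = w$3"
  by (simp_all add: vec_eq_iff forall_2 forall_3)

lemma chart_scale_relation:
  "(chart_scale s)\<^sup>2 * (1 + (s$1)\<^sup>2) = 1"
  "(chart_scale u)\<^sup>2 * (1 + (u$1)\<^sup>2 + (u$2)\<^sup>2) = 1"
  "(chart_scale t)\<^sup>2 * (1 + (t$1)\<^sup>2 + (t$2)\<^sup>2 + (t$3)\<^sup>2) = 1"
  for s :: "real^1" and u :: "real^2" and t :: "real^3"
  using chart_scale_square[of s] chart_scale_square[of u] chart_scale_square[of t]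
  by (simp_all add: inner_1 inner_2 inner_3 power2_eq_square add.assoc)

lemma chart_in_cball: "chart t \<in> cball 0 1"
  using chart_in_ball ball_subset_cball by blast

text \<open>This is the inverse of stereographic projection from e_4, since 2 X^2 = 2 / (1 +
  |t|^2).\<close>

definition orbit3 :: "real^3 \<Rightarrow> real^8" where
  "orbit3 t = (let X = chart_scale t in
     vec8 0 0 0 0 (1 - 2 * X\<^sup>2) (2 * X\<^sup>2 * t$1) (2 * X\<^sup>2 * t$2) (2 * X\<^sup>2 * t$3))"

definition orbit5 :: "real^3 \<Rightarrow> real^2 \<Rightarrow> real^8" where
  "orbit5 t u = (let X = chart_scale t; Y = chart_scale u in
     vec8 0 0 (1 - 2 * X\<^sup>2 * Y\<^sup>2) (2 * X\<^sup>2 * Y\<^sup>2 * t$1)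
       (2 * X\<^sup>2 * Y\<^sup>2 * (u$1 - t$1 * u$2)) (- 2 * X\<^sup>2 * Y\<^sup>2 * (u$2 + t$1 * u$1))
       (- 2 * X\<^sup>2 * Y * t$2) (- 2 * X\<^sup>2 * Y * t$3))"

definition orbit7 :: "real^3 \<Rightarrow> real^2 \<Rightarrow> real^2 \<Rightarrow> real^8" where
  "orbit7 t u v = (let X = chart_scale t; Y = chart_scale u; W = chart_scale v in
     vec8 (1 - 2 * X\<^sup>2 * Y\<^sup>2 * W\<^sup>2) (2 * X\<^sup>2 * Y\<^sup>2 * W\<^sup>2 * t$1)
        (2 * X\<^sup>2 * Y\<^sup>2 * W\<^sup>2 * (v$1 - t$1 * v$2)) (- 2 * X\<^sup>2 * Y\<^sup>2 * W\<^sup>2 * (v$2 + t$1 * v$1))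
        (- 2 * X\<^sup>2 * Y\<^sup>2 * W * (u$1 - t$1 * u$2)) (2 * X\<^sup>2 * Y\<^sup>2 * W * (u$2 + t$1 * u$1))
        (2 * X\<^sup>2 * Y * W * t$2) (2 * X\<^sup>2 * Y * W * t$3))"

definition orbit6 :: "real^3 \<Rightarrow> real^2 \<Rightarrow> real^1 \<Rightarrow> real^8" where
  "orbit6 t u s = (let X = chart_scale t; Y = chart_scale u; Z = chart_scale s in
     vec8 0 (1 - 2 * X\<^sup>2 * Y\<^sup>2 * Z\<^sup>2) (2 * X\<^sup>2 * Y\<^sup>2 * Z * t$1) (2 * X\<^sup>2 * Y\<^sup>2 * Z\<^sup>2 * s$1)
        (- 2 * X\<^sup>2 * Y\<^sup>2 * Z * (u$2 + t$1 * u$1))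
        (- 2 * X\<^sup>2 * Y * Z\<^sup>2 * (s$1 * Y * (u$1 - t$1 * u$2) + t$2))
        (- 2 * X\<^sup>2 * Y * Z * t$3)
        (- 2 * X\<^sup>2 * Y * Z\<^sup>2 * (Y * (u$1 - t$1 * u$2) - s$1 * t$2)))"

lemma phi_orbit:
  "phi3 (chart t) *v axis 4 1 = orbit3 t"
  "phi5 (chart t, chart u) *v axis 2 1 = orbit5 t u"
  "phi6 (chart t, chart u, chart s) *v axis 1 1 = orbit6 t u s"
  "phi7 (chart t, chart u, chart v) *v axis 0 1 = orbit7 t u v"
proof -
  show "phi3 (chart t) *v axis 4 1 = orbit3 t"
    by (simp add: phi3_def mat_rot cofactor_chart chart_nth axis_vec8 rot_apply orbit3_def Let_def power2_eq_square)
  show "phi5 (chart t, chart u) *v axis 2 1 = orbit5 t u"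
    using rotB_orbit[OF chart_scale_relation(3)[of t] chart_scale_relation(2)[of u]]
    by (simp only: phi_transpose chart_in_cball mat_rot rot_transpose cofactor_chart chart_nth
        orbit5_def Let_def mult.assoc[of 2] matrix_mul_assoc)
  show "phi6 (chart t, chart u, chart s) *v axis 1 1 = orbit6 t u s"
    using rotC_orbit[OF chart_scale_relation(3)[of t] chart_scale_relation(2)[of u] chart_scale_relation(1)[of s]]
    by (simp only: phi_transpose chart_in_cball mat_rot rot_transpose cofactor_chart chart_nth
        orbit6_def Let_def mult.assoc[of 2] matrix_mul_assoc)
  show "phi7 (chart t, chart u, chart v) *v axis 0 1 = orbit7 t u v"
    using rotD_orbit[OF chart_scale_relation(3)[of t] chart_scale_relation(2)[of u] chart_scale_relation(2)[of v]]
    by (simp only: phi_transpose chart_in_cball mat_rot rot_transpose cofactor_chart chart_nth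
        orbit7_def Let_def mult.assoc[of 2] matrix_mul_assoc)
qed

section \<open>Injectivity of the orbit maps\<close>

lemma orbit3_inj:
  assumes "orbit3 t = orbit3 t'" shows "t = t'"
proof -
  have "(chart_scale t)\<^sup>2 = (chart_scale t')\<^sup>2" "(chart_scale t)\<^sup>2 * t$1 = (chart_scale t')\<^sup>2 * t'$1"
    "(chart_scale t)\<^sup>2 * t$2 = (chart_scale t')\<^sup>2 * t'$2" "(chart_scale t)\<^sup>2 * t$3 = (chart_scale t')\<^sup>2 * t'$3"
    using assms by (auto simp: orbit3_def Let_def)
  then show ?thesis using chart_scale_pos[of t'] by (simp add: vec_eq_3)
qed

lemma orbit5_inj:
  assumes "orbit5 t u = orbit5 t' u'" shows "t = t' \<and> u = u'"
proof -
  define X where "X = chart_scale t"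
  define Y where "Y = chart_scale u"
  define X' where "X' = chart_scale t'"
  define Y' where "Y' = chart_scale u'"
  \<comment> \<open>Coordinate 2 is 1 - 2 E, so \<open>E\<close> agrees on both sides and cancels
    from coordinates 3, 4 and 5.\<close>
  define E where "E = X\<^sup>2 * Y\<^sup>2"
  have pos: "X > 0" "Y > 0" "X' > 0" "Y' > 0" using chart_scale_pos by (auto simp: X_def Y_def X'_def Y'_def)
  have E: "X'\<^sup>2 * Y'\<^sup>2 = E" and E0: "E \<noteq> 0" using assms pos
    by (simp_all add: E_def orbit5_def Let_def X_def Y_def X'_def Y'_def)
  have *: "E * t$1 = E * t'$1" "E * (u$1 - t$1 * u$2) = E * (u'$1 - t'$1 * u'$2)"
    "E * (u$2 + t$1 * u$1) = E * (u'$2 + t'$1 * u'$1)"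
    "X\<^sup>2 * Y * t$2 = X'\<^sup>2 * Y' * t'$2" "X\<^sup>2 * Y * t$3 = X'\<^sup>2 * Y' * t'$3"
    by (insert assms[unfolded orbit5_def Let_def vec8_inject, folded X_def Y_def X'_def Y'_def] E E_def,
      elim conjE, algebra)+
  have t1: "t$1 = t'$1" using * E0 by simp
  have u: "u = u'"
    using linear_system_unique[of "u$1" "t$1" "u$2" "u'$1" "u'$2"] * E0 t1 by (simp add: vec_eq_2)
  \<comment> \<open>\<open>Y\<close> depends on \<open>u\<close> alone. Knowing it splits
    \<open>E\<close> into its two factors while the last two entries of \<open>t\<close> are still
    open.\<close>
  then have Y: "Y = Y'" by (simp add: Y_def Y'_def)
  then have "X\<^sup>2 = X'\<^sup>2" using E pos by (simp add: E_def)
  then have "t$2 = t'$2" "t$3 = t'$3" using * Y pos by auto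
  with t1 u show ?thesis by (simp add: vec_eq_3)
qed

lemma orbit7_inj:
  assumes "orbit7 t u v = orbit7 t' u' v'" shows "t = t' \<and> u = u' \<and> v = v'"
proof -
  define X where "X = chart_scale t"
  define Y where "Y = chart_scale u"
  define W where "W = chart_scale v"
  define X' where "X' = chart_scale t'"
  define Y' where "Y' = chart_scale u'"
  define W' where "W' = chart_scale v'"
  define E where "E = X\<^sup>2 * Y\<^sup>2 * W\<^sup>2"
  note defs = X_def Y_def W_def X'_def Y'_def W'_def
  have pos: "X > 0" "Y > 0" "W > 0" "X' > 0" "Y' > 0" "W' > 0" using chart_scale_pos by (auto simp: defs)
  have E: "X'\<^sup>2 * Y'\<^sup>2 * W'\<^sup>2 = E" and E0: "E \<noteq> 0" using assms pos
    by (simp_all add: E_def orbit7_def Let_def defs)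
  have *: "E * t$1 = E * t'$1" "E * (v$1 - t$1 * v$2) = E * (v'$1 - t'$1 * v'$2)"
    "E * (v$2 + t$1 * v$1) = E * (v'$2 + t'$1 * v'$1)"
    "X\<^sup>2 * Y\<^sup>2 * W * (u$1 - t$1 * u$2) = X'\<^sup>2 * Y'\<^sup>2 * W' * (u'$1 - t'$1 * u'$2)"
    "X\<^sup>2 * Y\<^sup>2 * W * (u$2 + t$1 * u$1) = X'\<^sup>2 * Y'\<^sup>2 * W' * (u'$2 + t'$1 * u'$1)"
    "X\<^sup>2 * Y * W * t$2 = X'\<^sup>2 * Y' * W' * t'$2" "X\<^sup>2 * Y * W * t$3 = X'\<^sup>2 * Y' * W' * t'$3"
    by (insert assms[unfolded orbit7_def Let_def vec8_inject, folded defs] E E_def, elim conjE, algebra)+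
  have t1: "t$1 = t'$1" using * E0 by simp
  have v: "v = v'"
    using linear_system_unique[of "v$1" "t$1" "v$2" "v'$1" "v'$2"] * E0 t1 by (simp add: vec_eq_2)
  then have W: "W = W'" by (simp add: defs)
  then have XY: "X\<^sup>2 * Y\<^sup>2 = X'\<^sup>2 * Y'\<^sup>2" using E pos by (simp add: E_def)
  have u: "u = u'"
    using linear_system_unique[of "u$1" "t$1" "u$2" "u'$1" "u'$2"] *(4,5) XY W pos t1 by (simp add: vec_eq_2)
  then have Y: "Y = Y'" by (simp add: defs)
  then have "X\<^sup>2 = X'\<^sup>2" using XY pos by simp
  then have "t$2 = t'$2" "t$3 = t'$3" using * Y W pos by auto
  with t1 u v show ?thesis by (simp add: vec_eq_3)
qed

lemma orbit6_inj:
  assumes "orbit6 t u s = orbit6 t' u' s'" shows "t = t' \<and> u = u' \<and> s = s'"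
proof -
  define X where "X = chart_scale t"
  define Y where "Y = chart_scale u"
  define Z where "Z = chart_scale s"
  define X' where "X' = chart_scale t'"
  define Y' where "Y' = chart_scale u'"
  define Z' where "Z' = chart_scale s'"
  define E where "E = X\<^sup>2 * Y\<^sup>2 * Z\<^sup>2"
  \<comment> \<open>Coordinates 5 and 7 mix \<open>P\<close> with \<open>t$2\<close>: up to a real
    factor they are the imaginary and real parts of (P + i t2 / Y)(1 + i s1). Thus \<open>P\<close>
    and the quotient t2 / Y are recovered together, before \<open>Y = Y'\<close> is known.\<close>
  define P where "P = u$1 - t$1 * u$2"
  define P' where "P' = u'$1 - t'$1 * u'$2"
  note defs = X_def Y_def Z_def X'_def Y'_def Z'_def
  have pos: "X > 0" "Y > 0" "Z > 0" "X' > 0" "Y' > 0" "Z' > 0" using chart_scale_pos by (auto simp: defs)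
  have E: "X'\<^sup>2 * Y'\<^sup>2 * Z'\<^sup>2 = E" and E0: "E \<noteq> 0" using assms pos
    by (simp_all add: E_def orbit6_def Let_def defs)
  have *: "E * s$1 = E * s'$1" "X\<^sup>2 * Y\<^sup>2 * Z * t$1 = X'\<^sup>2 * Y'\<^sup>2 * Z' * t'$1"
    "X\<^sup>2 * Y\<^sup>2 * Z * (u$2 + t$1 * u$1) = X'\<^sup>2 * Y'\<^sup>2 * Z' * (u'$2 + t'$1 * u'$1)"
    "X\<^sup>2 * Y * Z\<^sup>2 * (s$1 * Y * P + t$2) = X'\<^sup>2 * Y' * Z'\<^sup>2 * (s'$1 * Y' * P' + t'$2)"
    "X\<^sup>2 * Y * Z\<^sup>2 * (Y * P - s$1 * t$2) = X'\<^sup>2 * Y' * Z'\<^sup>2 * (Y' * P' - s'$1 * t'$2)"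
    "X\<^sup>2 * Y * Z * t$3 = X'\<^sup>2 * Y' * Z' * t'$3"
    by (insert assms[unfolded orbit6_def Let_def vec8_inject, folded defs P_def P'_def] E E_def, elim conjE, algebra)+
  have s1: "s$1 = s'$1" using * E0 by simp
  then have s: "s = s'" by (simp add: vec_eq_iff forall_1)
  then have Z: "Z = Z'" by (simp add: defs)
  then have XY: "X\<^sup>2 * Y\<^sup>2 = X'\<^sup>2 * Y'\<^sup>2" using E pos by (simp add: E_def)
  have t1: "t$1 = t'$1" using *(2) XY Z pos by simp
  have "X\<^sup>2 * Y * Z\<^sup>2 * (s$1 * Y * P + t$2) = E * (t$2 / Y + s$1 * P)"
    "X\<^sup>2 * Y * Z\<^sup>2 * (Y * P - s$1 * t$2) = E * (P - s$1 * (t$2 / Y))"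
    unfolding E_def using pos by (simp_all add: field_simps power2_eq_square)
  moreover have "X'\<^sup>2 * Y' * Z'\<^sup>2 * (s'$1 * Y' * P' + t'$2) = E * (t'$2 / Y' + s$1 * P')"
    "X'\<^sup>2 * Y' * Z'\<^sup>2 * (Y' * P' - s'$1 * t'$2) = E * (P' - s$1 * (t'$2 / Y'))"
    unfolding E[symmetric] s1 using pos by (simp_all add: field_simps power2_eq_square)
  ultimately have PT: "P = P'" "t$2 / Y = t'$2 / Y'"
    using linear_system_unique[of P "s$1" "t$2 / Y" P' "t'$2 / Y'"] * E0 by simp_all
  have u: "u = u'"
    using linear_system_unique[of "u$1" "t$1" "u$2" "u'$1" "u'$2"] *(3) XY Z pos t1 PT(1)
    by (simp add: vec_eq_2 P_def P'_def)
  then have Y: "Y = Y'" by (simp add: defs)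
  then have "X\<^sup>2 = X'\<^sup>2" using XY pos by simp
  then have "t$2 = t'$2" "t$3 = t'$3" using PT * Y Z pos by auto
  with t1 u s show ?thesis by (simp add: vec_eq_3)
qed

section \<open>Surjectivity of the orbit maps onto the punctured spheres\<close>

lemma orbit3_surj:
  assumes c: "c \<bullet> c = 1" "c$0 = 0" "c$1 = 0" "c$2 = 0" "c$3 = 0" "c \<noteq> axis 4 1"
  obtains t where "c = orbit3 t"
proof -
  define E where "E = 1 - c$4"
  have E: "E > 0" using unit_coordinate_less[of c 4] c by (simp add: E_def)
  \<comment> \<open>The stereographic projection of \<open>c\<close> from e_4.\<close>
  define t where "t = (vector [c$5 / E, c$6 / E, c$7 / E] :: real^3)"
  have t: "E * t$1 = c$5" "E * t$2 = c$6" "E * t$3 = c$7" using E by (simp_all add: t_def vector_3)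
  define X where "X = chart_scale t"
  note X = chart_scale_relation(3)[of t, folded X_def]
  have "c$4 * c$4 + c$5 * c$5 + c$6 * c$6 + c$7 * c$7 = 1" using c by (simp add: inner_8)
  then have "E * (E * (1 + (t$1)\<^sup>2 + (t$2)\<^sup>2 + (t$3)\<^sup>2)) = E * 2"
    unfolding t[symmetric] using E_def by algebra
  then have "E * (1 + (t$1)\<^sup>2 + (t$2)\<^sup>2 + (t$3)\<^sup>2) = 2" using E by simp
  with X have XE: "2 * X\<^sup>2 = E" by algebra
  have "c = orbit3 t"
    unfolding vec8_eq_iff orbit3_def X_def[symmetric] Let_def vec8_nth XE t using c E_def by simp
  then show ?thesis by (rule that)
qed

text \<open>The unknowns are solved for as if the coefficient 2 X^2 Y^2 were E = 1 - c_2: t1 from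
  coordinate 3, \<open>u\<close> from 4 and 5, then t2 and t3 with the scale \<open>Y\<close> that
  \<open>u\<close> determines. The norm condition on \<open>c\<close> then yields exactly that this
  coefficient is \<open>E\<close>.\<close>

lemma orbit5_surj:
  assumes c: "c \<bullet> c = 1" "c$0 = 0" "c$1 = 0" "c \<noteq> axis 2 1"
  obtains t u where "c = orbit5 t u"
proof -
  define E where "E = 1 - c$2"
  have E: "E > 0" using unit_coordinate_less[of c 2] c by (simp add: E_def)
  obtain u :: "real^2" where u: "E * (u$1 - (c$3 / E) * u$2) = c$4" "- E * (u$2 + (c$3 / E) * u$1) = c$5"
    using linear_system_solve[OF E] by blast
  define Y where "Y = chart_scale u"
  have Y0: "Y > 0" by (simp add: Y_def chart_scale_pos)
  note Y = chart_scale_relation(2)[of u, folded Y_def]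
  define t where "t = (vector [c$3 / E, - (c$6 * Y) / E, - (c$7 * Y) / E] :: real^3)"
  have t1: "c$3 / E = t$1" by (simp add: t_def vector_3)
  have t: "E * t$1 = c$3" "E * t$2 = - (c$6 * Y)" "E * t$3 = - (c$7 * Y)" using E by (simp_all add: t_def vector_3)
  note u = u[unfolded t1]
  define X where "X = chart_scale t"
  note X = chart_scale_relation(3)[of t, folded X_def]
  have n: "c$2 * c$2 + c$3 * c$3 + c$4 * c$4 + c$5 * c$5 + c$6 * c$6 + c$7 * c$7 = 1" using c by (simp add: inner_8)
  \<comment> \<open>The modulus is multiplicative: c4^2 + c5^2 = E^2 (1 + t1^2)(u1^2 + u2^2). Adding
    E^2 + c3^2 = E^2 (1 + t1^2) produces the factor 1 + |u|^2, which \<open>Y\<close> squared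
    clears.\<close>
  have 1: "E * E * (1 + (t$1)\<^sup>2) = Y\<^sup>2 * (E * E + c$3 * c$3 + c$4 * c$4 + c$5 * c$5)"
    unfolding t(1)[symmetric] u[symmetric] using Y by algebra
  have "E * E * ((t$2)\<^sup>2 + (t$3)\<^sup>2) = (E * t$2)\<^sup>2 + (E * t$3)\<^sup>2" by algebra
  then have 2: "E * E * ((t$2)\<^sup>2 + (t$3)\<^sup>2) = Y\<^sup>2 * (c$6 * c$6 + c$7 * c$7)"
    unfolding t by (simp add: power2_eq_square algebra_simps)
  have 3: "E * E + c$3 * c$3 + c$4 * c$4 + c$5 * c$5 + c$6 * c$6 + c$7 * c$7 = 2 * E"
    using n E_def by algebra
  have "E * (E * (1 + (t$1)\<^sup>2 + (t$2)\<^sup>2 + (t$3)\<^sup>2)) = E * (2 * Y\<^sup>2)"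
    using 1 2 3 by algebra
  then have "E * (1 + (t$1)\<^sup>2 + (t$2)\<^sup>2 + (t$3)\<^sup>2) = 2 * Y\<^sup>2" using E by simp
  with X have XE: "2 * X\<^sup>2 * Y\<^sup>2 = E" by algebra
  have "- 2 * X\<^sup>2 * Y * t$2 * Y = - (E * t$2)" "- 2 * X\<^sup>2 * Y * t$3 * Y = - (E * t$3)"
    unfolding XE[symmetric] by algebra+
  then have "- 2 * X\<^sup>2 * Y * t$2 * Y = c$6 * Y" "- 2 * X\<^sup>2 * Y * t$3 * Y = c$7 * Y"
    unfolding t by simp_all
  then have "- 2 * X\<^sup>2 * Y * t$2 = c$6" "- 2 * X\<^sup>2 * Y * t$3 = c$7" using Y0 by (blast intro: mult_pos_cancel)+
  moreover have "- 2 * X\<^sup>2 * Y\<^sup>2 * (u$2 + t$1 * u$1) = c$5" unfolding u(2)[symmetric] XE[symmetric] by algebra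
  ultimately have "c = orbit5 t u"
    unfolding vec8_eq_iff orbit5_def X_def[symmetric] Y_def[symmetric] Let_def vec8_nth XE t u using c E_def by simp
  then show ?thesis by (rule that)
qed

lemma orbit7_surj:
  assumes c: "c \<bullet> c = 1" "c \<noteq> axis 0 1"
  obtains t u v where "c = orbit7 t u v"
proof -
  define E where "E = 1 - c$0"
  have E: "E > 0" using unit_coordinate_less[of c 0] c by (simp add: E_def)
  obtain v :: "real^2" where v: "E * (v$1 - (c$1 / E) * v$2) = c$2" "- E * (v$2 + (c$1 / E) * v$1) = c$3"
    using linear_system_solve[OF E] by blast
  define W where "W = chart_scale v"
  have W0: "W > 0" by (simp add: W_def chart_scale_pos)
  note W = chart_scale_relation(2)[of v, folded W_def]
  \<comment> \<open>The coefficient of coordinates 4 and 5 has one factor \<open>W\<close> less than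
    \<open>E\<close>; hence the \<open>W\<close>, already determined by \<open>v\<close>, on the
    right.\<close>
  obtain u :: "real^2" where u: "E * (u$1 - (c$1 / E) * u$2) = - (W * c$4)"
      "- E * (u$2 + (c$1 / E) * u$1) = - (W * c$5)"
    using linear_system_solve[OF E] by blast
  define Y where "Y = chart_scale u"
  have Y0: "Y > 0" by (simp add: Y_def chart_scale_pos)
  note Y = chart_scale_relation(2)[of u, folded Y_def]
  define t where "t = (vector [c$1 / E, c$6 * Y * W / E, c$7 * Y * W / E] :: real^3)"
  have t1: "c$1 / E = t$1" by (simp add: t_def vector_3)
  have t: "E * t$1 = c$1" "E * t$2 = c$6 * Y * W" "E * t$3 = c$7 * Y * W" using E by (simp_all add: t_def vector_3)
  note u = u[unfolded t1] and v = v[unfolded t1]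
  define X where "X = chart_scale t"
  note X = chart_scale_relation(3)[of t, folded X_def]
  have n: "c$0 * c$0 + c$1 * c$1 + c$2 * c$2 + c$3 * c$3 + c$4 * c$4 + c$5 * c$5 + c$6 * c$6 + c$7 * c$7 = 1"
    using c by (simp add: inner_8)
  have 0: "E * E * (1 + (t$1)\<^sup>2) = W\<^sup>2 * (E * E + c$1 * c$1 + c$2 * c$2 + c$3 * c$3)"
    unfolding t(1)[symmetric] v[symmetric] using W by algebra
  have "E * E * (1 + (t$1)\<^sup>2) = Y\<^sup>2 * (E * E * (1 + (t$1)\<^sup>2) + (- (W * c$4))\<^sup>2 + (- (W * c$5))\<^sup>2)"
    unfolding u[symmetric] using Y by algebra
  then have 1: "E * E * (1 + (t$1)\<^sup>2) = Y\<^sup>2 * (W\<^sup>2 * (E * E + c$1 * c$1 + c$2 * c$2 + c$3 * c$3 + c$4 * c$4 + c$5 * c$5))"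
    using 0 by algebra
  have "E * E * ((t$2)\<^sup>2 + (t$3)\<^sup>2) = (E * t$2)\<^sup>2 + (E * t$3)\<^sup>2" by algebra
  then have 2: "E * E * ((t$2)\<^sup>2 + (t$3)\<^sup>2) = Y\<^sup>2 * W\<^sup>2 * (c$6 * c$6 + c$7 * c$7)"
    unfolding t by (simp add: power2_eq_square algebra_simps)
  have 3: "E * E + c$1 * c$1 + c$2 * c$2 + c$3 * c$3 + c$4 * c$4 + c$5 * c$5 + c$6 * c$6 + c$7 * c$7 = 2 * E"
    using n E_def by algebra
  have "E * (E * (1 + (t$1)\<^sup>2 + (t$2)\<^sup>2 + (t$3)\<^sup>2)) = E * (2 * Y\<^sup>2 * W\<^sup>2)"
    using 1 2 3 by algebra
  then have "E * (1 + (t$1)\<^sup>2 + (t$2)\<^sup>2 + (t$3)\<^sup>2) = 2 * Y\<^sup>2 * W\<^sup>2" using E by simp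
  with X have XE: "2 * X\<^sup>2 * Y\<^sup>2 * W\<^sup>2 = E" by algebra
  have "2 * X\<^sup>2 * Y * W * t$2 * (Y * W) = E * t$2" "2 * X\<^sup>2 * Y * W * t$3 * (Y * W) = E * t$3"
    unfolding XE[symmetric] by algebra+
  then have "2 * X\<^sup>2 * Y * W * t$2 * (Y * W) = c$6 * (Y * W)" "2 * X\<^sup>2 * Y * W * t$3 * (Y * W) = c$7 * (Y * W)"
    unfolding t by (simp_all only: mult.assoc)
  then have 67: "2 * X\<^sup>2 * Y * W * t$2 = c$6" "2 * X\<^sup>2 * Y * W * t$3 = c$7" using mult_pos_pos[OF Y0 W0] by (blast intro: mult_pos_cancel)+
  have "- 2 * X\<^sup>2 * Y\<^sup>2 * W * (u$1 - t$1 * u$2) * W = c$4 * W" "2 * X\<^sup>2 * Y\<^sup>2 * W * (u$2 + t$1 * u$1) * W = c$5 * W"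
    using u XE by algebra+
  then have 45: "- 2 * X\<^sup>2 * Y\<^sup>2 * W * (u$1 - t$1 * u$2) = c$4" "2 * X\<^sup>2 * Y\<^sup>2 * W * (u$2 + t$1 * u$1) = c$5"
    using W0 by (blast intro: mult_pos_cancel)+
  have "- 2 * X\<^sup>2 * Y\<^sup>2 * W\<^sup>2 * (v$2 + t$1 * v$1) = c$3" unfolding v(2)[symmetric] XE[symmetric] by algebra
  then have "c = orbit7 t u v"
    unfolding vec8_eq_iff orbit7_def X_def[symmetric] Y_def[symmetric] W_def[symmetric] Let_def vec8_nth 67 45 XE t v
    using c E_def by simp
  then show ?thesis by (rule that)
qed

lemma orbit6_surj:
  assumes c: "c \<bullet> c = 1" "c$0 = 0" "c \<noteq> axis 1 1"
  obtains t u s where "c = orbit6 t u s"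
proof -
  define E where "E = 1 - c$1"
  have E: "E > 0" using unit_coordinate_less[of c 1] c by (simp add: E_def)
  define s where "s = (vector [c$3 / E] :: real^1)"
  have s: "E * s$1 = c$3" using E by (simp add: s_def)
  define Z where "Z = chart_scale s"
  have Z0: "Z > 0" by (simp add: Z_def chart_scale_pos)
  note Z = chart_scale_relation(1)[of s, folded Z_def]
  \<comment> \<open>Coordinates 5 and 7 both involve \<open>u\<close> and t2. The combination s c5 +
    c7 eliminates t2, and c5 - s c7 eliminates \<open>u\<close>; both leave a factor 1 + s^2, the
    inverse of Z^2.\<close>
  obtain u :: "real^2" where u: "E * (u$1 - (c$2 * Z / E) * u$2) = - (Z\<^sup>2 * (s$1 * c$5 + c$7))"
      "- E * (u$2 + (c$2 * Z / E) * u$1) = Z * c$4"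
    using linear_system_solve[OF E] by blast
  define Y where "Y = chart_scale u"
  have Y0: "Y > 0" by (simp add: Y_def chart_scale_pos)
  note Y = chart_scale_relation(2)[of u, folded Y_def]
  define t where "t = (vector [c$2 * Z / E, - (Y * Z\<^sup>2 * (c$5 - s$1 * c$7)) / E, - (c$6 * Y * Z) / E] :: real^3)"
  have t1: "c$2 * Z / E = t$1" by (simp add: t_def vector_3)
  have t: "E * t$1 = c$2 * Z" "E * t$2 = - (Y * Z\<^sup>2 * (c$5 - s$1 * c$7))" "E * t$3 = - (c$6 * Y * Z)"
    using E by (simp_all add: t_def vector_3)
  note u = u[unfolded t1]
  define X where "X = chart_scale t"
  note X = chart_scale_relation(3)[of t, folded X_def]
  have n: "c$1 * c$1 + c$2 * c$2 + c$3 * c$3 + c$4 * c$4 + c$5 * c$5 + c$6 * c$6 + c$7 * c$7 = 1"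
    using c by (simp add: inner_8)
  have 0: "E * E * (1 + (t$1)\<^sup>2) = Z\<^sup>2 * (E * E + c$2 * c$2 + c$3 * c$3)"
  proof -
    have "E * E * (1 + (t$1)\<^sup>2) = E * E * (Z\<^sup>2 * (1 + (s$1)\<^sup>2)) + (E * t$1)\<^sup>2" unfolding Z by algebra
    then show ?thesis unfolding t s[symmetric] by algebra
  qed
  have 01: "E * E * (1 + (t$1)\<^sup>2) = Y\<^sup>2 * (E * E * (1 + (t$1)\<^sup>2) + (- (Z\<^sup>2 * (s$1 * c$5 + c$7)))\<^sup>2 + (Z * c$4)\<^sup>2)"
    unfolding u[symmetric] using Y by algebra
  have r: "Z\<^sup>2 * ((s$1 * c$5 + c$7)\<^sup>2 + (c$5 - s$1 * c$7)\<^sup>2) = c$5 * c$5 + c$7 * c$7"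
    using Z by algebra
  have "E * E * ((t$2)\<^sup>2 + (t$3)\<^sup>2) = (E * t$2)\<^sup>2 + (E * t$3)\<^sup>2" by algebra
  then have 2: "E * E * ((t$2)\<^sup>2 + (t$3)\<^sup>2) = Y\<^sup>2 * (Z\<^sup>2 * (Z\<^sup>2 * (c$5 - s$1 * c$7)\<^sup>2 + c$6 * c$6))"
    unfolding t by (simp add: power2_eq_square algebra_simps)
  have 3: "E * E + c$2 * c$2 + c$3 * c$3 + c$4 * c$4 + c$5 * c$5 + c$6 * c$6 + c$7 * c$7 = 2 * E"
    using n E_def by algebra
  have "E * (E * (1 + (t$1)\<^sup>2 + (t$2)\<^sup>2 + (t$3)\<^sup>2)) = E * E * (1 + (t$1)\<^sup>2) + E * E * ((t$2)\<^sup>2 + (t$3)\<^sup>2)"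
    by algebra
  also have "\<dots> = Y\<^sup>2 * Z\<^sup>2 * (E * E + c$2 * c$2 + c$3 * c$3
      + Z\<^sup>2 * ((s$1 * c$5 + c$7)\<^sup>2 + (c$5 - s$1 * c$7)\<^sup>2) + c$4 * c$4 + c$6 * c$6)"
    by (subst 01, unfold 0 2) algebra
  also have "\<dots> = E * (2 * Y\<^sup>2 * Z\<^sup>2)"
    unfolding r using 3 by algebra
  finally have "E * (1 + (t$1)\<^sup>2 + (t$2)\<^sup>2 + (t$3)\<^sup>2) = 2 * Y\<^sup>2 * Z\<^sup>2" using E by simp
  with X have XE: "2 * X\<^sup>2 * Y\<^sup>2 * Z\<^sup>2 = E" by algebra
  have "2 * X\<^sup>2 * Y\<^sup>2 * Z * t$1 * Z = E * t$1" "- 2 * X\<^sup>2 * Y * Z * t$3 * (Y * Z) = - (E * t$3)"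
    unfolding XE[symmetric] by algebra+
  then have "2 * X\<^sup>2 * Y\<^sup>2 * Z * t$1 * Z = c$2 * Z" "- 2 * X\<^sup>2 * Y * Z * t$3 * (Y * Z) = c$6 * (Y * Z)"
    unfolding t by simp_all
  then have 26: "2 * X\<^sup>2 * Y\<^sup>2 * Z * t$1 = c$2" "- 2 * X\<^sup>2 * Y * Z * t$3 = c$6"
    using Z0 mult_pos_pos[OF Y0 Z0] by (blast intro: mult_pos_cancel)+
  have "- 2 * X\<^sup>2 * Y\<^sup>2 * Z * (u$2 + t$1 * u$1) * Z = c$4 * Z"
    using u XE by algebra
  then have 4: "- 2 * X\<^sup>2 * Y\<^sup>2 * Z * (u$2 + t$1 * u$1) = c$4" using Z0 by (blast intro: mult_pos_cancel)
  have "- 2 * X\<^sup>2 * Y * Z\<^sup>2 * (s$1 * Y * (u$1 - t$1 * u$2) + t$2) * Y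
      = - (s$1 * (E * (u$1 - t$1 * u$2)) * Y + E * t$2)"
    "- 2 * X\<^sup>2 * Y * Z\<^sup>2 * (Y * (u$1 - t$1 * u$2) - s$1 * t$2) * Y
      = - (E * (u$1 - t$1 * u$2) * Y - s$1 * (E * t$2))"
    unfolding XE[symmetric] by algebra+
  then have "- 2 * X\<^sup>2 * Y * Z\<^sup>2 * (s$1 * Y * (u$1 - t$1 * u$2) + t$2) * Y = c$5 * Y"
    "- 2 * X\<^sup>2 * Y * Z\<^sup>2 * (Y * (u$1 - t$1 * u$2) - s$1 * t$2) * Y = c$7 * Y"
    unfolding t u using Z by algebra+
  then have 57: "- 2 * X\<^sup>2 * Y * Z\<^sup>2 * (s$1 * Y * (u$1 - t$1 * u$2) + t$2) = c$5"
    "- 2 * X\<^sup>2 * Y * Z\<^sup>2 * (Y * (u$1 - t$1 * u$2) - s$1 * t$2) = c$7"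
    using Y0 by (blast intro: mult_pos_cancel)+
  have "c = orbit6 t u s"
    unfolding vec8_eq_iff orbit6_def X_def[symmetric] Y_def[symmetric] Z_def[symmetric] Let_def vec8_nth 26 4 57 XE s
    using c E_def by simp
  then show ?thesis by (rule that)
qed

section \<open>Factorization along the chain\<close>

text \<open>One flag for each of the four possible factors replaces the list of sixteen cells. With
  \<open>slot\<close>, an absent factor contributes the identity and has the single parameter
  0.\<close>

definition factor :: "bool \<Rightarrow> ('a \<Rightarrow> real^8^8) \<Rightarrow> 'a \<Rightarrow> real^8^8" where
  "factor b \<phi> v = (if b then \<phi> v else mat 1)"

definition slot :: "bool \<Rightarrow> 'a::zero set \<Rightarrow> 'a set" where
  "slot b K = (if b then K else {0})"

text \<open>
  One step of a chain of stabilizers: \<open>H'\<close> is the stabilizer in \<open>H\<close> of the base point of an orbit,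
  \<open>f\<close> is the orbit map, and \<open>\<phi>\<close> lifts a parametrization of the orbit without its base point.
\<close>

locale orbit_cell =
  fixes H H' :: "(real^8^8) set" and f :: "real^8^8 \<Rightarrow> real^8"
    and \<phi> :: "'a::euclidean_space \<Rightarrow> real^8^8" and U :: "'a set"
  assumes one: "mat 1 \<in> H'" and sub: "H' \<subseteq> H"
    and mult: "G1 \<in> H \<Longrightarrow> G2 \<in> H \<Longrightarrow> G1 ** G2 \<in> H"
    and orth: "G \<in> H \<Longrightarrow> orthogonal_matrix G"
    and phi: "v \<in> U \<Longrightarrow> \<phi> v \<in> H"
    and fiber: "G1 \<in> H \<Longrightarrow> G2 \<in> H \<Longrightarrow> f G1 = f G2 \<longleftrightarrow> transpose G1 ** G2 \<in> H'"
    and param: "bij_betw (\<lambda>v. f (\<phi> v)) U (f ` H - {f (mat 1)})"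
begin

lemma factor_mem: "v \<in> slot b U \<Longrightarrow> factor b \<phi> v \<in> H"
  using phi one sub by (auto simp: factor_def slot_def split: if_splits)

lemma f_mult:
  assumes "G \<in> H" "h \<in> H'" shows "f (G ** h) = f G"
proof -
  have "transpose G ** (G ** h) = h"
    using orthogonal_matrix_inverse(1)[OF orth[OF assms(1)]] by (simp add: matrix_mul_assoc)
  then show ?thesis using fiber[of G "G ** h"] mult assms sub by auto
qed

text \<open>Applying \<open>f\<close> removes \<open>h\<close> and \<open>h'\<close>. The flag is
  then determined because the parametrization misses the base point, and the parameter because it is
  injective.\<close>

lemma factor_unique:
  assumes "v \<in> slot b U" "v' \<in> slot b' U" "h \<in> H'" "h' \<in> H'"
    and eq: "factor b \<phi> v ** h = factor b' \<phi> v' ** h'"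
  shows "b = b' \<and> v = v' \<and> h = h'"
proof -
  have f: "f (factor b \<phi> v) = f (factor b' \<phi> v')"
    using f_mult[OF factor_mem] assms by metis
  have ne: "f (\<phi> u) \<noteq> f (mat 1)" if "u \<in> U" for u
    using that param by (auto simp: bij_betw_def)
  have inj: "u = u'" if "u \<in> U" "u' \<in> U" "f (\<phi> u) = f (\<phi> u')" for u u'
    using that param by (auto simp: bij_betw_def inj_on_def)
  have bv: "b = b' \<and> v = v'"
    using f assms(1,2) ne inj by (cases b; cases b') (force simp: factor_def slot_def)+
  then have "transpose (factor b \<phi> v) ** (factor b \<phi> v ** h) = transpose (factor b \<phi> v) ** (factor b \<phi> v ** h')"
    using eq by simp
  then have "h = h'"
    using orthogonal_matrix_inverse(1)[OF orth[OF factor_mem[OF assms(1)]]] by (simp add: matrix_mul_assoc)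
  with bv show ?thesis by simp
qed

text \<open>The flag records whether \<open>G\<close> moves the base point. Once a factor moves it
  to the same point, the remainder lies in the stabilizer.\<close>

lemma factor_exists:
  assumes "G \<in> H"
  obtains b v h where "v \<in> slot b U" "h \<in> H'" "G = factor b \<phi> v ** h"
proof -
  have "\<exists>b. \<exists>v\<in>slot b U. f (factor b \<phi> v) = f G"
  proof (cases "f G = f (mat 1)")
    case True
    then show ?thesis by (intro exI[of _ False]) (simp add: factor_def slot_def)
  next
    case False
    then obtain v where "v \<in> U" "f (\<phi> v) = f G"
      using param assms by (metis (no_types, lifting) Diff_iff bij_betw_imp_surj_on imageE image_eqI singletonD)
    then show ?thesis by (intro exI[of _ True]) (auto simp: factor_def slot_def)
  qed
  then obtain b v where bv: "v \<in> slot b U" "f (factor b \<phi> v) = f G" by blast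
  then have "transpose (factor b \<phi> v) ** G \<in> H'"
    using fiber[OF factor_mem[OF bv(1)] assms] by simp
  moreover have "G = factor b \<phi> v ** (transpose (factor b \<phi> v) ** G)"
    using orthogonal_matrix_inverse(2)[OF orth[OF factor_mem[OF bv(1)]]] by (simp add: matrix_mul_assoc)
  ultimately show ?thesis using bv(1) that by blast
qed

end

section \<open>The four links of the chain\<close>

abbreviation B1 :: "(real^1) set" where "B1 \<equiv> ball 0 1"
abbreviation B2 :: "(real^2) set" where "B2 \<equiv> ball 0 1"
abbreviation B3 :: "(real^3) set" where "B3 \<equiv> ball 0 1"

lemma ball_mem_cball [simp]: "x \<in> ball 0 1 \<Longrightarrow> x \<in> cball 0 1"
  using ball_subset_cball by blast

lemma orthogonal_fix_iff:
  assumes "orthogonal_matrix (G1::real^'n^'n)"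
  shows "G1 *v x = G2 *v x \<longleftrightarrow> (transpose G1 ** G2) *v x = x"
  using orthogonal_matrix_inverse(3,4)[OF assms] by (metis matrix_vector_mul_assoc)

lemma orthogonal_unit:
  assumes "orthogonal_matrix (G::real^'n^'n)"
  shows "(G *v axis i 1) \<bullet> (G *v axis i 1) = 1"
  by (simp add: orthogonal_matrix_inner[OF assms] inner_axis_axis)

lemma orthogonal_fix_coordinate:
  assumes "orthogonal_matrix (G::real^'n^'n)" "G *v axis j 1 = axis j 1" "i \<noteq> j"
  shows "(G *v axis i 1) $ j = 0"
  using orthogonal_matrix_inner[OF assms(1), of "axis i 1" "axis j 1"] assms(2,3)
  by (simp add: inner_axis) (simp add: axis_def)

text \<open>Transitivity on the 3-sphere comes out of the parametrization: \<open>SU2\<close> fixes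
  e_0, ..., e_3, so the orbit stays in the unit sphere of the orthogonal complement, while
  \<open>orbit3\<close> already reaches every point of that sphere except e_4.\<close>

lemma orbit_cell_3: "orbit_cell SU2 {mat 1} (\<lambda>G. G *v axis 4 1) phi3 B3"
proof
  show "mat 1 \<in> {mat 1::real^8^8}" "{mat 1} \<subseteq> SU2" using SU2_group by auto
  show orth: "orthogonal_matrix G" if "G \<in> SU2" for G
    using that subgroup_chain SU3_orthogonal by blast
  show "G1 ** G2 \<in> SU2" if "G1 \<in> SU2" "G2 \<in> SU2" for G1 G2
    using that SU2_group by blast
  show "phi3 v \<in> SU2" if "v \<in> B3" for v
    using that phi3_SU2 by simp
  show "G1 *v axis 4 1 = G2 *v axis 4 1 \<longleftrightarrow> transpose G1 ** G2 \<in> {mat 1}"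
    if "G1 \<in> SU2" "G2 \<in> SU2" for G1 G2
    using orthogonal_fix_iff[OF orth[OF that(1)], of "axis 4 1" G2]
      SU2_trivial[OF SU2_group(2)[OF SU2_group(3)[OF that(1)] that(2)]] by auto
  show "bij_betw (\<lambda>v. phi3 v *v axis 4 1) B3 ((\<lambda>G. G *v axis 4 1) ` SU2 - {mat 1 *v axis 4 1})"
    (is "bij_betw ?g _ ?R")
  proof (rule bij_betw_imageI)
    show "inj_on ?g B3"
      by (rule inj_onI) (metis chart_surj phi_orbit(1) orbit3_inj)
    have ne: "orbit3 t \<noteq> axis 4 1" for t
      using chart_scale_pos[of t] by (auto simp: orbit3_def axis_vec8 Let_def)
    show "?g ` B3 = ?R"
    proof (intro equalityI subsetI)
      fix c assume "c \<in> ?R"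
      then obtain G where G: "G \<in> SU2" "c = G *v axis 4 1" "c \<noteq> axis 4 1" by auto
      have "c \<bullet> c = 1" "c$0 = 0" "c$1 = 0" "c$2 = 0" "c$3 = 0"
        unfolding G(2) by (intro orthogonal_unit orthogonal_fix_coordinate orth[OF G(1)] SU2D[OF G(1)]; simp)+
      then obtain t where "c = orbit3 t" using orbit3_surj G(3) by blast
      then show "c \<in> ?g ` B3"
        by (intro image_eqI[of _ _ "chart t"]) (simp_all add: phi_orbit chart_in_ball)
    next
      fix c assume "c \<in> ?g ` B3"
      then obtain x where x: "c = phi3 x *v axis 4 1" "x \<in> B3" by blast
      moreover obtain t where "x = chart t" using x(2) chart_surj by blast
      ultimately show "c \<in> ?R" using imageI[OF phi3_SU2, of x "\<lambda>G. G *v axis 4 1"] ne[of t] by (simp add: phi_orbit)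
    qed
  qed
qed

lemma orbit_cell_5: "orbit_cell SU3 SU2 (\<lambda>G. G *v axis 2 1) phi5 (B3 \<times> B2)"
proof
  show "mat 1 \<in> SU2" "SU2 \<subseteq> SU3" using SU2_group subgroup_chain by auto
  show orth: "orthogonal_matrix G" if "G \<in> SU3" for G
    using that SU3_orthogonal by blast
  show "G1 ** G2 \<in> SU3" if "G1 \<in> SU3" "G2 \<in> SU3" for G1 G2
    using that SU3_group by blast
  show "phi5 v \<in> SU3" if "v \<in> B3 \<times> B2" for v
    using that phi5_SU3 by auto
  show "G1 *v axis 2 1 = G2 *v axis 2 1 \<longleftrightarrow> transpose G1 ** G2 \<in> SU2"
    if "G1 \<in> SU3" "G2 \<in> SU3" for G1 G2
    using orthogonal_fix_iff[OF orth[OF that(1)], of "axis 2 1" G2] SU3_group that by (auto simp: SU2_def)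
  show "bij_betw (\<lambda>v. phi5 v *v axis 2 1) (B3 \<times> B2) ((\<lambda>G. G *v axis 2 1) ` SU3 - {mat 1 *v axis 2 1})"
    (is "bij_betw ?g _ ?R")
  proof (rule bij_betw_imageI)
    show "inj_on ?g (B3 \<times> B2)"
    proof (rule inj_onI, clarify)
      fix x y x' y' assume "x \<in> B3" "y \<in> B2" "x' \<in> B3" "y' \<in> B2"
        and eq: "phi5 (x, y) *v axis 2 1 = phi5 (x', y') *v axis 2 1"
      then obtain t u t' u' where "x = chart t" "y = chart u" "x' = chart t'" "y' = chart u'"
        using chart_surj by metis
      with eq show "x = x' \<and> y = y'" by (auto simp: phi_orbit dest: orbit5_inj)
    qed
    have ne: "orbit5 t u \<noteq> axis 2 1" for t u
      using chart_scale_pos[of t] chart_scale_pos[of u] by (auto simp: orbit5_def axis_vec8 Let_def)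
    show "?g ` (B3 \<times> B2) = ?R"
    proof (intro equalityI subsetI)
      fix c assume "c \<in> ?R"
      then obtain G where G: "G \<in> SU3" "c = G *v axis 2 1" "c \<noteq> axis 2 1" by auto
      have "c \<bullet> c = 1" "c$0 = 0" "c$1 = 0"
        unfolding G(2) by (intro orthogonal_unit orthogonal_fix_coordinate orth[OF G(1)] SU3D[OF G(1)]; simp)+
      then obtain t u where "c = orbit5 t u" using orbit5_surj G(3) by blast
      then show "c \<in> ?g ` (B3 \<times> B2)"
        by (intro image_eqI[of _ _ "(chart t, chart u)"]) (simp_all add: phi_orbit chart_in_ball)
    next
      fix c assume "c \<in> ?g ` (B3 \<times> B2)"
      then obtain x y where x: "c = phi5 (x, y) *v axis 2 1" "x \<in> B3" "y \<in> B2" by blast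
      moreover obtain t u where "x = chart t" "y = chart u" using x(2,3) chart_surj by metis
      ultimately show "c \<in> ?R" using imageI[OF phi5_SU3, of "(x, y)" "\<lambda>G. G *v axis 2 1"] ne[of t u] by (simp add: phi_orbit)
    qed
  qed
qed

lemma orbit_cell_7: "orbit_cell SU4 SU3 (\<lambda>G. G *v axis 0 1) phi7 (B3 \<times> B2 \<times> B2)"
proof
  show "mat 1 \<in> SU3" "SU3 \<subseteq> SU4" using SU3_group subgroup_chain by auto
  show orth: "orthogonal_matrix G" if "G \<in> SU4" for G
    using that SU4_orthogonal by blast
  show "G1 ** G2 \<in> SU4" if "G1 \<in> SU4" "G2 \<in> SU4" for G1 G2
    using that SU4_group by blast
  show "phi7 v \<in> SU4" if "v \<in> B3 \<times> B2 \<times> B2" for v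
    using that phi7_SU4 by auto
  show "G1 *v axis 0 1 = G2 *v axis 0 1 \<longleftrightarrow> transpose G1 ** G2 \<in> SU3"
    if "G1 \<in> SU4" "G2 \<in> SU4" for G1 G2
    using orthogonal_fix_iff[OF orth[OF that(1)], of "axis 0 1" G2] SU4_group that by (auto simp: SU3_def)
  show "bij_betw (\<lambda>v. phi7 v *v axis 0 1) (B3 \<times> B2 \<times> B2) ((\<lambda>G. G *v axis 0 1) ` SU4 - {mat 1 *v axis 0 1})"
    (is "bij_betw ?g _ ?R")
  proof (rule bij_betw_imageI)
    show "inj_on ?g (B3 \<times> B2 \<times> B2)"
    proof (rule inj_onI)
      fix p q assume "p \<in> B3 \<times> B2 \<times> B2" "q \<in> B3 \<times> B2 \<times> B2" and eq: "?g p = ?g q"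
      then obtain x y w x' y' w' where p: "p = (x, y, w)" "q = (x', y', w')"
        and "x \<in> B3" "y \<in> B2" "w \<in> B2" "x' \<in> B3" "y' \<in> B2" "w' \<in> B2" by blast
      then obtain t u v t' u' v' where "x = chart t" "y = chart u" "w = chart v"
        "x' = chart t'" "y' = chart u'" "w' = chart v'"
        using chart_surj by metis
      with eq p show "p = q" by (auto simp: phi_orbit dest: orbit7_inj)
    qed
    have ne: "orbit7 t u v \<noteq> axis 0 1" for t u v
      using chart_scale_pos[of t] chart_scale_pos[of u] chart_scale_pos[of v]
      by (auto simp: orbit7_def axis_vec8 Let_def)
    show "?g ` (B3 \<times> B2 \<times> B2) = ?R"
    proof (intro equalityI subsetI)
      fix c assume "c \<in> ?R"
      then obtain G where G: "G \<in> SU4" "c = G *v axis 0 1" "c \<noteq> axis 0 1" by auto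
      have "c \<bullet> c = 1" unfolding G(2) by (intro orthogonal_unit orth[OF G(1)])
      then obtain t u v where "c = orbit7 t u v" using orbit7_surj G(3) by blast
      then show "c \<in> ?g ` (B3 \<times> B2 \<times> B2)"
        by (intro image_eqI[of _ _ "(chart t, chart u, chart v)"]) (simp_all add: phi_orbit chart_in_ball)
    next
      fix c assume "c \<in> ?g ` (B3 \<times> B2 \<times> B2)"
      then obtain x y w where x: "c = phi7 (x, y, w) *v axis 0 1" "x \<in> B3" "y \<in> B2" "w \<in> B2" by blast
      moreover obtain t u v where "x = chart t" "y = chart u" "w = chart v" using x(2-4) chart_surj by metis
      ultimately show "c \<in> ?R" using imageI[OF phi7_SU4, of "(x, y, w)" "\<lambda>G. G *v axis 0 1"] ne[of t u v] by (simp add: phi_orbit)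
    qed
  qed
qed

lemma spin_image_fiber:
  assumes "G1 \<in> Spin7" "G2 \<in> Spin7"
  shows "spin_image G1 = spin_image G2 \<longleftrightarrow> transpose G1 ** G2 \<in> SU4"
proof -
  obtain g1 g2 where g: "spin_pair g1 G1" "spin_pair g2 G2" using assms by (auto simp: Spin7_iff)
  have "spin_image G1 = spin_image G2 \<longleftrightarrow> (transpose g1 ** g2) *v axis 1 1 = axis 1 1"
    unfolding spin_image_eq[OF g(1)] spin_image_eq[OF g(2)]
    by (rule orthogonal_fix_iff) (rule spin_pair_orthogonal(1)[OF g(1)])
  also have "\<dots> \<longleftrightarrow> transpose G1 ** G2 \<in> SU4"
    using spin_pair_mult[OF spin_pair_transpose[OF g(1)] g(2)] spin_pair_unique unfolding SU4_def by blast
  finally show ?thesis .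
qed

lemma orbit_cell_6: "orbit_cell Spin7 SU4 spin_image phi6 (B3 \<times> B2 \<times> B1)"
proof
  show "mat 1 \<in> SU4" "SU4 \<subseteq> Spin7" using SU4_group subgroup_chain by auto
  show orth: "orthogonal_matrix G" if "G \<in> Spin7" for G
    using that Spin7_orthogonal by blast
  show "G1 ** G2 \<in> Spin7" if "G1 \<in> Spin7" "G2 \<in> Spin7" for G1 G2
    using that Spin7_group by blast
  show "phi6 v \<in> Spin7" if "v \<in> B3 \<times> B2 \<times> B1" for v
    using that phi6_Spin7 by auto
  show "spin_image G1 = spin_image G2 \<longleftrightarrow> transpose G1 ** G2 \<in> SU4"
    if "G1 \<in> Spin7" "G2 \<in> Spin7" for G1 G2
    using that by (rule spin_image_fiber)
  have im: "spin_image (phi6 (chart t, chart u, chart s)) = orbit6 t u s" for t u s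
    using spin_image_eq[OF phi6_spin_pair] by (simp add: chart_in_cball phi_orbit)
  have one: "spin_image (mat 1) = axis 1 1" using spin_image_eq[OF spin_pair_id] by simp
  show "bij_betw (\<lambda>v. spin_image (phi6 v)) (B3 \<times> B2 \<times> B1) (spin_image ` Spin7 - {spin_image (mat 1)})"
    (is "bij_betw ?g _ ?R")
  proof (rule bij_betw_imageI)
    show "inj_on ?g (B3 \<times> B2 \<times> B1)"
    proof (rule inj_onI)
      fix p q assume "p \<in> B3 \<times> B2 \<times> B1" "q \<in> B3 \<times> B2 \<times> B1" and eq: "?g p = ?g q"
      then obtain x y z x' y' z' where p: "p = (x, y, z)" "q = (x', y', z')"
        and "x \<in> B3" "y \<in> B2" "z \<in> B1" "x' \<in> B3" "y' \<in> B2" "z' \<in> B1" by blast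
      then obtain t u s t' u' s' where "x = chart t" "y = chart u" "z = chart s"
        "x' = chart t'" "y' = chart u'" "z' = chart s'"
        using chart_surj by metis
      with eq p show "p = q" by (auto simp: im dest: orbit6_inj)
    qed
    have ne: "orbit6 t u s \<noteq> axis 1 1" for t u s
      using chart_scale_pos[of t] chart_scale_pos[of u] chart_scale_pos[of s]
      by (auto simp: orbit6_def axis_vec8 Let_def)
    show "?g ` (B3 \<times> B2 \<times> B1) = ?R"
    proof (intro equalityI subsetI)
      fix c assume "c \<in> ?R"
      then obtain G g where g: "spin_pair g G" "c = g *v axis 1 1" "c \<noteq> axis 1 1"
        using spin_image_eq one by (auto simp: Spin7_iff)
      \<comment> \<open>A partner in SO(7) fixes e_0, so the orbit lies in the 6-sphere of imaginary
        units.\<close>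
      have o: "orthogonal_matrix g" "g *v axis 0 1 = axis 0 1"
        using g(1) spin_pair_orthogonal by (auto simp: spin_pair_def SO7_def)
      have "c \<bullet> c = 1" "c$0 = 0"
        unfolding g(2) by (intro orthogonal_unit orthogonal_fix_coordinate o; simp)+
      then obtain t u s where "c = orbit6 t u s" using orbit6_surj g(3) by blast
      then show "c \<in> ?g ` (B3 \<times> B2 \<times> B1)"
        by (intro image_eqI[of _ _ "(chart t, chart u, chart s)"]) (simp_all add: im chart_in_ball)
    next
      fix c assume "c \<in> ?g ` (B3 \<times> B2 \<times> B1)"
      then obtain x y z where x: "c = spin_image (phi6 (x, y, z))" "x \<in> B3" "y \<in> B2" "z \<in> B1" by blast
      moreover obtain t u s where "x = chart t" "y = chart u" "z = chart s" using x(2-4) chart_surj by metis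
      ultimately show "c \<in> ?R" using imageI[OF phi6_Spin7, of "(x, y, z)" spin_image] ne[of t u s] by (simp add: im one)
    qed
  qed
qed

section \<open>Boundaries of the cells\<close>

lemma set_mult_mem: "p \<in> P \<Longrightarrow> q \<in> Q \<Longrightarrow> p ** q \<in> P \<odot> Q"
  by (auto simp: set_mult_def)

lemma axis_nth_8: "axis i (1::real) $ (j::8) = (if i = j then 1 else 0)"
  by (auto simp: axis_def)

lemma transpose_apply_nth: "(transpose M *v n) $ j = (M *v axis j 1) \<bullet> (n::real^'n)"
  unfolding matrix_vector_mult_basis
  by (simp add: matrix_vector_mult_def transpose_def column_def inner_vec_def)

lemma matA_fix:
  assumes "cofactor x = 0 \<or> n$4 = 0 \<and> n$5 = 0 \<and> n$6 = 0 \<and> n$7 = 0"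
  shows "matA x *v n = n"
  using assms by (cases rule: vec8_cases[of n]) (auto simp: mat_rot rot_apply)

lemma cofactor_boundary: "x \<in> cball 0 1 \<Longrightarrow> x \<notin> ball 0 1 \<Longrightarrow> cofactor x = 0"
  by (simp add: cofactor_def mem_cball_iff_inner mem_ball_iff_inner)

lemma matA_boundary: "cofactor x = 0 \<Longrightarrow> matA x = mat 1"
  by (simp add: matrix_eq matA_fix)

text \<open>The conjugate moves only the span of the images of e_4, ..., e_7 under \<open>M\<close>.
  Questions about fixed vectors of the characteristic maps thereby become four inner
  products.\<close>

lemma conj_matA_fix:
  assumes "orthogonal_matrix M"
    and "cofactor x = 0 \<or> (\<forall>j\<in>{4,5,6,7}. (M *v axis j 1) \<bullet> n = 0)"
  shows "(M ** matA x ** transpose M) *v n = n"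
proof -
  have "matA x *v (transpose M *v n) = transpose M *v n"
    using assms(2) by (intro matA_fix) (auto simp: transpose_apply_nth)
  then show ?thesis
    by (simp add: orthogonal_matrix_inverse(4)[OF assms(1)] flip: matrix_vector_mul_assoc)
qed

lemma phi_conj:
  "y \<in> D2 \<Longrightarrow> z \<in> D1 \<Longrightarrow> phi6 (x, y, z) = (matC z ** matB y) ** matA x ** transpose (matC z ** matB y)"
  "y \<in> D2 \<Longrightarrow> w \<in> D2 \<Longrightarrow> phi7 (x, y, w) = (matD w ** matB y) ** matA x ** transpose (matD w ** matB y)"
  by (simp_all add: phi_transpose matrix_transpose_mul matrix_mul_assoc)

lemma phi_boundary_trivial:
  "cofactor x = 0 \<Longrightarrow> phi3 x = mat 1"
  "cofactor x = 0 \<Longrightarrow> y \<in> D2 \<Longrightarrow> phi5 (x, y) = mat 1"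
  "cofactor x = 0 \<Longrightarrow> y \<in> D2 \<Longrightarrow> z \<in> D1 \<Longrightarrow> phi6 (x, y, z) = mat 1"
  "cofactor x = 0 \<Longrightarrow> y \<in> D2 \<Longrightarrow> w \<in> D2 \<Longrightarrow> phi7 (x, y, w) = mat 1"
proof -
  assume x: "cofactor x = 0"
  show "phi3 x = mat 1" by (simp add: phi3_def matA_boundary x)
  show "phi5 (x, y) = mat 1" if "y \<in> D2"
    using that by (simp add: phi_transpose matA_boundary x orthogonal_matrix_inverse mat_orthogonal)
  show "phi6 (x, y, z) = mat 1" if "y \<in> D2" "z \<in> D1"
    using that by (simp add: phi_conj matA_boundary x orthogonal_matrix_inverse mat_orthogonal orthogonal_matrix_mul)
  show "phi7 (x, y, w) = mat 1" if "y \<in> D2" "w \<in> D2"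
    using that by (simp add: phi_conj matA_boundary x orthogonal_matrix_inverse mat_orthogonal orthogonal_matrix_mul)
qed

text \<open>These vectors span everything that \<open>phi5 (x, y)\<close> can move. As e_6 and e_7
  stay in place, two inner products suffice for a vector without components 6 and 7.\<close>

lemma frame_5:
  "matB y *v axis 4 1 = vec8 0 0 (- cofactor y) 0 (y$1) (- y$2) 0 0"
  "matB y *v axis 5 1 = vec8 0 0 0 (- cofactor y) (y$2) (y$1) 0 0"
  "matB y *v axis 6 1 = axis 6 1" "matB y *v axis 7 1 = axis 7 1"
  by (simp_all add: mat_rot axis_vec8 rot_apply)

lemma frame_6:
  "(matC z ** matB y) *v axis 4 1 = vec8 0 0 (- cofactor y) 0 (y$1) (- z$1 * y$2) 0 (- cofactor z * y$2)"
  "(matC z ** matB y) *v axis 5 1 = vec8 0 (cofactor z * cofactor y) 0 (- z$1 * cofactor y) (y$2) (z$1 * y$1) 0 (cofactor z * y$1)"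
  "(matC z ** matB y) *v axis 6 1 = axis 6 1"
  "(matC z ** matB y) *v axis 7 1 = vec8 0 0 0 0 0 (- cofactor z) 0 (z$1)"
  by (simp_all add: frame_5 flip: matrix_vector_mul_assoc) (simp_all add: mat_rot axis_vec8 rot_apply)

lemma frame_7:
  "(matD w ** matB y) *v axis 4 1 =
     vec8 (cofactor w * cofactor y) 0 (- w$1 * cofactor y) (w$2 * cofactor y) (y$1) (- y$2) 0 0"
  "(matD w ** matB y) *v axis 5 1 =
     vec8 0 (cofactor w * cofactor y) (- w$2 * cofactor y) (- w$1 * cofactor y) (y$2) (y$1) 0 0"
  "(matD w ** matB y) *v axis 6 1 = axis 6 1" "(matD w ** matB y) *v axis 7 1 = axis 7 1"
  by (simp_all add: frame_5 flip: matrix_vector_mul_assoc) (simp_all add: mat_rot axis_vec8 rot_apply)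

lemma phi5_fix:
  assumes "y \<in> D2" "n$6 = 0" "n$7 = 0"
    and "cofactor x = 0 \<or> (matB y *v axis 4 1) \<bullet> n = 0 \<and> (matB y *v axis 5 1) \<bullet> n = 0"
  shows "phi5 (x, y) *v n = n"
  using assms(2-) unfolding phi_transpose(1)[OF assms(1)]
  by (intro conj_matA_fix mat_orthogonal assms(1)) (auto simp: frame_5 inner_axis')

lemma phi7_fix:
  assumes "y \<in> D2" "w \<in> D2" "n$6 = 0" "n$7 = 0"
    and "cofactor x = 0 \<or> ((matD w ** matB y) *v axis 4 1) \<bullet> n = 0 \<and> ((matD w ** matB y) *v axis 5 1) \<bullet> n = 0"
  shows "phi7 (x, y, w) *v n = n"
  using assms(3-) unfolding phi_conj(2)[OF assms(1,2)]
  by (intro conj_matA_fix mat_orthogonal orthogonal_matrix_mul assms(1,2)) (auto simp: frame_7 inner_axis')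

lemma phi6_fix:
  assumes "y \<in> D2" "z \<in> D1"
    and "\<forall>j\<in>{4,5,6,7}. ((matC z ** matB y) *v axis j 1) \<bullet> n = 0"
  shows "phi6 (x, y, z) *v n = n"
  using assms(3-) unfolding phi_conj(1)[OF assms(1,2)]
  by (intro conj_matA_fix mat_orthogonal orthogonal_matrix_mul assms(1,2)) auto

lemma axis_mem_cball: "axis i 1 \<in> (cball 0 1 :: (real^'n) set)"
  by (simp add: mem_cball_iff_inner inner_axis_axis)

lemma cofactor_axis [simp]: "cofactor (axis i 1 :: real^'n) = 0"
  by (simp add: cofactor_def inner_axis_axis)

lemma e3_subset_e5: "e3 \<subseteq> e5"
proof
  fix G assume "G \<in> e3"
  then obtain x where x: "x \<in> D3" "G = matA x" by (auto simp: e3_def phi3_def)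
  \<comment> \<open>The parameter y = (1, 0) lies on the boundary circle, where Y = 0.\<close>
  have "matB (axis 1 1) = mat 1"
    by (rule matrix_eq_mat1I) (simp add: forall_8 axis_vec8 mat_rot rot_apply, simp add: axis_def)
  then have "phi5 (x, axis 1 1) = G"
    by (simp add: phi_transpose axis_mem_cball x)
  then show "G \<in> e5" unfolding e5_def using x by (intro image_eqI[of _ _ "(x, axis 1 1)"]) (auto simp: axis_mem_cball)
qed

lemma one_mem: "mat 1 \<in> e3" "mat 1 \<in> e5" "mat 1 \<in> e6" "mat 1 \<in> e7"
proof -
  show 3: "mat 1 \<in> e3" unfolding e3_def
    by (intro image_eqI[of _ _ "axis 1 1"]) (auto simp: axis_mem_cball phi_boundary_trivial)
  then show "mat 1 \<in> e5" using e3_subset_e5 by blast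
  show "mat 1 \<in> e6" unfolding e6_def
    by (intro image_eqI[of _ _ "(axis 1 1, axis 1 1, axis 1 1)"]) (auto simp: axis_mem_cball phi_boundary_trivial)
  show "mat 1 \<in> e7" unfolding e7_def
    by (intro image_eqI[of _ _ "(axis 1 1, axis 1 1, axis 1 1)"]) (auto simp: axis_mem_cball phi_boundary_trivial)
qed

section \<open>The stabilizers as products of closed cells\<close>

lemma e_subset: "e3 \<subseteq> SU2" "e5 \<subseteq> SU3" "e7 \<subseteq> SU4" "e6 \<subseteq> Spin7"
  using phi3_SU2 phi5_SU3 phi7_SU4 phi6_Spin7 by (auto simp: e3_def e5_def e6_def e7_def)

lemma SU2_eq: "SU2 = e3"
proof
  show "SU2 \<subseteq> e3"
  proof
    fix G assume "G \<in> SU2"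
    then obtain b v where "v \<in> slot b B3" "G = factor b phi3 v ** mat 1"
      using orbit_cell.factor_exists[OF orbit_cell_3] by (metis singletonD)
    then show "G \<in> e3" using one_mem by (auto simp: factor_def slot_def e3_def split: if_splits)
  qed
qed (rule e_subset)

lemma SU3_eq: "SU3 = e5 \<odot> e3"
proof
  show "SU3 \<subseteq> e5 \<odot> e3"
  proof
    fix G assume "G \<in> SU3"
    then obtain b v h where v: "v \<in> slot b (B3 \<times> B2)" "h \<in> SU2" "G = factor b phi5 v ** h"
      using orbit_cell.factor_exists[OF orbit_cell_5] by metis
    then have "factor b phi5 v \<in> e5" using one_mem by (auto simp: factor_def slot_def e5_def split: if_splits)
    then show "G \<in> e5 \<odot> e3" using v by (simp add: SU2_eq set_mult_mem)
  qed
  show "e5 \<odot> e3 \<subseteq> SU3"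
    using e_subset subgroup_chain SU3_group unfolding set_mult_def by blast
qed

lemma SU4_eq: "SU4 = e7 \<odot> SU3"
proof
  show "SU4 \<subseteq> e7 \<odot> SU3"
  proof
    fix G assume "G \<in> SU4"
    then obtain b v h where v: "v \<in> slot b (B3 \<times> B2 \<times> B2)" "h \<in> SU3" "G = factor b phi7 v ** h"
      using orbit_cell.factor_exists[OF orbit_cell_7] by metis
    then have "factor b phi7 v \<in> e7" using one_mem by (auto simp: factor_def slot_def e7_def split: if_splits)
    then show "G \<in> e7 \<odot> SU3" using v by (simp add: set_mult_mem)
  qed
  show "e7 \<odot> SU3 \<subseteq> SU4"
    using e_subset subgroup_chain SU4_group unfolding set_mult_def by blast
qed

lemma Spin7_eq: "Spin7 = e6 \<odot> SU4"
proof
  show "Spin7 \<subseteq> e6 \<odot> SU4"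
  proof
    fix G assume "G \<in> Spin7"
    then obtain b v h where v: "v \<in> slot b (B3 \<times> B2 \<times> B1)" "h \<in> SU4" "G = factor b phi6 v ** h"
      using orbit_cell.factor_exists[OF orbit_cell_6] by metis
    then have "factor b phi6 v \<in> e6" using one_mem by (auto simp: factor_def slot_def e6_def split: if_splits)
    then show "G \<in> e6 \<odot> SU4" using v by (simp add: set_mult_mem)
  qed
  show "e6 \<odot> SU4 \<subseteq> Spin7"
    using e_subset subgroup_chain Spin7_group unfolding set_mult_def by blast
qed

text \<open>
  With \<open>e\<^sub>1\<close> as imaginary unit, \<open>SU3\<close> acts on the complex span of \<open>e\<^sub>2, e\<^sub>4, e\<^sub>6\<close>, and \<open>e\<^sup>5\<close> consists
  of the elements that fix a line in the span of \<open>e\<^sub>2, e\<^sub>4\<close>: \<^term>\<open>matB y\<close> moves \<open>e\<^sub>2\<close> to that line.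
\<close>

lemma e5I:
  assumes G: "G \<in> SU3" "G *v n = n" and n: "n$6 = 0" "n$7 = 0" "\<not> (n$2 = 0 \<and> n$3 = 0 \<and> n$4 = 0 \<and> n$5 = 0)"
  shows "G \<in> e5"
proof -
  define m where "m = vec8 0 0 (n$2) (n$3) (n$4) (n$5) 0 0"
  have "m = n - n$0 *\<^sub>R axis 0 1 - n$1 *\<^sub>R axis 1 1"
    using n by (simp add: vec8_eq_iff m_def axis_vec8)
  then have m: "G *v m = m"
    using SU3D(2,3)[OF G(1)] G(2) by (simp add: matrix_vector_mult_diff_distrib matrix_vector_mult_scaleR)
  define J where "J = axis 1 1 \<bullet>\<^sub>C m"
  have J: "J = vec8 0 0 (- n$3) (n$2) (- n$5) (n$4) 0 0"
    by (simp add: J_def m_def axis_vec8 cayley_mult_vec8)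
  have GJ: "G *v J = J"
    using SU3D(4)[OF G(1), of "axis 1 1" m] SU3D(3)[OF G(1)] m by (simp add: J_def)
  \<comment> \<open>The multiple (a + i b) m shall have a real, nonnegative component at e_4, as the
    image (y1, y2, Y, 0) of e_2 under \<open>matB y\<close> has. The conjugate of n4 + i n5 serves
    as multiplier or, if that vanishes, the conjugate of n2 + i n3.\<close>
  obtain a b c d :: real where ab: "a * n$2 - b * n$3 = c" "a * n$3 + b * n$2 = d"
    "a * n$5 + b * n$4 = 0" "a * n$4 - b * n$5 \<ge> 0" "c\<^sup>2 + d\<^sup>2 + (a * n$4 - b * n$5)\<^sup>2 \<noteq> 0"
  proof (cases "n$4 = 0 \<and> n$5 = 0")
    case True
    then have "n$2 * n$2 + n$3 * n$3 \<noteq> 0" using n(3) by (simp add: sum_squares_eq_zero_iff)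
    then show ?thesis using True by (intro that[of "n$2" "- n$3" "n$2 * n$2 + n$3 * n$3" 0]) auto
  next
    case False
    then have "n$4 * n$4 + n$5 * n$5 > 0" by (simp add: sum_squares_gt_zero_iff)
    then show ?thesis by (intro that[of "n$4" "- n$5" "n$4 * n$2 + n$5 * n$3" "n$4 * n$3 - n$5 * n$2"])
      (auto simp: add_nonneg_eq_0_iff)
  qed
  define e where "e = a * n$4 - b * n$5"
  define r where "r = sqrt (c\<^sup>2 + d\<^sup>2 + e\<^sup>2)"
  have r: "r > 0" "r\<^sup>2 = c\<^sup>2 + d\<^sup>2 + e\<^sup>2"
    using ab(5) by (auto simp: r_def e_def add_nonneg_nonneg order.strict_iff_order)
  define y where "y = (vector [c / r, d / r] :: real^2)"
  have y: "y$1 = c / r" "y$2 = d / r" by (simp_all add: y_def)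
  have yy: "1 - y \<bullet> y = (e / r)\<^sup>2"
  proof -
    have "1 - y \<bullet> y = (r\<^sup>2 - c\<^sup>2 - d\<^sup>2) / r\<^sup>2" using r(1)
      by (simp add: y inner_2 power2_eq_square diff_divide_distrib)
    then show ?thesis by (simp add: r(2) power_divide)
  qed
  have yD: "y \<in> D2" using zero_le_power2[of "e / r"] unfolding mem_cball_iff_inner yy[symmetric] by linarith
  have cof: "cofactor y = e / r" using yy ab(4) r(1) by (simp add: cofactor_def e_def)
  have "matB y *v axis 2 1 = vec8 0 0 (c / r) (d / r) (e / r) 0 0 0"
    by (simp add: mat_rot axis_vec8 rot_apply y cof)
  also have "\<dots> = (1 / r) *\<^sub>R (a *\<^sub>R m + b *\<^sub>R J)"
    using ab(3) r(1) unfolding ab(1,2)[symmetric] e_def m_def J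
    by (simp add: vec8_arith algebra_simps diff_divide_distrib add_divide_distrib)
  finally have Be2: "G *v (matB y *v axis 2 1) = matB y *v axis 2 1"
    by (simp add: matrix_vector_mult_scaleR matrix_vector_right_distrib m GJ)
  note oB = mat_orthogonal(2)[OF yD]
  have B: "matB y \<in> SU3" using SU_mat yD by blast
  have "transpose (matB y) ** G ** matB y \<in> SU2"
    unfolding SU2_def using SU3_group B G(1) Be2 orthogonal_matrix_inverse(3)[OF oB]
    by (simp flip: matrix_vector_mul_assoc)
  then obtain x where x: "x \<in> D3" "transpose (matB y) ** G ** matB y = matA x"
    unfolding SU2_eq e3_def phi3_def by blast
  have "phi5 (x, y) = matB y ** (transpose (matB y) ** G ** matB y) ** transpose (matB y)"
    by (simp add: phi_transpose yD x)
  also have "\<dots> = (matB y ** transpose (matB y)) ** G ** (matB y ** transpose (matB y))"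
    by (simp add: matrix_mul_assoc)
  also have "\<dots> = G" by (simp add: orthogonal_matrix_inverse[OF oB])
  finally show ?thesis unfolding e5_def using x(1) yD by (intro image_eqI[of _ _ "(x, y)"]) auto
qed

section \<open>Boundary values of the four characteristic maps\<close>

lemma phi3_boundary: "x \<in> D3 - B3 \<Longrightarrow> phi3 x = mat 1"
  using phi_boundary_trivial(1) cofactor_boundary[of x] by simp

text \<open>If Y = 0, the moved vectors have no component along e_2. So e_2 is fixed, and the
  stabilizer \<open>SU2\<close> is e^3.\<close>

lemma phi5_boundary:
  assumes "v \<in> D3 \<times> D2 - B3 \<times> B2" shows "phi5 v \<in> e3"
proof -
  obtain x y where v: "v = (x, y)" "x \<in> D3" "y \<in> D2" "x \<notin> B3 \<or> y \<notin> B2"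
    using assms by blast
  have cof: "cofactor x = 0 \<or> cofactor y = 0"
    using v cofactor_boundary[of x] cofactor_boundary[of y] by argo
  have "phi5 v *v axis 2 1 = axis 2 1"
    unfolding v(1) by (rule phi5_fix) (use v cof in \<open>auto simp: frame_5 inner_axis axis_nth_8\<close>)
  then show ?thesis using phi5_SU3[of v] v by (auto simp: SU2_eq[symmetric] SU2_def)
qed

text \<open>When X = 0 the value is the identity. Otherwise W Y = 0 makes e_0 fixed, which only
  gives \<open>SU3\<close>; the sharper membership in e^5 comes from a further fixed vector.\<close>

lemma phi7_boundary:
  assumes "v \<in> D3 \<times> D2 \<times> D2 - B3 \<times> B2 \<times> B2" shows "phi7 v \<in> e5"
proof -
  obtain x y w where v: "v = (x, y, w)" "x \<in> D3" "y \<in> D2" "w \<in> D2"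
    "x \<notin> B3 \<or> y \<notin> B2 \<or> w \<notin> B2"
    using assms by blast
  have cof0: "cofactor x = 0 \<or> cofactor y = 0 \<or> cofactor w = 0"
    using v cofactor_boundary[of x] cofactor_boundary[of y] cofactor_boundary[of w] by argo
  show ?thesis
  proof (cases "cofactor x = 0")
    case True
    then show ?thesis using phi_boundary_trivial(4) v one_mem by simp
  next
    case False
    with cof0 have cof: "cofactor w = 0 \<or> cofactor y = 0" by blast
    have "phi7 v *v axis 0 1 = axis 0 1"
      unfolding v(1) by (rule phi7_fix) (use v cof in \<open>auto simp: frame_7 inner_axis axis_nth_8\<close>)
    then have G: "phi7 v \<in> SU3" using phi7_SU4[of v] v by (auto simp: SU3_def)
    \<comment> \<open>The image of e_2 under \<open>matD w ** matB y\<close>, hence orthogonal to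
      the images of e_4 and e_5.\<close>
    define n where "n = vec8 (- cofactor w * y$1) (- cofactor w * y$2) (w$1 * y$1 + w$2 * y$2) (w$1 * y$2 - w$2 * y$1) (cofactor y) 0 0 0"
    have "((matD w ** matB y) *v axis 4 1) \<bullet> n = 0 \<and> ((matD w ** matB y) *v axis 5 1) \<bullet> n = 0"
      unfolding n_def frame_7 inner_8 vec8_nth using cofactor_relation(2)[OF v(4)] by (intro conjI; algebra)
    then have n: "phi7 v *v n = n"
      unfolding v(1) by (intro phi7_fix v) (auto simp: n_def)
    show ?thesis
    proof (cases "n$2 = 0 \<and> n$3 = 0 \<and> n$4 = 0 \<and> n$5 = 0")
      case False
      then show ?thesis using e5I[OF G n] by (simp add: n_def)
    next
      \<comment> \<open>Here \<open>n\<close> lies in the span of e_0 and e_1 and gives no line. But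
        Y = 0 now, so the moved vectors have no component along e_2, and e_2 itself serves.\<close>
      case True
      then have *: "w$1 * y$1 + w$2 * y$2 = 0" "w$1 * y$2 - w$2 * y$1 = 0" "cofactor y = 0" by (auto simp: n_def)
      have "phi7 v *v axis 2 1 = axis 2 1"
        unfolding v(1) by (rule phi7_fix) (use v * in \<open>auto simp: frame_7 inner_axis axis_nth_8\<close>)
      then show ?thesis using e5I[OF G] by (simp add: axis_nth_8)
    qed
  qed
qed

lemma phi6_boundary:
  assumes "v \<in> D3 \<times> D2 \<times> D1 - B3 \<times> B2 \<times> B1" shows "phi6 v \<in> e5"
proof -
  obtain x y z where v: "v = (x, y, z)" "x \<in> D3" "y \<in> D2" "z \<in> D1"
    "x \<notin> B3 \<or> y \<notin> B2 \<or> z \<notin> B1"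
    using assms by blast
  have cof0: "cofactor x = 0 \<or> cofactor y = 0 \<or> cofactor z = 0"
    using v cofactor_boundary[of x] cofactor_boundary[of y] cofactor_boundary[of z] by argo
  show ?thesis
  proof (cases "cofactor x = 0")
    case True
    then show ?thesis using phi_boundary_trivial(3) v one_mem by simp
  next
    case False
    with cof0 have cof: "cofactor z = 0 \<or> cofactor y = 0" by blast
    have "phi6 v *v axis 0 1 = axis 0 1" "phi6 v *v axis 1 1 = axis 1 1"
      unfolding v(1) by (rule phi6_fix; use v cof in \<open>auto simp: frame_6 inner_axis axis_nth_8\<close>)+
    then have G: "phi6 v \<in> SU3" using phi6_spin_pair[of v] v by (auto simp: SU3_def SU4_def)
    \<comment> \<open>The image of e_2 under \<open>matC z ** matB y\<close>.\<close>
    define n where "n = vec8 0 (- cofactor z * y$2) (y$1) (z$1 * y$2) (cofactor y) 0 0 0"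
    have "((matC z ** matB y) *v axis 4 1) \<bullet> n = 0"
      unfolding n_def frame_6 inner_8 vec8_nth by algebra
    moreover have "((matC z ** matB y) *v axis 5 1) \<bullet> n = 0"
      unfolding n_def frame_6 inner_8 vec8_nth using cofactor_relation(3)[OF v(4)] by algebra
    moreover have "((matC z ** matB y) *v axis 6 1) \<bullet> n = 0" "((matC z ** matB y) *v axis 7 1) \<bullet> n = 0"
      by (simp_all add: frame_6 n_def inner_8 axis_nth_8)
    ultimately have "\<forall>j\<in>{4,5,6,7}. ((matC z ** matB y) *v axis j 1) \<bullet> n = 0" by simp
    then have n: "phi6 v *v n = n"
      unfolding v(1) by (intro phi6_fix v)
    show ?thesis
    proof (cases "n$2 = 0 \<and> n$3 = 0 \<and> n$4 = 0 \<and> n$5 = 0")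
      case False
      then show ?thesis using e5I[OF G n] by (simp add: n_def)
    next
      case True
      then have "phi6 v *v axis 2 1 = axis 2 1"
        unfolding v(1) by (intro phi6_fix v) (auto simp: n_def frame_6 inner_axis axis_nth_8)
      then show ?thesis using e5I[OF G] by (simp add: axis_nth_8)
    qed
  qed
qed

text \<open>
  Conversely to \<open>phi7_fix\<close>: a vector of the complex span of \<open>e\<^sub>0, e\<^sub>2, e\<^sub>4\<close> that is orthogonal
  to the displacement of \<open>e\<^sub>0\<close> is fixed.
\<close>

lemma phi7_interior_fix:
  assumes v: "x \<in> B3" "y \<in> B2" "w \<in> B2" and n: "n$6 = 0" "n$7 = 0"
    and "n \<bullet> (phi7 (x, y, w) *v axis 0 1) = n$0" "n \<bullet> (phi7 (x, y, w) *v axis 1 1) = n$1"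
  shows "phi7 (x, y, w) *v n = n"
proof -
  have v': "x \<in> D3" "y \<in> D2" "w \<in> D2" using v by auto
  define M where "M = matD w ** matB y"
  have M: "orthogonal_matrix M" using v' by (simp add: M_def orthogonal_matrix_mul mat_orthogonal)
  have Mt: "orthogonal_matrix (transpose M)" using M by simp
  define X where "X = cofactor x"
  define c where "c = cofactor w * cofactor y"
  have pos: "X > 0" "c > 0" using v by (simp_all add: X_def c_def cofactor_def mem_ball_iff_inner)
  define k where "k = transpose M *v n"
  note F = frame_7[of w y, folded M_def c_def]
  have k67: "k$6 = 0" "k$7 = 0" using n by (simp_all add: k_def transpose_apply_nth F inner_axis inner_axis' axis_nth_8)
  have l0: "(transpose M *v axis 0 1) $ 4 = c" "(transpose M *v axis 0 1) $ 5 = 0"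
      "(transpose M *v axis 0 1) $ 6 = 0" "(transpose M *v axis 0 1) $ 7 = 0"
    and l1: "(transpose M *v axis 1 1) $ 4 = 0" "(transpose M *v axis 1 1) $ 5 = c"
      "(transpose M *v axis 1 1) $ 6 = 0" "(transpose M *v axis 1 1) $ 7 = 0"
    by (simp_all add: transpose_apply_nth F inner_axis inner_axis' axis_nth_8)
  have phi: "n \<bullet> (phi7 (x, y, w) *v l) = k \<bullet> (matA x *v (transpose M *v l))" for l
  proof -
    have "phi7 (x, y, w) *v l = M *v (matA x *v (transpose M *v l))"
      unfolding phi_conj(2)[OF v'(2,3)] M_def by (simp flip: matrix_vector_mul_assoc)
    then have "n \<bullet> (phi7 (x, y, w) *v l) = (M *v k) \<bullet> (M *v (matA x *v (transpose M *v l)))"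
      by (simp add: k_def orthogonal_matrix_inverse(4)[OF M])
    then show ?thesis by (simp add: orthogonal_matrix_inner[OF M])
  qed
  have kl: "k \<bullet> (transpose M *v l) = n \<bullet> l" for l
    unfolding k_def by (rule orthogonal_matrix_inner[OF Mt])
  have A: "k \<bullet> (matA x *v l) = k \<bullet> l + 2 * X * (k$4 * (- X * l$4 - x$1 * l$5) + k$5 * (x$1 * l$4 - X * l$5))"
    if "l$6 = 0" "l$7 = 0" for l
    using that k67 unfolding X_def
    by (cases rule: vec8_cases[of l]) (simp add: mat_rot rot_apply inner_8 power2_eq_square algebra_simps)
  have "n$0 = n$0 + 2 * X * (k$4 * (- X * c) + k$5 * (x$1 * c))"
    using assms(6) A[OF l0(3,4)] by (simp add: phi kl l0 inner_axis)
  moreover have "n$1 = n$1 + 2 * X * (k$4 * (- x$1 * c) + k$5 * (- X * c))"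
    using assms(7) A[OF l1(3,4)] by (simp add: phi kl l1 inner_axis)
  \<comment> \<open>Together these say (k4 + i k5)(X + i x1) = 0, and X > 0 in the interior.\<close>
  ultimately have "(2 * X * c) * (k$5 * x$1 - k$4 * X) = 0" "(2 * X * c) * (k$4 * x$1 + k$5 * X) = 0" by algebra+
  then have "k$5 * x$1 - k$4 * X = 0" "k$4 * x$1 + k$5 * X = 0" using pos by auto
  then have "k$4 * (X * X + x$1 * x$1) = 0" "k$5 * (X * X + x$1 * x$1) = 0" by algebra+
  moreover have "X * X + x$1 * x$1 > 0" using pos by (simp add: sum_squares_gt_zero_iff)
  ultimately have "k$4 = 0" "k$5 = 0" by auto
  then show ?thesis
    by (intro phi7_fix v' n) (auto simp: k_def transpose_apply_nth M_def)
qed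

text \<open>
  If \<open>p \<in> e\<^sup>5\<close> and \<open>q \<in> e\<^sup>7\<close>, then the complex span of \<open>e\<^sub>0, e\<^sub>2, e\<^sub>4\<close> contains a vector \<open>n\<close> that is
  fixed by both.  Writing \<open>p q = q' h\<close> with \<open>q' \<in> e\<^sup>7\<close> and \<open>h \<in> SU3\<close>, the vector \<open>n\<close> is also fixed
  by \<open>q'\<close> and hence by \<open>h\<close>.
\<close>

lemma e5_e7_swap:
  assumes "p \<in> e5" "q \<in> e7" shows "p ** q \<in> e7 \<odot> e5 \<union> SU3"
proof -
  obtain x y where p: "p = phi5 (x, y)" "x \<in> D3" "y \<in> D2" using assms(1) by (auto simp: e5_def)
  obtain x' y' w where q: "q = phi7 (x', y', w)" "x' \<in> D3" "y' \<in> D2" "w \<in> D2"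
    using assms(2) by (auto simp: e7_def)
  have pS: "p \<in> SU3" and qS: "q \<in> SU4" using assms e_subset by auto
  define c where "c = cofactor w * cofactor y'"
  note F = frame_7[of w y', folded c_def]
  show ?thesis
  proof (cases "c = 0")
    case True
    have "q *v axis 0 1 = axis 0 1"
      unfolding q(1) by (rule phi7_fix) (use q True in \<open>auto simp: F inner_axis axis_nth_8\<close>)
    then show ?thesis using pS qS SU3_group by (auto simp: SU3_def)
  next
    case False
    define s where "s = vec8 0 0 (y$1) (y$2) (cofactor y) 0 0 0"
    \<comment> \<open>The vector \<open>s\<close>, the image of e_2 under \<open>matB y\<close>, is
      fixed by \<open>p\<close>, as are e_0 and e_1. The moved vectors of \<open>q\<close> have
      (e_0, e_1)-components (c, 0) and (0, c), so these multiples make c s orthogonal to both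
      without a division.\<close>
    define n where "n = c *\<^sub>R s - (((matD w ** matB y') *v axis 4 1) \<bullet> s) *\<^sub>R axis 0 1
        - (((matD w ** matB y') *v axis 5 1) \<bullet> s) *\<^sub>R axis 1 1"
    have n67: "n$6 = 0" "n$7 = 0" by (simp_all add: n_def s_def axis_nth_8)
    have ps: "p *v s = s" unfolding p(1)
      by (rule phi5_fix) (use p in \<open>auto simp: frame_5, auto simp: s_def inner_8\<close>)
    have pn: "p *v n = n" unfolding n_def
      by (simp add: ps SU3D[OF pS] matrix_vector_mult_diff_distrib matrix_vector_mult_scaleR)
    have qn: "q *v n = n" unfolding q(1)
      by (rule phi7_fix) (use q n67 in \<open>auto simp: n_def inner_diff_right F inner_axis\<close>)
    have pq: "p ** q \<in> SU4" using pS qS subgroup_chain SU4_group by blast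
    then obtain b v h where v: "v \<in> slot b (B3 \<times> B2 \<times> B2)" "h \<in> SU3" "p ** q = factor b phi7 v ** h"
      using orbit_cell.factor_exists[OF orbit_cell_7] by metis
    show ?thesis
    proof (cases b)
      case False
      then show ?thesis using v by (simp add: factor_def)
    next
      case True
      then obtain x1 y1 w1 where v1: "v = (x1, y1, w1)" "x1 \<in> B3" "y1 \<in> B2" "w1 \<in> B2"
        and eq: "p ** q = phi7 v ** h" using v by (auto simp: slot_def factor_def)
      have vS: "phi7 v \<in> SU4" using v1 phi7_SU4 by auto
      have pqn: "(p ** q) *v n = n" by (simp add: pn qn flip: matrix_vector_mul_assoc)
      \<comment> \<open>\<open>h\<close> fixes e_0 and e_1, so on them \<open>phi7 v\<close> agrees
        with the isometry \<open>p ** q\<close>, which fixes \<open>n\<close>. This says that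
        \<open>n\<close> is orthogonal to their displacements.\<close>
      have d: "n \<bullet> (phi7 v *v axis j 1) = n $ j" if "j = 0 \<or> j = 1" for j
      proof -
        have "phi7 v *v axis j 1 = (p ** q) *v axis j 1"
          using that SU3D(2,3)[OF v(2)] by (auto simp: eq simp flip: matrix_vector_mul_assoc)
        then have "n \<bullet> (phi7 v *v axis j 1) = ((p ** q) *v n) \<bullet> ((p ** q) *v axis j 1)"
          by (simp add: pqn)
        then show ?thesis by (simp add: orthogonal_matrix_inner[OF SU4_orthogonal[OF pq]] inner_axis)
      qed
      have "phi7 v *v n = n" unfolding v1(1)
        by (rule phi7_interior_fix) (use v1 n67 d in auto)
      moreover have "phi7 v *v (h *v n) = n" using pqn by (simp add: eq flip: matrix_vector_mul_assoc)
      ultimately have "h *v n = n" using orthogonal_matrix_inverse(3)[OF SU4_orthogonal[OF vS]] by metis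
      moreover have "\<not> (n$2 = 0 \<and> n$3 = 0 \<and> n$4 = 0 \<and> n$5 = 0)"
        using \<open>c \<noteq> 0\<close> cofactor_relation(2)[OF p(3)] by (auto simp: n_def s_def axis_nth_8)
      ultimately have "h \<in> e5" using e5I v(2) n67 by blast
      moreover have "phi7 v \<in> e7" using v1 by (auto simp: e7_def)
      ultimately show ?thesis by (simp add: eq set_mult_mem)
    qed
  qed
qed

section \<open>The cells as products\<close>

text \<open>With 0 in both sets, affine dimension is linear dimension of the span, which is
  additive.\<close>

lemma aff_dim_Times_0:
  fixes A :: "'a::euclidean_space set" and B :: "'b::euclidean_space set"
  assumes "0 \<in> A" "0 \<in> B"
  shows "aff_dim (A \<times> B) = aff_dim A + aff_dim B"
proof -
  have "span (A \<times> B) = span A \<times> span B"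
  proof
    show "span (A \<times> B) \<subseteq> span A \<times> span B"
      by (rule span_minimal) (auto intro: span_base subspace_Times)
    have "A \<times> {0} \<subseteq> A \<times> B" "{0} \<times> B \<subseteq> A \<times> B" using assms by auto
    then have *: "span A \<times> {0} \<subseteq> span (A \<times> B)" "{0} \<times> span B \<subseteq> span (A \<times> B)"
      using span_mono[of "A \<times> {0}" "A \<times> B"] span_mono[of "{0} \<times> B" "A \<times> B"]
      by (simp_all add: span_Times_sing1 span_Times_sing2)
    show "span A \<times> span B \<subseteq> span (A \<times> B)"
    proof clarify
      fix a b assume "a \<in> span A" "b \<in> span B"
      then have "(a, 0) \<in> span (A \<times> B)" "(0, b) \<in> span (A \<times> B)" using * by auto
      then show "(a, b) \<in> span (A \<times> B)" using span_add by fastforce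
    qed
  qed
  then have "dim (A \<times> B) = dim A + dim B"
    using dim_Times[of "span A" "span B"] by (metis dim_span subspace_span)
  moreover have "(0, 0) \<in> A \<times> B" using assms by simp
  ultimately show ?thesis
    using assms by (simp add: aff_dim_zero hull_inc zero_prod_def)
qed

section \<open>Continuity of the characteristic maps\<close>

lemma continuous_on_vec8 [continuous_intros]:
  fixes f0 :: "'a::topological_space \<Rightarrow> 'b::topological_space"
  assumes "continuous_on S f0" "continuous_on S f1" "continuous_on S f2" "continuous_on S f3"
    "continuous_on S f4" "continuous_on S f5" "continuous_on S f6" "continuous_on S f7"
  shows "continuous_on S (\<lambda>x. vec8 (f0 x) (f1 x) (f2 x) (f3 x) (f4 x) (f5 x) (f6 x) (f7 x))"
proof -
  have "\<forall>i. continuous_on S (\<lambda>x. vec8 (f0 x) (f1 x) (f2 x) (f3 x) (f4 x) (f5 x) (f6 x) (f7 x) $ i)"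
    using assms by (simp add: forall_8)
  then have "continuous_on S (\<lambda>x. \<chi> i. vec8 (f0 x) (f1 x) (f2 x) (f3 x) (f4 x) (f5 x) (f6 x) (f7 x) $ i)"
    by (intro continuous_on_vec_lambda) auto
  then show ?thesis by simp
qed

lemma continuous_on_matrix_mult [continuous_intros]:
  fixes F :: "'a::topological_space \<Rightarrow> real^'m^'n" and G :: "'a \<Rightarrow> real^'p^'m"
  assumes "continuous_on S F" "continuous_on S G"
  shows "continuous_on S (\<lambda>x. F x ** G x)"
  unfolding matrix_matrix_mult_def using assms
  by (intro continuous_on_vec_lambda continuous_intros continuous_on_component)

lemma continuous_on_transpose [continuous_intros]:
  fixes F :: "'a::topological_space \<Rightarrow> real^'m^'n"
  assumes "continuous_on S F"
  shows "continuous_on S (\<lambda>x. transpose (F x))"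
  unfolding transpose_def using assms
  by (intro continuous_on_vec_lambda continuous_on_component)

lemma continuous_on_cofactor [continuous_intros]:
  "continuous_on S f \<Longrightarrow> continuous_on S (\<lambda>x. cofactor (f x))"
  unfolding cofactor_def by (intro continuous_intros)

lemma continuous_on_mat [continuous_intros]:
  "continuous_on S f \<Longrightarrow> continuous_on S (\<lambda>x. matA (f x))"
  "continuous_on S g \<Longrightarrow> continuous_on S (\<lambda>x. matB (g x))"
  "continuous_on S h \<Longrightarrow> continuous_on S (\<lambda>x. matC (h x))"
  "continuous_on S k \<Longrightarrow> continuous_on S (\<lambda>x. matD (k x))"
  unfolding mat_rot rot_defs by (intro continuous_intros continuous_on_component; assumption)+

text \<open>\<open>matrix_inv\<close> is defined by choice; on the discs it is the transpose, whose
  continuity is evident.\<close>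

lemma continuous_on_phi:
  "continuous_on D3 phi3" "continuous_on (D3 \<times> D2) phi5"
  "continuous_on (D3 \<times> D2 \<times> D1) phi6" "continuous_on (D3 \<times> D2 \<times> D2) phi7"
proof -
  show "continuous_on D3 phi3" unfolding phi3_def by (intro continuous_intros)
  have "continuous_on (D3 \<times> D2) (\<lambda>v. matB (snd v) ** matA (fst v) ** transpose (matB (snd v)))"
    by (intro continuous_intros)
  then show "continuous_on (D3 \<times> D2) phi5"
    by (rule continuous_on_eq) (auto simp: phi_transpose)
  have "continuous_on (D3 \<times> D2 \<times> D1) (\<lambda>v. matC (snd (snd v)) ** matB (fst (snd v)) ** matA (fst v)
      ** transpose (matB (fst (snd v))) ** transpose (matC (snd (snd v))))"
    by (intro continuous_intros)
  then show "continuous_on (D3 \<times> D2 \<times> D1) phi6"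
    by (rule continuous_on_eq) (auto simp: phi_transpose)
  have "continuous_on (D3 \<times> D2 \<times> D2) (\<lambda>v. matD (snd (snd v)) ** matB (fst (snd v)) ** matA (fst v)
      ** transpose (matB (fst (snd v))) ** transpose (matD (snd (snd v))))"
    by (intro continuous_intros)
  then show "continuous_on (D3 \<times> D2 \<times> D2) phi7"
    by (rule continuous_on_eq) (auto simp: phi_transpose)
qed

lemma rel_interior_balls:
  "rel_interior D1 = B1" "rel_interior D2 = B2" "rel_interior D3 = B3"
  by (simp_all add: rel_interior_nonempty_interior)

lemma rel_interior_slot: "rel_interior (slot b K) = slot b (rel_interior K)"
  for K :: "'a::euclidean_space set"
  by (simp add: slot_def)

lemma convex_slot: "convex K \<Longrightarrow> convex (slot b K)"
  and compact_slot: "compact K \<Longrightarrow> compact (slot b K)"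
  and aff_dim_slot: "aff_dim (slot b K) = (if b then aff_dim K else 0)"
  and zero_slot: "0 \<in> K \<Longrightarrow> 0 \<in> slot b K"
  for K :: "'a::euclidean_space set"
  by (simp_all add: slot_def)

section \<open>Cells indexed by the set of their factors\<close>

definition params :: "bool \<Rightarrow> bool \<Rightarrow> bool \<Rightarrow> bool \<Rightarrow> cell_params set" where
  "params b6 b7 b5 b3 =
     slot b6 (D3 \<times> D2 \<times> D1) \<times> slot b7 (D3 \<times> D2 \<times> D2) \<times> slot b5 (D3 \<times> D2) \<times> slot b3 D3"

definition open_params :: "bool \<Rightarrow> bool \<Rightarrow> bool \<Rightarrow> bool \<Rightarrow> cell_params set" where
  "open_params b6 b7 b5 b3 =
     slot b6 (B3 \<times> B2 \<times> B1) \<times> slot b7 (B3 \<times> B2 \<times> B2) \<times> slot b5 (B3 \<times> B2) \<times> slot b3 B3"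

text \<open>Bracketing to the right lets the factors be split off in the order of the chain.\<close>

definition prod_map :: "bool \<Rightarrow> bool \<Rightarrow> bool \<Rightarrow> bool \<Rightarrow> cell_params \<Rightarrow> real^8^8" where
  "prod_map b6 b7 b5 b3 = (\<lambda>(v6, v7, v5, v3).
     factor b6 phi6 v6 ** (factor b7 phi7 v7 ** (factor b5 phi5 v5 ** factor b3 phi3 v3)))"

definition prod_cell :: "bool \<Rightarrow> bool \<Rightarrow> bool \<Rightarrow> bool \<Rightarrow> (real^8^8) set" where
  "prod_cell b6 b7 b5 b3 = (if b6 then e6 else {mat 1}) \<odot> ((if b7 then e7 else {mat 1}) \<odot>
     ((if b5 then e5 else {mat 1}) \<odot> (if b3 then e3 else {mat 1})))"

text \<open>The sixteen subset sums of 3, 5, 6, 7 are distinct, so the dimension can also serve as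
  the name of the cell.\<close>

definition prod_dim :: "bool \<Rightarrow> bool \<Rightarrow> bool \<Rightarrow> bool \<Rightarrow> nat" where
  "prod_dim b6 b7 b5 b3 = (if b6 then 6 else 0) + (if b7 then 7 else 0) + (if b5 then 5 else 0) + (if b3 then 3 else 0)"

lemma set_mult_assoc: "P \<odot> Q \<odot> R = P \<odot> (Q \<odot> R)"
  unfolding set_mult_def by (auto simp: matrix_mul_assoc) (metis matrix_mul_assoc)+

lemma set_mult_mono: "P \<subseteq> P' \<Longrightarrow> Q \<subseteq> Q' \<Longrightarrow> P \<odot> Q \<subseteq> P' \<odot> Q'"
  by (auto simp: set_mult_def)

lemma set_mult_one [simp]: "{mat 1} \<odot> P = P" "P \<odot> {mat 1} = P"
  by (auto simp: set_mult_def)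

lemma prod_dim_cases:
  assumes "n \<in> cell_dims"
  obtains b6 b7 b5 b3 where "n = prod_dim b6 b7 b5 b3"
proof -
  have "\<exists>b6 b7 b5 b3. n = prod_dim b6 b7 b5 b3"
    using assms by (simp add: ex_bool_eq prod_dim_def cell_dims_def) auto
  then show ?thesis using that by blast
qed

lemma prod_dim_mem: "prod_dim b6 b7 b5 b3 \<in> cell_dims"
  by (cases b6; cases b7; cases b5; cases b3; simp add: prod_dim_def cell_dims_def)

lemma cell_domain_prod: "cell_domain (prod_dim b6 b7 b5 b3) = params b6 b7 b5 b3"
  by (cases b6; cases b7; cases b5; cases b3; simp add: prod_dim_def cell_domain_def params_def slot_def)

lemma char_map_prod: "char_map (prod_dim b6 b7 b5 b3) = prod_map b6 b7 b5 b3"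
  by (cases b6; cases b7; cases b5; cases b3;
      simp add: prod_dim_def char_map_def prod_map_def factor_def matrix_mul_assoc)

lemma cell_prod: "cell (prod_dim b6 b7 b5 b3) = prod_cell b6 b7 b5 b3"
  by (cases b6; cases b7; cases b5; cases b3;
      simp add: prod_dim_def cell_def prod_cell_def set_mult_assoc)

lemma factor_image:
  "factor b phi6 ` slot b (D3 \<times> D2 \<times> D1) = (if b then e6 else {mat 1})"
  "factor b phi7 ` slot b (D3 \<times> D2 \<times> D2) = (if b then e7 else {mat 1})"
  "factor b phi5 ` slot b (D3 \<times> D2) = (if b then e5 else {mat 1})"
  "factor b phi3 ` slot b D3 = (if b then e3 else {mat 1})"
  by (simp_all add: factor_def[abs_def] slot_def e3_def e5_def e6_def e7_def)

lemma prod_map_image: "prod_map b6 b7 b5 b3 ` params b6 b7 b5 b3 = prod_cell b6 b7 b5 b3"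
  unfolding prod_map_def params_def prod_cell_def factor_image[symmetric] set_mult_def
  by (auto simp: image_iff) blast+

lemma prod_cell_subset: "prod_cell b6 b7 b5 b3 \<subseteq> prod_cell True True True True"
  unfolding prod_cell_def using one_mem by (intro set_mult_mono) auto

lemma prod_cell_eqs:
  "prod_cell False False False True = SU2" "prod_cell False False True True = SU3"
  "prod_cell False True True True = SU4" "prod_cell True True True True = Spin7"
  by (simp_all add: prod_cell_def SU2_eq SU3_eq SU4_eq Spin7_eq)

text \<open>Comparing flags as well as parameters gives injectivity on each open cell and
  disjointness of different open cells at once.\<close>

lemma prod_map_unique:
  assumes v: "v \<in> open_params b6 b7 b5 b3" "v' \<in> open_params b6' b7' b5' b3'"
    and eq: "prod_map b6 b7 b5 b3 v = prod_map b6' b7' b5' b3' v'"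
  shows "(b6, b7, b5, b3) = (b6', b7', b5', b3') \<and> v = v'"
proof -
  interpret c6: orbit_cell Spin7 SU4 spin_image phi6 "B3 \<times> B2 \<times> B1" by (rule orbit_cell_6)
  interpret c7: orbit_cell SU4 SU3 "\<lambda>G. G *v axis 0 1" phi7 "B3 \<times> B2 \<times> B2" by (rule orbit_cell_7)
  interpret c5: orbit_cell SU3 SU2 "\<lambda>G. G *v axis 2 1" phi5 "B3 \<times> B2" by (rule orbit_cell_5)
  interpret c3: orbit_cell SU2 "{mat 1}" "\<lambda>G. G *v axis 4 1" phi3 B3 by (rule orbit_cell_3)
  obtain v6 v7 v5 v3 where v_eq: "v = (v6, v7, v5, v3)" by (cases v)
  obtain v6' v7' v5' v3' where v'_eq: "v' = (v6', v7', v5', v3')" by (cases v')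
  have m: "v6 \<in> slot b6 (B3 \<times> B2 \<times> B1)" "v7 \<in> slot b7 (B3 \<times> B2 \<times> B2)" "v5 \<in> slot b5 (B3 \<times> B2)" "v3 \<in> slot b3 B3"
    using v(1) by (auto simp: open_params_def v_eq)
  have m': "v6' \<in> slot b6' (B3 \<times> B2 \<times> B1)" "v7' \<in> slot b7' (B3 \<times> B2 \<times> B2)" "v5' \<in> slot b5' (B3 \<times> B2)" "v3' \<in> slot b3' B3"
    using v(2) by (auto simp: open_params_def v'_eq)
  have h3: "factor b3 phi3 v3 \<in> SU2" "factor b3' phi3 v3' \<in> SU2"
    using c3.factor_mem m m' by auto
  have h5: "factor b5 phi5 v5 ** factor b3 phi3 v3 \<in> SU3" "factor b5' phi5 v5' ** factor b3' phi3 v3' \<in> SU3"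
    using c5.factor_mem m m' h3 c5.sub c5.mult by (meson subsetD)+
  have h7: "factor b7 phi7 v7 ** (factor b5 phi5 v5 ** factor b3 phi3 v3) \<in> SU4"
    "factor b7' phi7 v7' ** (factor b5' phi5 v5' ** factor b3' phi3 v3') \<in> SU4"
    using c7.factor_mem m m' h5 c7.sub c7.mult by (meson subsetD)+
  have 6: "b6 = b6' \<and> v6 = v6' \<and> factor b7 phi7 v7 ** (factor b5 phi5 v5 ** factor b3 phi3 v3)
      = factor b7' phi7 v7' ** (factor b5' phi5 v5' ** factor b3' phi3 v3')"
    using c6.factor_unique[OF m(1) m'(1) h7] eq by (simp add: prod_map_def v_eq v'_eq)
  then have 7: "b7 = b7' \<and> v7 = v7' \<and> factor b5 phi5 v5 ** factor b3 phi3 v3 = factor b5' phi5 v5' ** factor b3' phi3 v3'"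
    using c7.factor_unique[OF m(2) m'(2) h5] by blast
  then have 5: "b5 = b5' \<and> v5 = v5' \<and> factor b3 phi3 v3 = factor b3' phi3 v3'"
    using c5.factor_unique[OF m(3) m'(3) h3] by blast
  then have "b3 = b3' \<and> v3 = v3'"
    using c3.factor_unique[OF m(4) m'(4), of "mat 1" "mat 1"] by simp
  with 5 6 7 show ?thesis by (simp add: v_eq v'_eq)
qed

lemma prod_map_exists:
  assumes "G \<in> Spin7"
  obtains b6 b7 b5 b3 v where "v \<in> open_params b6 b7 b5 b3" "G = prod_map b6 b7 b5 b3 v"
proof -
  obtain b6 v6 g where 6: "v6 \<in> slot b6 (B3 \<times> B2 \<times> B1)" "g \<in> SU4" "G = factor b6 phi6 v6 ** g"
    using orbit_cell.factor_exists[OF orbit_cell_6 assms] by blast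
  obtain b7 v7 h where 7: "v7 \<in> slot b7 (B3 \<times> B2 \<times> B2)" "h \<in> SU3" "g = factor b7 phi7 v7 ** h"
    using orbit_cell.factor_exists[OF orbit_cell_7 6(2)] by blast
  obtain b5 v5 k where 5: "v5 \<in> slot b5 (B3 \<times> B2)" "k \<in> SU2" "h = factor b5 phi5 v5 ** k"
    using orbit_cell.factor_exists[OF orbit_cell_5 7(2)] by blast
  obtain b3 v3 l where 3: "v3 \<in> slot b3 B3" "l \<in> {mat 1}" "k = factor b3 phi3 v3 ** l"
    using orbit_cell.factor_exists[OF orbit_cell_3 5(2)] by blast
  have "(v6, v7, v5, v3) \<in> open_params b6 b7 b5 b3" "G = prod_map b6 b7 b5 b3 (v6, v7, v5, v3)"
    using 6 7 5 3 by (auto simp: open_params_def prod_map_def)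
  then show ?thesis using that by blast
qed

lemma rel_interior_params: "rel_interior (params b6 b7 b5 b3) = open_params b6 b7 b5 b3"
  by (simp add: params_def open_params_def rel_interior_Times convex_Times convex_slot rel_interior_slot rel_interior_balls)

lemma params_compact_convex: "compact (params b6 b7 b5 b3)" "convex (params b6 b7 b5 b3)"
  unfolding params_def
  by (intro compact_Times compact_slot compact_cball convex_Times convex_slot convex_cball)+

lemma zero_mem_Times: "0 \<in> A \<Longrightarrow> 0 \<in> B \<Longrightarrow> 0 \<in> A \<times> B"
  by (simp add: zero_prod_def)

lemma aff_dim_params: "aff_dim (params b6 b7 b5 b3) = int (prod_dim b6 b7 b5 b3)"
proof -
  have z: "0 \<in> D1" "0 \<in> D2" "0 \<in> D3" by (simp_all add: mem_cball_0)
  note z = z zero_mem_Times zero_slot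
  have "aff_dim (D3 \<times> D2) = 5" "aff_dim (D3 \<times> D2 \<times> D1) = 6" "aff_dim (D3 \<times> D2 \<times> D2) = 7"
    by (simp_all add: z aff_dim_Times_0 aff_dim_cball)
  then show ?thesis unfolding params_def prod_dim_def
    by (simp add: z aff_dim_Times_0 aff_dim_slot aff_dim_cball)
qed

lemma continuous_on_factor: "continuous_on K \<phi> \<Longrightarrow> continuous_on (slot b K) (factor b \<phi>)"
  by (cases b) (simp_all add: slot_def factor_def[abs_def])

lemma continuous_on_prod_map: "continuous_on (params b6 b7 b5 b3) (prod_map b6 b7 b5 b3)"
  unfolding prod_map_def case_prod_unfold params_def
  by (intro continuous_intros continuous_on_compose2[OF continuous_on_factor[OF continuous_on_phi(1)]]
      continuous_on_compose2[OF continuous_on_factor[OF continuous_on_phi(2)]]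
      continuous_on_compose2[OF continuous_on_factor[OF continuous_on_phi(3)]]
      continuous_on_compose2[OF continuous_on_factor[OF continuous_on_phi(4)]]) auto

text \<open>Some factor sits on its boundary and drops into the identity, e^3 or e^5. The cases
  differ in how far it must be merged with the factors to its right so that a product in the
  prescribed order, of smaller dimension, contains the result.\<close>

lemma prod_map_boundary:
  assumes "v \<in> params b6 b7 b5 b3" "v \<notin> open_params b6 b7 b5 b3"
  shows "\<exists>a6 a7 a5 a3. prod_map b6 b7 b5 b3 v \<in> prod_cell a6 a7 a5 a3
           \<and> prod_dim a6 a7 a5 a3 < prod_dim b6 b7 b5 b3"
proof -
  obtain v6 v7 v5 v3 where v_eq: "v = (v6, v7, v5, v3)" by (cases v)
  define g6 where "g6 = factor b6 phi6 v6"
  define g7 where "g7 = factor b7 phi7 v7"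
  define g5 where "g5 = factor b5 phi5 v5"
  define g3 where "g3 = factor b3 phi3 v3"
  define G where "G = g6 ** (g7 ** (g5 ** g3))"
  have G: "prod_map b6 b7 b5 b3 v = G"
    by (simp add: G_def v_eq prod_map_def g6_def g7_def g5_def g3_def)
  have m: "v6 \<in> slot b6 (D3 \<times> D2 \<times> D1)" "v7 \<in> slot b7 (D3 \<times> D2 \<times> D2)" "v5 \<in> slot b5 (D3 \<times> D2)" "v3 \<in> slot b3 D3"
    using assms(1) by (auto simp: v_eq params_def)
  have g: "g6 \<in> (if b6 then e6 else {mat 1})" "g7 \<in> (if b7 then e7 else {mat 1})"
    "g5 \<in> (if b5 then e5 else {mat 1})" "g3 \<in> (if b3 then e3 else {mat 1})"
    unfolding g6_def g7_def g5_def g3_def using factor_image m by blast+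
  have g3S: "g3 \<in> SU2" using g(4) one_mem by (auto simp: SU2_eq split: if_splits)
  have g5S: "g5 \<in> SU3" using g(3) one_mem e_subset(2) by (auto split: if_splits)
  have g7S: "g7 \<in> SU4" using g(2) one_mem e_subset(3) by (auto split: if_splits)
  have h5: "g5 ** g3 \<in> SU3" using g3S g5S subgroup_chain SU3_group by blast
  have h7: "g7 ** (g5 ** g3) \<in> SU4" using h5 g7S subgroup_chain SU4_group by blast
  have "\<exists>a6 a7 a5 a3. G \<in> prod_cell a6 a7 a5 a3 \<and> prod_dim a6 a7 a5 a3 < prod_dim b6 b7 b5 b3" (is ?goal)
  proof -
  consider "v3 \<notin> slot b3 B3" | "v5 \<notin> slot b5 (B3 \<times> B2)" | "v7 \<notin> slot b7 (B3 \<times> B2 \<times> B2)"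
    | "v6 \<notin> slot b6 (B3 \<times> B2 \<times> B1)"
    using assms(2) unfolding v_eq open_params_def by blast
  then show ?goal
  proof cases
    case 1
    then have b3: "b3" using m(4) by (auto simp: slot_def split: if_splits)
    then have "g3 = mat 1" using 1 m(4) b3 phi3_boundary[of v3] by (simp add: slot_def g3_def factor_def)
    then have "G \<in> prod_cell b6 b7 b5 False"
      unfolding prod_cell_def G_def using g by (intro set_mult_mem) auto
    then show ?goal using b3
      by (intro exI[of _ b6] exI[of _ b7] exI[of _ b5] exI[of _ False]) (simp add: prod_dim_def)
  next
    case 2
    then have b5: "b5" using m(3) by (auto simp: slot_def split: if_splits)
    then have "g5 \<in> e3" using 2 m(3) b5 phi5_boundary[of v5] by (simp add: slot_def g5_def factor_def)
    \<comment> \<open>Both factors lie in the group \<open>SU2\<close>, which is e^3: the 5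
      disappears and at most 3 is gained.\<close>
    then have "g5 ** g3 \<in> e3" using g3S SU2_group by (simp add: SU2_eq[symmetric])
    then have "G \<in> prod_cell b6 b7 False True"
      unfolding prod_cell_def G_def using g(1,2) by (intro set_mult_mem[of g6] set_mult_mem[of g7]) auto
    then show ?goal using b5
      by (intro exI[of _ b6] exI[of _ b7] exI[of _ False] exI[of _ True]) (simp add: prod_dim_def)
  next
    case 3
    then have b7: "b7" using m(2) by (auto simp: slot_def split: if_splits)
    then have g7: "g7 \<in> e5" using 3 m(2) b7 phi7_boundary[of v7] by (simp add: slot_def g7_def factor_def)
    show ?goal
    proof (cases b5)
      case True
      \<comment> \<open>Everything to the right of \<open>g6\<close> lies in \<open>SU3\<close>, of
        dimension 8, which is less than 7 + 5.\<close>
      have "g7 ** (g5 ** g3) \<in> e5 \<odot> e3" using g7 e_subset(2) h5 SU3_group by (auto simp: SU3_eq[symmetric])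
      then have "G \<in> prod_cell b6 False True True"
        unfolding prod_cell_def G_def using g(1) by (intro set_mult_mem[of g6]) auto
      then show ?goal using b7 True
        by (intro exI[of _ b6] exI[of _ False] exI[of _ True] exI[of _ True]) (simp add: prod_dim_def)
    next
      case False
      then have "G = g6 ** (g7 ** g3)" using g(3) by (simp add: G_def)
      then have "G \<in> prod_cell b6 False True b3"
        using set_mult_mem[OF g(1) set_mult_mem[OF g7 g(4)]] by (simp add: prod_cell_def)
      then show ?goal using b7 False
        by (intro exI[of _ b6] exI[of _ False] exI[of _ True] exI[of _ b3]) (simp add: prod_dim_def)
    qed
  next
    case 4
    then have b6: "b6" using m(1) by (auto simp: slot_def split: if_splits)
    then have g6: "g6 \<in> e5" using 4 m(1) b6 phi6_boundary[of v6] by (simp add: slot_def g6_def factor_def)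
    then have g6S: "g6 \<in> SU3" "g6 \<in> SU4" using e_subset subgroup_chain by auto
    \<comment> \<open>With e^6, e^7 and another factor the dimension is at least 16, so
      \<open>SU4\<close> of dimension 15 is enough; e^6 e^7 alone needs the swap. Without e^7,
      either \<open>SU3\<close> absorbs the product or e^5 simply replaces e^6.\<close>
    consider "b7" "b5 \<or> b3" | "b7" "\<not> b5" "\<not> b3" | "\<not> b7" "b5" | "\<not> b7" "\<not> b5" by blast
    then show ?goal
    proof cases
      case 1
      have "G \<in> prod_cell False True True True"
        unfolding prod_cell_eqs G_def using g6S(2) h7 SU4_group by blast
      then show ?goal using b6 1
        by (intro exI[of _ False] exI[of _ True] exI[of _ True] exI[of _ True]) (auto simp: prod_dim_def)
    next
      case 2
      then have "G = g6 ** g7" "g7 \<in> e7" using g by (auto simp: G_def)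
      then have "G \<in> prod_cell False True True False \<union> prod_cell False False True True"
        using e5_e7_swap[OF g6] unfolding prod_cell_eqs by (simp add: prod_cell_def)
      then show ?goal
      proof
        assume "G \<in> prod_cell False True True False"
        then show ?goal using b6 2
          by (intro exI[of _ False] exI[of _ True] exI[of _ True] exI[of _ False]) (simp add: prod_dim_def)
      next
        assume "G \<in> prod_cell False False True True"
        then show ?goal using b6 2
          by (intro exI[of _ False] exI[of _ False] exI[of _ True] exI[of _ True]) (simp add: prod_dim_def)
      qed
    next
      case 3
      then have "g7 = mat 1" using g(2) by simp
      then have "G \<in> prod_cell False False True True"
        unfolding prod_cell_eqs G_def using g6S(1) h5 SU3_group by simp
      then show ?goal using b6 3
        by (intro exI[of _ False] exI[of _ False] exI[of _ True] exI[of _ True]) (simp add: prod_dim_def)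
    next
      case 4
      then have "G = g6 ** g3" using g(2,3) by (simp add: G_def)
      then have "G \<in> prod_cell False False True b3"
        using set_mult_mem[OF g6 g(4)] by (simp add: prod_cell_def)
      then show ?goal using b6 4
        by (intro exI[of _ False] exI[of _ False] exI[of _ True] exI[of _ b3]) (simp add: prod_dim_def)
    qed
  qed
  qed
  then show ?thesis unfolding G .
qed

theorem theorem2p6:
  shows "cellular_decomposition Spin7 cell_dims (\<lambda>n. n) cell_domain char_map \<and>
         (\<forall>n\<in>cell_dims. char_map n ` cell_domain n = cell n) \<and>
         Spin7 = cell 0 \<union> cell 3 \<union> cell 5 \<union> cell 6 \<union> cell 7 \<union> cell 8 \<union> cell 9 \<union> cell 10 \<union> cell 11
                 \<union> cell 12 \<union> cell 13 \<union> cell 14 \<union> cell 15 \<union> cell 16 \<union> cell 18 \<union> cell 21"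
proof (intro conjI)
  note prod_simps = cell_domain_prod char_map_prod cell_prod rel_interior_params
  have image: "char_map n ` cell_domain n = cell n" if "n \<in> cell_dims" for n
    by (rule prod_dim_cases[OF that]) (simp add: cell_domain_prod char_map_prod cell_prod prod_map_image)
  have sub: "cell n \<subseteq> Spin7" if "n \<in> cell_dims" for n
    by (rule prod_dim_cases[OF that]) (use prod_cell_subset[unfolded prod_cell_eqs] in \<open>simp add: cell_prod\<close>)
  show "\<forall>n\<in>cell_dims. char_map n ` cell_domain n = cell n" using image by blast
  \<comment> \<open>The top closed cell is already the whole group, so the displayed union of closed
    cells follows from the inclusions; the finer information is in the open cells.\<close>
  have "cell 21 = Spin7"
    using cell_prod[of True True True True] by (simp add: prod_dim_def prod_cell_eqs)
  then show "Spin7 = cell 0 \<union> cell 3 \<union> cell 5 \<union> cell 6 \<union> cell 7 \<union> cell 8 \<union> cell 9 \<union> cell 10 \<union> cell 11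
                 \<union> cell 12 \<union> cell 13 \<union> cell 14 \<union> cell 15 \<union> cell 16 \<union> cell 18 \<union> cell 21"
    using sub by (auto simp: cell_dims_def)
  show "cellular_decomposition Spin7 cell_dims (\<lambda>n. n) cell_domain char_map"
    unfolding cellular_decomposition_def
  proof (intro conjI ballI impI)
    show "finite cell_dims" by (simp add: cell_dims_def)
    fix n assume n: "n \<in> cell_dims"
    obtain b6 b7 b5 b3 where n_eq: "n = prod_dim b6 b7 b5 b3" using prod_dim_cases[OF n] .
    show "compact (cell_domain n)" "convex (cell_domain n)" "aff_dim (cell_domain n) = int n"
      "continuous_on (cell_domain n) (char_map n)"
      by (simp_all add: n_eq prod_simps params_compact_convex aff_dim_params continuous_on_prod_map)
    show "char_map n ` cell_domain n \<subseteq> Spin7" using image[OF n] sub[OF n] by simp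
    show "inj_on (char_map n) (rel_interior (cell_domain n))"
      unfolding n_eq prod_simps by (rule inj_onI) (use prod_map_unique in blast)
    show "char_map n ` rel_interior (cell_domain n) \<inter> char_map m ` rel_interior (cell_domain m) = {}"
      if m: "m \<in> cell_dims" and "n \<noteq> m" for m
    proof -
      obtain a6 a7 a5 a3 where m_eq: "m = prod_dim a6 a7 a5 a3" using prod_dim_cases[OF m] .
      have False if "v \<in> open_params b6 b7 b5 b3" "v' \<in> open_params a6 a7 a5 a3"
        "prod_map b6 b7 b5 b3 v = prod_map a6 a7 a5 a3 v'" for v v'
        using prod_map_unique[OF that] \<open>n \<noteq> m\<close> by (simp add: n_eq m_eq)
      then show ?thesis unfolding n_eq m_eq prod_simps by blast
    qed
    show "char_map n ` rel_frontier (cell_domain n) \<subseteq> (\<Union>j\<in>{j \<in> cell_dims. j < n}. char_map j ` cell_domain j)"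
    proof
      fix G assume "G \<in> char_map n ` rel_frontier (cell_domain n)"
      then obtain v where v: "v \<in> params b6 b7 b5 b3" "v \<notin> open_params b6 b7 b5 b3" "G = prod_map b6 b7 b5 b3 v"
        by (auto simp: rel_frontier_def n_eq prod_simps params_compact_convex compact_imp_closed)
      obtain a6 a7 a5 a3 where a: "G \<in> prod_cell a6 a7 a5 a3" "prod_dim a6 a7 a5 a3 < n"
        using prod_map_boundary[OF v(1,2)] v(3) n_eq by blast
      then have "G \<in> char_map (prod_dim a6 a7 a5 a3) ` cell_domain (prod_dim a6 a7 a5 a3)"
        by (simp add: image prod_dim_mem cell_prod)
      then show "G \<in> (\<Union>j\<in>{j \<in> cell_dims. j < n}. char_map j ` cell_domain j)"
        by (rule UN_I[rotated]) (simp add: a(2) prod_dim_mem)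
    qed
  next
    show "(\<Union>n\<in>cell_dims. char_map n ` rel_interior (cell_domain n)) = Spin7"
    proof
      show "(\<Union>n\<in>cell_dims. char_map n ` rel_interior (cell_domain n)) \<subseteq> Spin7"
      proof (intro UN_least)
        fix n assume "n \<in> cell_dims"
        then show "char_map n ` rel_interior (cell_domain n) \<subseteq> Spin7"
          using image_mono[OF rel_interior_subset, of "char_map n" "cell_domain n"] image sub by fast
      qed
      show "Spin7 \<subseteq> (\<Union>n\<in>cell_dims. char_map n ` rel_interior (cell_domain n))"
      proof
        fix G assume G: "G \<in> Spin7"
        obtain b6 b7 b5 b3 v where "v \<in> open_params b6 b7 b5 b3" "G = prod_map b6 b7 b5 b3 v"
          using prod_map_exists[OF G] .
        then have "G \<in> char_map (prod_dim b6 b7 b5 b3) ` rel_interior (cell_domain (prod_dim b6 b7 b5 b3))"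
          by (simp add: prod_simps)
        then show "G \<in> (\<Union>n\<in>cell_dims. char_map n ` rel_interior (cell_domain n))"
          by (rule UN_I[OF prod_dim_mem])
      qed
    qed
  qed
qed

end
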